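(* Let $f$ satisfy the codifferentiability conditions of order $p\in[1,+\infty]$, and let either $1<p\le+\infty$, or the set $\Omega$ be bounded and have the segment property. Let $u_0\in W^{1,p}(\Omega;\mathbb{R}^m)$ be fixed and let $u_*$ be a locally optimal solution of the problem $$\min\ \mathcal{I}(u)=\int_\Omega f(x,u(x),\nabla u(x))\,dx,\qquad u\in u_0+W^{1,p}_0(\Omega;\mathbb{R}^m).$$ Then for any measurable selection $(0,w_1(\cdot),w_2(\cdot))$ of the set-valued map $\overline{d}_{u,\xi}f(\cdot,u_*(\cdot),\nabla u_*(\cdot))$ there exists $\zeta\in L^{p'}(\Omega;\mathbb{R}^{m\times d};\operatorname{div})$ satisfying the Euler–Lagrange inclusion $$(0,\operatorname{div}(\zeta)(x),\zeta(x))\in\underline{d}_{u,\xi}f(x,u_*(x),\nabla u_*(x))+(0,w_1(x),w_2(x))\quad\text{for a.e. }x\in\Omega.$$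
   Context: **Codifferentials.** Let $X$ be a real Banach space, $X^*$ its dual, $U\subseteq X$ open. A function $F:U\to\mathbb{R}$ is codifferentiable at $x\in U$ if there is a pair $DF(x)=[\underline{d}F(x),\overline{d}F(x)]$ (a codifferential) of convex subsets of $\mathbb{R}\times X^*$, compact in the product of the standard topology and the weak$^*$ topology, such that $\Phi_F(x,0)=\Psi_F(x,0)=0$ and for all $\Delta x\in X$ $$\lim_{\alpha\to+0}\frac1\alpha\big|F(x+\alpha\Delta x)-F(x)-\Phi_F(x,\alpha\Delta x)-\Psi_F(x,\alpha\Delta x)\big|=0,$$ where $\Phi_F(x,\Delta x)=\max_{(a,x^* )\in\underline{d}F(x)}(a+\langle x^*,\Delta x\rangle)$ and $\Psi_F(x,\Delta x)=\min_{(b,y^* )\in\overline{d}F(x)}(b+\langle y^*,\Delta x\rangle)$. Codifferentials are not unique. **Setting.** $\Omega\subseteq\mathbb{R}^d$ is an open set (not necessarily bounded), $f:\Omega\times\mathbb{R}^m\times\mathbb{R}^{m\times d}\to\mathbb{R}$, $f=f(x,u,\xi)$. $W^{1,p}(\Omega;\mathbb{R}^m)$, $1\le p\le+\infty$, is the Sobolev space with norm $\|u\|_{1,p}=(\|u\|_p^p+\|\nabla u\|_p^p)^{1/p}$ for $p<+\infty$, $\|u\|_{1,\infty}=\max\{\|u\|_\infty,\|\nabla u\|_\infty\}$; $W^{1,p}_0(\Omega;\mathbb{R}^m)$ is the closure of $C^\infty_c(\Omega;\mathbb{R}^m)$ in it; $1/p+1/p'=1$; $|\cdot|$ is the Euclidean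 norm. Local optimality is understood with respect to the norm of $W^{1,p}(\Omega;\mathbb{R}^m)$. For a.e. $x\in\Omega$ the function $(u,\xi)\mapsto f(x,u,\xi)$ is assumed codifferentiable at every point of $\mathbb{R}^m\times\mathbb{R}^{m\times d}$; $D_{u,\xi}f(x,u,\xi)=[\underline{d}_{u,\xi}f(x,u,\xi),\overline{d}_{u,\xi}f(x,u,\xi)]$ denotes a fixed choice of its codifferential, consisting of convex compact subsets of $\mathbb{R}\times\mathbb{R}^m\times\mathbb{R}^{m\times d}$. A (set-valued or single-valued) map $F(x,y)$ is a Carathéodory map if it is measurable in $x$ for every $y$ and continuous in $y$ for (a.e.) every $x$ (for compact-valued maps into $\mathbb{R}^k$: Hausdorff continuous). A measurable selection of a multifunction $G$ on $\Omega$ is a measurable $z$ with $z(x)\in G(x)$ for a.e. $x$. **Codifferentiability conditions of order $p$.** $f$ satisfies them if: (1) $f$ is a Carathéodory function, and: if $1\le p<+\infty$, there are an a.e. nonnegative $\beta\in L^1(\Omega)$ and $C>0$ with $|f(x,u,\xi)|\le\beta(x)+C(|u|^p+|\xi|^p)$ for a.e. $x$ and all $(u,\xi)$; if $p=+\infty$, for any $N>0$ there is an a.e. nonnegative $\beta_N\in L^1(\Omega)$ with $|f(x,u,\xi)|\le\beta_N(x)$ for a.e. $x$ and all $(u,\xi)$ with $\max\{|u|,|\xi|\}\le N$; (2) for a.e. $x$ the function $(u,\xi)\mapsto f(x,u,\xi)$ is codifferentiable on $\mathbb{R}^m\times\mathbb{R}^{m\times d}$, both $\underline{d}_{u,\xi}f$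 and $\overline{d}_{u,\xi}f$ are Carathéodory maps, and: if $1\le p<+\infty$, there are $C>0$ and a.e. nonnegative $\beta\in L^1(\Omega)$, $\gamma\in L^{p'}(\Omega)$ such that for a.e. $x$, all $(u,\xi)$, all $(a,v_1,v_2)\in\underline{d}_{u,\xi}f(x,u,\xi)$ and $(b,w_1,w_2)\in\overline{d}_{u,\xi}f(x,u,\xi)$: $\max\{|a|,|b|\}\le\beta(x)+C(|u|^p+|\xi|^p)$ and $\max\{|v_1|,|v_2|,|w_1|,|w_2|\}\le\gamma(x)+C(|u|^{p-1}+|\xi|^{p-1})$; if $p=+\infty$, for any $N>0$ there is an a.e. nonnegative $\beta_N\in L^1(\Omega)$ such that $\max\{|a|,|v_1|,|v_2|,|b|,|w_1|,|w_2|\}\le\beta_N(x)$ for a.e. $x$, for all such triples and all $(u,\xi)$ with $\max\{|u|,|\xi|\}\le N$. **Segment property.** $\Omega$ has the segment property if for every $x\in\partial\Omega$ there are a neighbourhood $U_x\subset\mathbb{R}^d$ of $x$ and a nonzero $y_x\in\mathbb{R}^d$ such that for any $z\in\operatorname{cl}\Omega\cap U_x$ one has $z+ty_x\in\Omega$ for all $t\in(0,1)$. **Weak divergence.** $v\in L^1_{loc}(\Omega)$ is the weak divergence of $u\in L^1_{loc}(\Omega;\mathbb{R}^d)$, $v=\operatorname{div}u$, if $\int_\Omega v\varphi\,dx=-\int_\Omega\langle u,\nabla\varphi\rangle dx$ for all $\varphi\in C_c^\infty(\Omega)$. $L^{q}(\Omega;\mathbb{R}^{m\times d};\operatorname{div})$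 is the space of all $u\in L^q(\Omega;\mathbb{R}^{m\times d})$ for which the row-wise weak divergence $\operatorname{div}u=(\operatorname{div}(u_{11},\dots,u_{1d}),\dots,\operatorname{div}(u_{m1},\dots,u_{md}))$ exists and belongs to $L^q(\Omega;\mathbb{R}^m)$. *)

theory Defs
  imports "HOL-Analysis.Analysis" "HOL-Probability.Essential_Supremum"
begin

section \<open>Codifferentials\<close>

text \<open>The dual of a Euclidean space is identified with the space itself through the inner product;
  the weak* topology is then the usual topology, so a codifferential is a pair of compact convex
  subsets of \<open>real \<times> 'a\<close>. On a nonempty compact set the \<open>SUP\<close> and \<open>INF\<close> below are attained.\<close>

definition codiff_Phi :: "(real \<times> 'a::euclidean_space) set \<Rightarrow> 'a \<Rightarrow> real" where
  "codiff_Phi A h = (SUP (a, v)\<in>A. a + v \<bullet> h)"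

definition codiff_Psi :: "(real \<times> 'a::euclidean_space) set \<Rightarrow> 'a \<Rightarrow> real" where
  "codiff_Psi B h = (INF (b, w)\<in>B. b + w \<bullet> h)"

definition has_codifferential ::
    "('a::euclidean_space \<Rightarrow> real) \<Rightarrow> (real \<times> 'a) set \<Rightarrow> (real \<times> 'a) set \<Rightarrow> 'a \<Rightarrow> bool" where
  "has_codifferential F A B y \<longleftrightarrow>
     A \<noteq> {} \<and> convex A \<and> compact A \<and> B \<noteq> {} \<and> convex B \<and> compact B \<and>
     codiff_Phi A 0 = 0 \<and> codiff_Psi B 0 = 0 \<and>
     (\<forall>h. ((\<lambda>\<alpha>. (1 / \<alpha>) * \<bar>F (y + \<alpha> *\<^sub>R h) - F y
                  - codiff_Phi A (\<alpha> *\<^sub>R h) - codiff_Psi B (\<alpha> *\<^sub>R h)\<bar>)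
            \<longlongrightarrow> 0) (at_right 0))"

lemma codiff_Phi_attained:
  fixes A :: "(real \<times> 'a::euclidean_space) set"
  assumes "compact A" "A \<noteq> {}"
  shows "\<exists>z\<in>A. codiff_Phi A h = fst z + snd z \<bullet> h"
    and "(a, v) \<in> A \<Longrightarrow> a + v \<bullet> h \<le> codiff_Phi A h"
proof -
  let ?g = "\<lambda>(a, v). a + v \<bullet> h"
  have "continuous_on A ?g"
    by (auto simp: case_prod_unfold intro!: continuous_intros)
  then obtain z where z: "z \<in> A" "\<forall>y\<in>A. ?g y \<le> ?g z"
    using continuous_attains_sup[OF assms] by blast
  then have "codiff_Phi A h = ?g z"
    unfolding codiff_Phi_def by (intro cSup_eq_maximum) auto
  with z show "\<exists>z\<in>A. codiff_Phi A h = fst z + snd z \<bullet> h"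
    and "(a, v) \<in> A \<Longrightarrow> a + v \<bullet> h \<le> codiff_Phi A h" by (auto simp: case_prod_unfold)
qed

lemma codiff_Psi_attained:
  fixes B :: "(real \<times> 'a::euclidean_space) set"
  assumes "compact B" "B \<noteq> {}"
  shows "\<exists>z\<in>B. codiff_Psi B h = fst z + snd z \<bullet> h"
    and "(b, w) \<in> B \<Longrightarrow> codiff_Psi B h \<le> b + w \<bullet> h"
proof -
  let ?g = "\<lambda>(b, w). b + w \<bullet> h"
  have "continuous_on B ?g"
    by (auto simp: case_prod_unfold intro!: continuous_intros)
  then obtain z where z: "z \<in> B" "\<forall>y\<in>B. ?g z \<le> ?g y"
    using continuous_attains_inf[OF assms] by blast
  then have "codiff_Psi B h = ?g z"
    unfolding codiff_Psi_def by (intro cInf_eq_minimum) auto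
  with z show "\<exists>z\<in>B. codiff_Psi B h = fst z + snd z \<bullet> h"
    and "(b, w) \<in> B \<Longrightarrow> codiff_Psi B h \<le> b + w \<bullet> h" by (auto simp: case_prod_unfold)
qed

section \<open>Caratheodory maps and measurable selections\<close>

definition caratheodory_fun ::
    "'x measure \<Rightarrow> ('x \<Rightarrow> 'y::topological_space \<Rightarrow> real) \<Rightarrow> bool" where
  "caratheodory_fun M F \<longleftrightarrow>
     (\<forall>y. (\<lambda>x. F x y) \<in> borel_measurable M) \<and> (AE x in M. continuous_on UNIV (F x))"

definition measurable_multifun :: "'x measure \<Rightarrow> ('x \<Rightarrow> 'z::topological_space set) \<Rightarrow> bool" where
  "measurable_multifun M G \<longleftrightarrow> (\<forall>V. open V \<longrightarrow> {x \<in> space M. G x \<inter> V \<noteq> {}} \<in> sets M)"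

text \<open>Meaningful for nonempty bounded arguments; it is only applied to the values of codifferentials.\<close>

definition hausdorff_dist :: "'z::metric_space set \<Rightarrow> 'z set \<Rightarrow> real" where
  "hausdorff_dist A B = max (SUP a\<in>A. infdist a B) (SUP b\<in>B. infdist b A)"

definition hausdorff_continuous :: "('y::topological_space \<Rightarrow> 'z::metric_space set) \<Rightarrow> bool" where
  "hausdorff_continuous G \<longleftrightarrow> (\<forall>y. ((\<lambda>y'. hausdorff_dist (G y') (G y)) \<longlongrightarrow> 0) (at y))"

definition caratheodory_multifun ::
    "'x measure \<Rightarrow> ('x \<Rightarrow> 'y::topological_space \<Rightarrow> 'z::metric_space set) \<Rightarrow> bool" where
  "caratheodory_multifun M G \<longleftrightarrow>
     (\<forall>y. measurable_multifun M (\<lambda>x. G x y)) \<and> (AE x in M. hausdorff_continuous (G x))"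

definition measurable_selection ::
    "'x measure \<Rightarrow> ('x \<Rightarrow> 'z::topological_space set) \<Rightarrow> ('x \<Rightarrow> 'z) \<Rightarrow> bool" where
  "measurable_selection M G z \<longleftrightarrow> z \<in> borel_measurable M \<and> (AE x in M. z x \<in> G x)"

section \<open>Lebesgue spaces\<close>

text \<open>Elements of function spaces are represented by functions, not by classes modulo equality
  almost everywhere. Only the values on \<open>\<Omega>\<close> matter for the spaces over \<open>\<Omega>\<close>.\<close>

definition conj_exponent :: "ennreal \<Rightarrow> ennreal" where
  "conj_exponent p = inverse (1 - inverse p)"

lemma conj_exponent:
  assumes "1 \<le> p"
  shows "inverse p + inverse (conj_exponent p) = 1"
proof -
  have "inverse p \<le> 1"
  proof (cases p)
    case (real r)
    with assms have "1 \<le> r" by simp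
    with real show ?thesis
      by (simp add: inverse_ennreal inverse_le_1_iff)
  qed simp
  moreover have "inverse (inverse z) = z" for z :: ennreal
  proof (cases z)
    case (real s)
    then show ?thesis by (cases "s = 0") (auto simp: inverse_ennreal)
  qed simp
  ultimately show ?thesis
    by (simp add: conj_exponent_def add_diff_inverse_ennreal)
qed

definition Lp :: "'x measure \<Rightarrow> ennreal \<Rightarrow> ('x \<Rightarrow> 'b::euclidean_space) set" where
  "Lp M p = {g \<in> borel_measurable M.
     if p = \<infinity> then esssup M (\<lambda>x. ennreal (norm (g x))) < \<infinity>
     else integrable M (\<lambda>x. norm (g x) powr enn2real p)}"

definition Lp_norm :: "'x measure \<Rightarrow> ennreal \<Rightarrow> ('x \<Rightarrow> 'b::euclidean_space) \<Rightarrow> real" where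
  "Lp_norm M p g =
     (if p = \<infinity> then enn2real (esssup M (\<lambda>x. ennreal (norm (g x))))
      else (LINT x|M. norm (g x) powr enn2real p) powr (1 / enn2real p))"

definition L1_loc :: "'a::euclidean_space set \<Rightarrow> ('a \<Rightarrow> 'b::euclidean_space) set" where
  "L1_loc \<Omega> = {g \<in> borel_measurable (lebesgue_on \<Omega>).
     \<forall>K. compact K \<and> K \<subseteq> \<Omega> \<longrightarrow> integrable (lebesgue_on K) g}"

section \<open>Test functions, weak derivatives and Sobolev spaces\<close>

text \<open>\<open>C_k k g\<close> means that \<open>g\<close> is \<open>k\<close> times continuously differentiable on the whole space.\<close>

primrec C_k :: "nat \<Rightarrow> ('a::euclidean_space \<Rightarrow> 'b::euclidean_space) \<Rightarrow> bool" where
  "C_k 0 g \<longleftrightarrow> continuous_on UNIV g"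
| "C_k (Suc k) g \<longleftrightarrow>
     g differentiable_on UNIV \<and> (\<forall>v. C_k k (\<lambda>x. frechet_derivative g (at x) v))"

text \<open>Elements of $C^\infty_c(\Omega)$, extended by zero to the whole space.\<close>

definition test_functions ::
    "'a::euclidean_space set \<Rightarrow> ('a \<Rightarrow> 'b::euclidean_space) set" where
  "test_functions \<Omega> = {\<phi>. (\<forall>k. C_k k \<phi>) \<and> compact (closure {x. \<phi> x \<noteq> 0})
                          \<and> closure {x. \<phi> x \<noteq> 0} \<subseteq> \<Omega>}"

definition grad :: "(real^'d::finite \<Rightarrow> real) \<Rightarrow> real^'d \<Rightarrow> real^'d" where
  "grad \<phi> x = (\<chi> j. frechet_derivative \<phi> (at x) (axis j 1))"

definition has_weak_gradient ::
    "(real^'d::finite) set \<Rightarrow> (real^'d \<Rightarrow> real^'m::finite) \<Rightarrow> (real^'d \<Rightarrow> real^'d^'m) \<Rightarrow> bool" where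
  "has_weak_gradient \<Omega> u G \<longleftrightarrow> u \<in> L1_loc \<Omega> \<and> G \<in> L1_loc \<Omega> \<and>
     (\<forall>\<phi>\<in>test_functions \<Omega>. \<forall>i j.
        (LINT x|lebesgue_on \<Omega>. u x $ i * grad \<phi> x $ j)
          = - (LINT x|lebesgue_on \<Omega>. G x $ i $ j * \<phi> x))"

text \<open>Weak gradients and weak divergences are unique up to equality almost everywhere in \<open>\<Omega>\<close>;
  an arbitrary representative is chosen.\<close>

definition weak_gradient ::
    "(real^'d::finite) set \<Rightarrow> (real^'d \<Rightarrow> real^'m::finite) \<Rightarrow> real^'d \<Rightarrow> real^'d^'m" where
  "weak_gradient \<Omega> u = (SOME G. has_weak_gradient \<Omega> u G)"

definition has_weak_div ::
    "(real^'d::finite) set \<Rightarrow> (real^'d \<Rightarrow> real^'d) \<Rightarrow> (real^'d \<Rightarrow> real) \<Rightarrow> bool" where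
  "has_weak_div \<Omega> u v \<longleftrightarrow> u \<in> L1_loc \<Omega> \<and> v \<in> L1_loc \<Omega> \<and>
     (\<forall>\<phi>\<in>test_functions \<Omega>.
        (LINT x|lebesgue_on \<Omega>. v x * \<phi> x) = - (LINT x|lebesgue_on \<Omega>. u x \<bullet> grad \<phi> x))"

definition weak_div :: "(real^'d::finite) set \<Rightarrow> (real^'d \<Rightarrow> real^'d) \<Rightarrow> real^'d \<Rightarrow> real" where
  "weak_div \<Omega> u = (SOME v. has_weak_div \<Omega> u v)"

definition weak_div_rows ::
    "(real^'d::finite) set \<Rightarrow> (real^'d \<Rightarrow> real^'d^'m::finite) \<Rightarrow> real^'d \<Rightarrow> real^'m" where
  "weak_div_rows \<Omega> \<zeta> x = (\<chi> i. weak_div \<Omega> (\<lambda>y. \<zeta> y $ i) x)"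

definition Lp_div ::
    "(real^'d::finite) set \<Rightarrow> ennreal \<Rightarrow> (real^'d \<Rightarrow> real^'d^'m::finite) set" where
  "Lp_div \<Omega> q = {\<zeta> \<in> Lp (lebesgue_on \<Omega>) q.
     (\<forall>i. \<exists>v. has_weak_div \<Omega> (\<lambda>y. \<zeta> y $ i) v) \<and> weak_div_rows \<Omega> \<zeta> \<in> Lp (lebesgue_on \<Omega>) q}"

definition W1p :: "(real^'d::finite) set \<Rightarrow> ennreal \<Rightarrow> (real^'d \<Rightarrow> real^'m::finite) set" where
  "W1p \<Omega> p = {u \<in> Lp (lebesgue_on \<Omega>) p.
     (\<exists>G. has_weak_gradient \<Omega> u G) \<and> weak_gradient \<Omega> u \<in> Lp (lebesgue_on \<Omega>) p}"

definition W1p_norm ::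
    "(real^'d::finite) set \<Rightarrow> ennreal \<Rightarrow> (real^'d \<Rightarrow> real^'m::finite) \<Rightarrow> real" where
  "W1p_norm \<Omega> p u =
     (let a = Lp_norm (lebesgue_on \<Omega>) p u; b = Lp_norm (lebesgue_on \<Omega>) p (weak_gradient \<Omega> u)
      in if p = \<infinity> then max a b
         else (a powr enn2real p + b powr enn2real p) powr (1 / enn2real p))"

definition W1p_0 :: "(real^'d::finite) set \<Rightarrow> ennreal \<Rightarrow> (real^'d \<Rightarrow> real^'m::finite) set" where
  "W1p_0 \<Omega> p = {u \<in> W1p \<Omega> p.
     \<forall>\<epsilon>>0. \<exists>\<phi>\<in>test_functions \<Omega>. W1p_norm \<Omega> p (\<lambda>x. u x - \<phi> x) < \<epsilon>}"

section \<open>The variational problem\<close>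

definition segment_property :: "(real^'d::finite) set \<Rightarrow> bool" where
  "segment_property \<Omega> \<longleftrightarrow>
     (\<forall>x\<in>frontier \<Omega>. \<exists>U y. open U \<and> x \<in> U \<and> y \<noteq> 0 \<and>
        (\<forall>z\<in>closure \<Omega> \<inter> U. \<forall>t\<in>{0<..<1}. z + t *\<^sub>R y \<in> \<Omega>))"

text \<open>\<open>ld\<close> and \<open>ud\<close> are the fixed choice of the hypo- and hyperdifferential of
  \<open>f x\<close> with respect to \<open>(u, \<xi>)\<close>. Since \<open>0 powr 0 = 0\<close>, the bound in the second
  condition reads \<open>\<gamma> x\<close> instead of \<open>\<gamma> x + 2 * C\<close> at \<open>u = 0\<close>, \<open>\<xi> = 0\<close> if \<open>p = 1\<close> (and similarly if
  only one of them vanishes); as \<open>\<gamma>\<close> is then any function in $L^\infty$, the constant can be absorbed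
  into it and the condition does not depend on this convention.\<close>

definition codifferentiability_conditions ::
    "(real^'d::finite) set \<Rightarrow> ennreal \<Rightarrow> (real^'d \<Rightarrow> real^'m::finite \<Rightarrow> real^'d^'m \<Rightarrow> real) \<Rightarrow>
     (real^'d \<Rightarrow> real^'m \<Rightarrow> real^'d^'m \<Rightarrow> (real \<times> (real^'m) \<times> (real^'d^'m)) set) \<Rightarrow>
     (real^'d \<Rightarrow> real^'m \<Rightarrow> real^'d^'m \<Rightarrow> (real \<times> (real^'m) \<times> (real^'d^'m)) set) \<Rightarrow> bool" where
  "codifferentiability_conditions \<Omega> p f ld ud \<longleftrightarrow>
     (let M = lebesgue_on \<Omega>; r = enn2real p in
      caratheodory_fun M (\<lambda>x (u, \<xi>). f x u \<xi>) \<and>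
      (if p < \<infinity> then
         \<exists>\<beta> C. integrable M \<beta> \<and> (AE x in M. 0 \<le> \<beta> x) \<and> 0 < C \<and>
           (AE x in M. \<forall>u \<xi>. \<bar>f x u \<xi>\<bar> \<le> \<beta> x + C * (norm u powr r + norm \<xi> powr r))
       else
         \<forall>N>0. \<exists>\<beta>. integrable M \<beta> \<and> (AE x in M. 0 \<le> \<beta> x) \<and>
           (AE x in M. \<forall>u \<xi>. max (norm u) (norm \<xi>) \<le> N \<longrightarrow> \<bar>f x u \<xi>\<bar> \<le> \<beta> x)) \<and>
      (AE x in M. \<forall>u \<xi>. has_codifferential (\<lambda>(u, \<xi>). f x u \<xi>) (ld x u \<xi>) (ud x u \<xi>) (u, \<xi>)) \<and>
      caratheodory_multifun M (\<lambda>x (u, \<xi>). ld x u \<xi>) \<and>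
      caratheodory_multifun M (\<lambda>x (u, \<xi>). ud x u \<xi>) \<and>
      (if p < \<infinity> then
         \<exists>C \<beta> \<gamma>. 0 < C \<and> integrable M \<beta> \<and> (AE x in M. 0 \<le> \<beta> x) \<and>
           \<gamma> \<in> Lp M (conj_exponent p) \<and> (AE x in M. 0 \<le> \<gamma> x) \<and>
           (AE x in M. \<forall>u \<xi>. \<forall>(a, v1, v2)\<in>ld x u \<xi>. \<forall>(b, w1, w2)\<in>ud x u \<xi>.
              Max {\<bar>a\<bar>, \<bar>b\<bar>} \<le> \<beta> x + C * (norm u powr r + norm \<xi> powr r) \<and>
              Max {norm v1, norm v2, norm w1, norm w2}
                \<le> \<gamma> x + C * (norm u powr (r - 1) + norm \<xi> powr (r - 1)))
       else
         \<forall>N>0. \<exists>\<beta>. integrable M \<beta> \<and> (AE x in M. 0 \<le> \<beta> x) \<and>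
           (AE x in M. \<forall>u \<xi>. max (norm u) (norm \<xi>) \<le> N \<longrightarrow>
              (\<forall>(a, v1, v2)\<in>ld x u \<xi>. \<forall>(b, w1, w2)\<in>ud x u \<xi>.
                 Max {\<bar>a\<bar>, norm v1, norm v2, \<bar>b\<bar>, norm w1, norm w2} \<le> \<beta> x))))"

definition functional_I ::
    "(real^'d::finite) set \<Rightarrow> (real^'d \<Rightarrow> real^'m::finite \<Rightarrow> real^'d^'m \<Rightarrow> real) \<Rightarrow>
     (real^'d \<Rightarrow> real^'m) \<Rightarrow> real" where
  "functional_I \<Omega> f u = (LINT x|lebesgue_on \<Omega>. f x (u x) (weak_gradient \<Omega> u x))"

definition admissible ::
    "(real^'d::finite) set \<Rightarrow> ennreal \<Rightarrow> (real^'d \<Rightarrow> real^'m::finite) \<Rightarrow> (real^'d \<Rightarrow> real^'m) set" where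
  "admissible \<Omega> p u0 = {(\<lambda>x. u0 x + h x) | h. h \<in> W1p_0 \<Omega> p}"

definition locally_optimal ::
    "(real^'d::finite) set \<Rightarrow> ennreal \<Rightarrow> (real^'d \<Rightarrow> real^'m::finite \<Rightarrow> real^'d^'m \<Rightarrow> real) \<Rightarrow>
     (real^'d \<Rightarrow> real^'m) \<Rightarrow> (real^'d \<Rightarrow> real^'m) \<Rightarrow> bool" where
  "locally_optimal \<Omega> p f u0 us \<longleftrightarrow> us \<in> admissible \<Omega> p u0 \<and>
     (\<exists>\<delta>>0. \<forall>u\<in>admissible \<Omega> p u0. W1p_norm \<Omega> p (\<lambda>x. u x - us x) < \<delta> \<longrightarrow>
        functional_I \<Omega> f us \<le> functional_I \<Omega> f u)"

end

theory Submission
  imports Defs "HOL-Library.Function_Algebras"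
begin

text \<open>
  Local optimality is tested only along smooth compactly supported directions \<open>h\<close>. Since
  \<open>\<Psi>\<close> is bounded above by the selected affine function \<open>w\<close> and \<open>\<Phi>\<close> is convex with \<open>\<Phi> 0 = 0\<close>,
  dominated convergence of the difference quotients shows that the convex integral functional
  \<open>Q H = \<integral> \<Phi>(x, H x) + w x \<bullet> H x\<close> is nonnegative on the subspace of all pairs \<open>H = (h, \<nabla>h)\<close>.
  By Hahn-Banach some linear functional below \<open>Q\<close> vanishes on that subspace; the growth conditions
  make it continuous on a weighted \<open>L\<^sup>1\<close> space, hence it is integration against a function
  \<open>v = (v\<^sub>1, \<zeta>)\<close>. Localizing \<open>v \<le> Q\<close> gives \<open>v x - w x\<close> in the zero section of the
  hypodifferential almost everywhere, and vanishing on the pairs \<open>(h, \<nabla>h)\<close> says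
  \<open>div \<zeta> = v\<^sub>1\<close>. No compactness in \<open>L\<^sup>p\<close> is needed, so all exponents are treated alike.
\<close>

section \<open>Domination of linear functionals by convex functionals\<close>

text \<open>What shapes the proof is the need for a space on which \<open>Q\<close> is finite and
  whose bounded functionals are functions; for \<open>p = \<infinity>\<close> the Sobolev space
  itself does not qualify. The growth conditions supply a bound \<open>\<sigma>\<close> in
  \<open>L^p'\<close> for the second components of both codifferentials along the solution, hence
  \<open>\<bar>\<Phi>(x, \<xi>) + w x \<bullet> \<xi>\<bar> \<le> 2 * \<sigma> x * norm
  \<xi>\<close>. As \<open>\<sigma>\<close> is locally integrable and the pairs
  \<open>(h, \<nabla>h)\<close> are bounded with compact support, these pairs lie in
  \<open>L^1\<close> with weight \<open>2 * \<sigma> + 1\<close>; the summand 1 makes the weight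
  positive, so that it can be divided out. The space \<open>L^p'\<close> is never dualized: that
  \<open>v\<close> belongs to it is read off at the end, because \<open>v x - w x\<close> lies in a
  set bounded by \<open>\<sigma> x\<close>. The expansion defining a codifferential is only
  directional and pointwise. The integrable majorant for dominated convergence therefore comes from
  a mean value inequality, proved from one-sided expansions at all points of a segment. The limit is
  one-sided too: replacing \<open>\<Psi>\<close> by \<open>w\<close> leaves an upper estimate of the
  difference quotients, the direction that minimality needs.\<close>

definition sublinear :: "('v::real_vector \<Rightarrow> real) \<Rightarrow> bool" where
  "sublinear q \<longleftrightarrow> (\<forall>x y. q (x + y) \<le> q x + q y) \<and> (\<forall>c>0. \<forall>x. q (c *\<^sub>R x) \<le> c * q x)"

lemma sublinearI:
  assumes "\<And>x y. q (x + y) \<le> q x + q y" "\<And>c x. 0 < c \<Longrightarrow> q (c *\<^sub>R x) \<le> c * q x"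
  shows "sublinear q"
  using assms by (simp add: sublinear_def)

text \<open>The inequality in \<open>sublinear_def\<close> already forces equality: apply it to
  \<open>c *\<^sub>R x\<close> with the factor \<open>inverse c\<close>, and to 0 with the factors 2
  and 1/2.\<close>

lemma
  assumes "sublinear q"
  shows sublinear_add: "q (x + y) \<le> q x + q y"
    and sublinear_0: "q 0 = 0"
    and sublinear_scale: "0 \<le> c \<Longrightarrow> q (c *\<^sub>R x) = c * q x"
    and sublinear_neg: "- q (- x) \<le> q x"
proof -
  show add: "q (x + y) \<le> q x + q y" for x y
    using assms by (simp add: sublinear_def)
  have le: "q (c *\<^sub>R x) \<le> c * q x" if "0 < c" for c x
    using assms that by (simp add: sublinear_def)
  show z: "q 0 = 0"
    using le[of 2 0] le[of "1/2" 0] by simp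
  show "q (c *\<^sub>R x) = c * q x" if "0 \<le> c" for c
  proof (cases "c = 0")
    case False
    with that have c: "0 < c" by simp
    have "q x \<le> inverse c * q (c *\<^sub>R x)"
      using le[of "inverse c" "c *\<^sub>R x"] c by simp
    then have "c * q x \<le> q (c *\<^sub>R x)"
      using c by (simp add: field_simps)
    with le[OF c, of x] show ?thesis by simp
  qed (simp add: z)
  show "- q (- x) \<le> q x"
    using add[of x "- x"] z by simp
qed

text \<open>The hypotheses are the form of directedness that survives an infimum: two members,
  evaluated at different points, are beaten by a single member at the sum. It serves the translates
  in the minimality argument, the chains in Zorn's lemma and the homogenization of a convex
  function.\<close>

lemma sublinear_INF:
  fixes f :: "'i \<Rightarrow> 'v::real_vector \<Rightarrow> real"
  assumes ne: "I \<noteq> {}" and bdd: "\<And>x. bdd_below ((\<lambda>i. f i x) ` I)"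
    and add: "\<And>i j x y. i \<in> I \<Longrightarrow> j \<in> I \<Longrightarrow> \<exists>k\<in>I. f k (x + y) \<le> f i x + f j y"
    and scale: "\<And>i c x. i \<in> I \<Longrightarrow> 0 < c \<Longrightarrow> \<exists>k\<in>I. f k (c *\<^sub>R x) \<le> c * f i x"
  shows "sublinear (\<lambda>x. INF i\<in>I. f i x)"
proof -
  define r where "r x = (INF i\<in>I. f i x)" for x
  have r_le: "r x \<le> f i x" if "i \<in> I" for i x
    unfolding r_def by (rule cINF_lower[OF bdd that])
  have r_ge: "m \<le> r x" if "\<And>i. i \<in> I \<Longrightarrow> m \<le> f i x" for m x
    unfolding r_def using that by (rule cINF_greatest[OF ne])
  have "sublinear r"
  proof (rule sublinearI)
    fix x y
    have 1: "r (x + y) \<le> f i x + f j y" if ij: "i \<in> I" "j \<in> I" for i j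
      using add[OF ij, of x y] r_le order_trans by blast
    have "r (x + y) - f i x \<le> r y" if "i \<in> I" for i
      by (rule r_ge) (use 1[OF that] in \<open>simp add: algebra_simps\<close>)
    then have "r (x + y) - r y \<le> r x"
      by (intro r_ge) (simp add: algebra_simps)
    then show "r (x + y) \<le> r x + r y" by simp
  next
    fix c :: real and x assume c: "0 < c"
    have "r (c *\<^sub>R x) / c \<le> r x"
    proof (rule r_ge)
      fix i assume "i \<in> I"
      then obtain k where "k \<in> I" "f k (c *\<^sub>R x) \<le> c * f i x" using scale c by blast
      then show "r (c *\<^sub>R x) / c \<le> f i x"
        using r_le[of k "c *\<^sub>R x"] c by (simp add: field_simps)
    qed
    then show "r (c *\<^sub>R x) \<le> c * r x"
      using c by (simp add: field_simps)
  qed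
  then show ?thesis by (simp add: r_def[abs_def])
qed

text \<open>Minimality is tested against \<open>r x\<close>, the infimum over
  \<open>t \<ge> 0\<close> of \<open>q (x + t *\<^sub>R y) - t * q y\<close>. It is sublinear, lies
  below \<open>q\<close> by \<open>t = 0\<close>, and is finite because
  \<open>q (t *\<^sub>R y) \<le> q (x + t *\<^sub>R y) + q (- x)\<close>. Then \<open>r = q\<close>
  with \<open>t = 1\<close> gives superadditivity in the direction \<open>y\<close>.\<close>

lemma minimal_sublinear_linear:
  fixes q :: "'v::real_vector \<Rightarrow> real"
  assumes q: "sublinear q" and min: "\<And>r. sublinear r \<Longrightarrow> (\<And>x. r x \<le> q x) \<Longrightarrow> r = q"
  shows "linear q"
proof -
  have super: "q x + q y \<le> q (x + y)" for x y
  proof -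
    define r where "r x = (INF t\<in>{0..}. q (x + t *\<^sub>R y) - t * q y)" for x
    have bdd: "bdd_below ((\<lambda>t. q (x + t *\<^sub>R y) - t * q y) ` {0..})" for x
    proof (rule bdd_belowI2)
      fix t :: real assume "t \<in> {0..}"
      then show "- q (- x) \<le> q (x + t *\<^sub>R y) - t * q y"
        using sublinear_add[OF q, of "x + t *\<^sub>R y" "- x"] sublinear_scale[OF q, of t y] by simp
    qed
    have r_le: "r x \<le> q (x + t *\<^sub>R y) - t * q y" if "0 \<le> t" for x t
      unfolding r_def using that by (intro cINF_lower bdd) auto
    have "sublinear r"
      unfolding r_def[abs_def]
    proof (rule sublinear_INF[OF _ bdd])
      fix t s :: real and x x' assume "t \<in> {0..}" "s \<in> {0..}"
      then show "\<exists>k\<in>{0..}. q (x + x' + k *\<^sub>R y) - k * q y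
          \<le> (q (x + t *\<^sub>R y) - t * q y) + (q (x' + s *\<^sub>R y) - s * q y)"
        using sublinear_add[OF q, of "x + t *\<^sub>R y" "x' + s *\<^sub>R y"]
        by (intro bexI[of _ "t + s"]) (auto simp: algebra_simps)
    next
      fix t c :: real and x assume "t \<in> {0..}" "0 < c"
      then show "\<exists>k\<in>{0..}. q (c *\<^sub>R x + k *\<^sub>R y) - k * q y \<le> c * (q (x + t *\<^sub>R y) - t * q y)"
        using sublinear_scale[OF q, of c "x + t *\<^sub>R y"]
        by (intro bexI[of _ "c * t"]) (auto simp: algebra_simps)
    qed simp
    moreover have "r x \<le> q x" for x
      using r_le[of 0 x] by simp
    ultimately have "r = q" by (rule min)
    then show ?thesis
      using r_le[of 1 x] by simp
  qed
  have add: "q (x + y) = q x + q y" for x y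
    using super[of x y] sublinear_add[OF q, of x y] by simp
  have neg: "q (- x) = - q x" for x
    using add[of x "- x"] sublinear_0[OF q] by simp
  show ?thesis
  proof (rule linearI)
    fix c :: real and x
    show "q (c *\<^sub>R x) = c *\<^sub>R q x"
    proof (cases "0 \<le> c")
      case False
      then have "q ((- c) *\<^sub>R x) = - c * q x"
        by (intro sublinear_scale[OF q]) simp
      then show ?thesis using neg[of "c *\<^sub>R x"] by simp
    qed (simp add: sublinear_scale[OF q])
  qed (rule add)
qed

text \<open>The algebraic Hahn-Banach theorem, without extension from a subspace: Zorn's lemma
  yields a minimal sublinear functional below \<open>P\<close>, and minimal ones are linear.
  Prescribed values on a subspace are later built into \<open>P\<close> itself.\<close>

lemma sublinear_dominates_linear:
  fixes P :: "'v::real_vector \<Rightarrow> real"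
  assumes P: "sublinear P"
  shows "\<exists>l. linear l \<and> (\<forall>x. l x \<le> P x)"
proof -
  define A where "A = {q. sublinear q \<and> (\<forall>x. q x \<le> P x)}"
  \<comment> \<open>\<open>R\<close> is the reversed pointwise order, so the maximal element
    produced by Zorn's lemma is a minimal functional.\<close>
  define R where "R = (\<lambda>a b :: 'v \<Rightarrow> real. \<forall>x. b x \<le> a x)"
  have "\<exists>m\<in>A. \<forall>a\<in>A. R m a \<longrightarrow> a = m"
  proof (rule predicate_Zorn)
    show "partial_order_on A (relation_of R A)"
      by (rule partial_order_on_relation_ofI)
        (auto simp: R_def intro: order_trans[rotated] intro!: ext order_antisym)
  next
    fix C assume C: "C \<in> Chains (relation_of R A)"
    then have CA: "C \<subseteq> A" and tot: "\<And>a b. a \<in> C \<Longrightarrow> b \<in> C \<Longrightarrow> R a b \<or> R b a"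
      by (auto simp: Chains_def relation_of_def)
    show "\<exists>u\<in>A. \<forall>a\<in>C. R a u"
    proof (cases "C = {}")
      case True
      then show ?thesis using P by (intro bexI[of _ P]) (auto simp: A_def)
    next
      case False
      define u where "u x = (INF q\<in>C. q x)" for x
      have sub: "sublinear q" "q x \<le> P x" if "q \<in> C" for q x
        using that CA by (auto simp: A_def)
      \<comment> \<open>No member of the chain can fall below \<open>- P (- x)\<close>, so the
        infimum along the chain is a real number.\<close>
      have bdd: "bdd_below ((\<lambda>q. q x) ` C)" for x
      proof (rule bdd_belowI2)
        fix q assume "q \<in> C"
        then show "- P (- x) \<le> q x"
          using sublinear_neg[OF sub(1), of q x] sub(2)[of q "- x"] by linarith
      qed
      have u_le: "u x \<le> q x" if "q \<in> C" for q x
        unfolding u_def using that by (intro cINF_lower bdd) auto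
      have "sublinear u"
        unfolding u_def[abs_def]
      proof (rule sublinear_INF[OF False bdd])
        fix q q' x y assume q: "q \<in> C" "q' \<in> C"
        show "\<exists>k\<in>C. k (x + y) \<le> q x + q' y"
        proof (cases "R q q'")
          case True
          then show ?thesis
            using q sublinear_add[OF sub(1)[OF q(2)], of x y]
            by (intro bexI[of _ q']) (auto simp: R_def intro: order_trans)
        next
          case False
          with tot[OF q] have "R q' q" by simp
          then show ?thesis
            using q sublinear_add[OF sub(1)[OF q(1)], of x y]
            by (intro bexI[of _ q]) (auto simp: R_def intro: order_trans)
        qed
      qed (use sublinear_scale[OF sub(1)] in \<open>force intro: bexI\<close>)
      moreover obtain q where "q \<in> C" using False by blast
      ultimately have "u \<in> A"
        using order_trans[OF u_le[of q] sub(2)[of q]] by (auto simp: A_def)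
      then show ?thesis
        using u_le by (intro bexI[of _ u]) (auto simp: R_def)
    qed
  qed
  then obtain q where q: "q \<in> A" and min: "\<And>a. a \<in> A \<Longrightarrow> R q a \<Longrightarrow> a = q" by blast
  have "linear q"
  proof (rule minimal_sublinear_linear)
    show "sublinear q" using q by (simp add: A_def)
    fix r assume r: "sublinear r" "\<And>x. r x \<le> q x"
    moreover have "r \<in> A"
      using q r order_trans by (fastforce simp: A_def)
    ultimately show "r = q"
      by (intro min) (auto simp: R_def)
  qed
  then show ?thesis using q by (auto simp: A_def)
qed

text \<open>\<open>P\<close> makes \<open>Q\<close> positively homogeneous by the infimum of
  \<open>Q (t x) / t\<close> and at the same time divides out \<open>S\<close>. A linear
  \<open>l \<le> P\<close> is below \<open>Q\<close> by the choice \<open>t = 1\<close>,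
  \<open>s = 0\<close>, and is nonpositive on \<open>S\<close> by the choice \<open>s = - x\<close>;
  on a subspace this means zero.\<close>

lemma convex_dominates_linear:
  fixes Q :: "'v::real_vector \<Rightarrow> real"
  assumes Q: "convex_on UNIV Q" "Q 0 = 0" and S: "subspace S" and nonneg: "\<And>s. s \<in> S \<Longrightarrow> 0 \<le> Q s"
  shows "\<exists>l. linear l \<and> (\<forall>x. l x \<le> Q x) \<and> (\<forall>s\<in>S. l s = 0)"
proof -
  define I where "I = {0 :: real <..} \<times> S"
  define P where "P x = (INF i\<in>I. Q (fst i *\<^sub>R (x + snd i)) / fst i)" for x
  have cvx: "Q (a *\<^sub>R x + b *\<^sub>R y) \<le> a * Q x + b * Q y" if "0 \<le> a" "0 \<le> b" "a + b = 1" for a b x y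
    using Q(1) that by (simp add: convex_on_def)
  \<comment> \<open>The point \<open>(t / (1 + t)) *\<^sub>R s\<close> of \<open>S\<close>, where
    \<open>Q\<close> is nonnegative, is the convex combination of \<open>t *\<^sub>R (x + s)\<close>
    and \<open>- x\<close> with weights \<open>1 / (1 + t)\<close> and \<open>t / (1 + t)\<close>;
    the arbitrary \<open>s\<close> thus drops out of the lower bound.\<close>
  have bound: "- Q (- x) \<le> Q (t *\<^sub>R (x + s)) / t" if "0 < t" "s \<in> S" for t s x
  proof -
    have t: "1 + t \<noteq> 0" using that by simp
    have "(1 / (1 + t)) *\<^sub>R (t *\<^sub>R (x + s)) + (t / (1 + t)) *\<^sub>R (- x) = (t / (1 + t)) *\<^sub>R s"
      by (simp add: algebra_simps)
    moreover have "0 \<le> Q ((t / (1 + t)) *\<^sub>R s)"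
      using that S by (intro nonneg subspace_scale)
    ultimately have "0 \<le> (1 / (1 + t)) * Q (t *\<^sub>R (x + s)) + (t / (1 + t)) * Q (- x)"
      using cvx[of "1 / (1 + t)" "t / (1 + t)" "t *\<^sub>R (x + s)" "- x"] that t
      by (simp add: add_divide_distrib[symmetric])
    then show ?thesis using that
      by (simp add: field_simps add_divide_distrib[symmetric])
  qed
  have bdd: "bdd_below ((\<lambda>i. Q (fst i *\<^sub>R (x + snd i)) / fst i) ` I)" for x
    by (rule bdd_belowI2[where m = "- Q (- x)"]) (auto simp: I_def bound)
  have P_le: "P x \<le> Q (t *\<^sub>R (x + s)) / t" if "0 < t" "s \<in> S" for t s x
    unfolding P_def using that cINF_lower[OF bdd, of "(t, s)" x] by (auto simp: I_def)
  have "sublinear P"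
    unfolding P_def[abs_def]
  proof (rule sublinear_INF[OF _ bdd])
    show "I \<noteq> {}"
      using subspace_0[OF S] by (auto simp: I_def intro!: exI[of _ 1])
  next
    fix i j x x' assume ij: "i \<in> I" "j \<in> I"
    obtain t s t' s' where i: "i = (t, s)" and j: "j = (t', s')" by fastforce
    have *: "0 < t" "s \<in> S" "0 < t'" "s' \<in> S" using ij by (auto simp: I_def i j)
    \<comment> \<open>The scale is half the harmonic mean of \<open>t\<close> and \<open>t'\<close>:
      then \<tau> times the sum is a convex combination of the two given points, and division by
      \<tau> turns its weights into \<open>1 / t\<close> and \<open>1 / t'\<close>.\<close>
    define \<tau> where "\<tau> = t * t' / (t + t')"
    have \<tau>: "0 < \<tau>" using * by (simp add: \<tau>_def)
    have 2: "\<tau> = (t' / (t + t')) * t" "\<tau> = (t / (t + t')) * t'"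
      by (simp_all add: \<tau>_def)
    have "\<tau> *\<^sub>R ((x + x') + (s + s')) = \<tau> *\<^sub>R (x + s) + \<tau> *\<^sub>R (x' + s')"
      by (simp add: algebra_simps)
    also have "\<dots> = (t' / (t + t')) *\<^sub>R t *\<^sub>R (x + s) + (t / (t + t')) *\<^sub>R t' *\<^sub>R (x' + s')"
      unfolding scaleR_scaleR 2[symmetric] ..
    finally have "Q (\<tau> *\<^sub>R ((x + x') + (s + s')))
        \<le> (t' / (t + t')) * Q (t *\<^sub>R (x + s)) + (t / (t + t')) * Q (t' *\<^sub>R (x' + s'))"
      using * by (simp only:) (intro cvx; simp add: add_divide_distrib[symmetric])
    also have "\<dots> = (Q (t *\<^sub>R (x + s)) / t + Q (t' *\<^sub>R (x' + s')) / t') * \<tau>"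
      using * unfolding \<tau>_def distrib_right by (simp add: mult.commute)
    finally have "Q (\<tau> *\<^sub>R ((x + x') + (s + s'))) / \<tau> \<le> Q (t *\<^sub>R (x + s)) / t + Q (t' *\<^sub>R (x' + s')) / t'"
      unfolding pos_divide_le_eq[OF \<tau>] .
    then show "\<exists>k\<in>I. Q (fst k *\<^sub>R (x + x' + snd k)) / fst k
        \<le> Q (fst i *\<^sub>R (x + snd i)) / fst i + Q (fst j *\<^sub>R (x' + snd j)) / fst j"
      using \<tau> * subspace_add[OF S] by (intro bexI[of _ "(\<tau>, s + s')"]) (auto simp: I_def i j)
  next
    \<comment> \<open>For an index \<open>(t, s)\<close> the witness is
      \<open>(t / c, c *\<^sub>R s)\<close>, because \<open>(t / c) *\<^sub>R (c *\<^sub>R x + c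
      *\<^sub>R s) = t *\<^sub>R (x + s)\<close>.\<close>
    fix i x and c :: real assume "i \<in> I" "0 < c"
    then show "\<exists>k\<in>I. Q (fst k *\<^sub>R (c *\<^sub>R x + snd k)) / fst k \<le> c * (Q (fst i *\<^sub>R (x + snd i)) / fst i)"
      using subspace_scale[OF S]
      by (intro bexI[of _ "(fst i / c, c *\<^sub>R snd i)"]) (auto simp: I_def algebra_simps)
  qed
  then obtain l where l: "linear l" "\<And>x. l x \<le> P x"
    using sublinear_dominates_linear by blast
  have "l x \<le> Q x" for x
    using l(2)[of x] P_le[of 1 0 x] subspace_0[OF S] by simp
  moreover have "l s = 0" if "s \<in> S" for s
  proof -
    have 1: "l s \<le> 0" if "s \<in> S" for s
      using l(2)[of s] P_le[of 1 "- s" s] subspace_neg[OF S that] Q(2) by simp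
    show ?thesis
      using 1[OF that] 1[OF subspace_neg[OF S that]] linear_neg[OF l(1), of s] by simp
  qed
  ultimately show ?thesis using l(1) by blast
qed

text \<open>Integral functionals are convex only on integrable functions, while
  \<open>linear\<close> speaks of total maps. A linear projection \<open>g\<close> onto
  \<open>V\<close> carries \<open>Q\<close> to a convex function on the whole space and does not
  change it on \<open>V\<close>.\<close>

lemma convex_dominates_linear_on:
  fixes Q :: "'v::real_vector \<Rightarrow> real"
  assumes V: "subspace V" and Q: "convex_on V Q" "Q 0 = 0"
    and S: "subspace S" "S \<subseteq> V" and nonneg: "\<And>s. s \<in> S \<Longrightarrow> 0 \<le> Q s"
  shows "\<exists>l. linear l \<and> (\<forall>x\<in>V. l x \<le> Q x) \<and> (\<forall>s\<in>S. l s = 0)"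
proof -
  obtain g :: "'v \<Rightarrow> 'v" where g: "range g \<subseteq> V" "linear g" "\<And>v. v \<in> V \<Longrightarrow> g v = v"
    using linear_exists_left_inverse_on[OF linear_id V] by auto
  have "convex_on UNIV (\<lambda>x. Q (g x))"
  proof (rule convex_onI)
    fix t :: real and x y assume "0 < t" "t < 1"
    then show "Q (g ((1 - t) *\<^sub>R x + t *\<^sub>R y)) \<le> (1 - t) * Q (g x) + t * Q (g y)"
      using convex_onD[OF Q(1), of t "g x" "g y"] g(1)
      by (auto simp: linear_add[OF g(2)] linear_scale[OF g(2)])
  qed simp
  moreover have "Q (g 0) = 0" using Q(2) by (simp add: linear_0[OF g(2)])
  moreover have "0 \<le> Q (g s)" if "s \<in> S" for s
    using that S(2) nonneg g(3) by force
  ultimately obtain l where "linear l" "\<And>x. l x \<le> Q (g x)" "\<And>s. s \<in> S \<Longrightarrow> l s = 0"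
    using convex_dominates_linear[of "\<lambda>x. Q (g x)" S] S(1) by blast
  then show ?thesis using g(3) by metis
qed

text \<open>Hahn-Banach is applied to functions themselves and not to classes modulo null sets. A
  functional bounded by an integral seminorm ignores null sets anyway.\<close>

instantiation "fun" :: (type, real_vector) real_vector
begin

definition scaleR_fun :: "real \<Rightarrow> ('a \<Rightarrow> 'b) \<Rightarrow> 'a \<Rightarrow> 'b" where
  "scaleR_fun c f = (\<lambda>x. c *\<^sub>R f x)"

instance
  by standard (auto simp: scaleR_fun_def plus_fun_def algebra_simps)

end

section \<open>Integral functionals with convex integrands\<close>

lemma sum_fun_apply: "(\<Sum>i\<in>I. F i) x = (\<Sum>i\<in>I. F i x)"
  by (induction I rule: infinite_finite_induct) auto

text \<open>The dual of \<open>L^1\<close> over a finite measure, obtained from the Radon-Nikodym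
  theorem: the values of \<open>l\<close> on indicators form a countably additive set function, its
  density represents \<open>l\<close> on indicators, and the seminorm bound extends the formula to
  all integrable functions.\<close>

lemma L1_functional_representation:
  fixes l :: "('x \<Rightarrow> real) \<Rightarrow> real"
  assumes "finite_measure M" and l: "linear l"
    and bound: "\<And>g. integrable M g \<Longrightarrow> \<bar>l g\<bar> \<le> C * (LINT x|M. \<bar>g x\<bar>)"
  shows "\<exists>v\<in>borel_measurable M. \<forall>g. integrable M g \<longrightarrow>
           integrable M (\<lambda>x. v x * g x) \<and> l g = (LINT x|M. v x * g x)"
proof -
  interpret finite_measure M by fact
  \<comment> \<open>Adding \<open>C * measure M A\<close> makes the set function nonnegative, so
    positive measures suffice; the constant is subtracted from the density again in
    \<open>v\<close>.\<close>
  define m where "m A = l (indicator A) + C * measure M A" for A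
  have bound_ind: "\<bar>l (indicator A)\<bar> \<le> C * measure M A" if "A \<in> sets M" for A
  proof -
    have "integrable M (indicat_real A)"
      using that by (intro integrable_real_indicator) (auto simp: less_top[symmetric])
    then show ?thesis
      using bound[of "indicator A"] that by simp
  qed
  have m_nonneg: "0 \<le> m A" if "A \<in> sets M" for A
    using bound_ind[OF that] by (simp add: m_def)
  define N where "N = measure_of (space M) (sets M) (\<lambda>A. ennreal (m A))"
  have sets_N: "sets N = sets M"
    by (simp add: N_def)
  \<comment> \<open>By additivity the error after \<open>n\<close> terms is the value of
    \<open>l\<close> on the indicator of the tail, whose measure tends to 0.\<close>
  have l_sums: "(\<lambda>i. l (indicator (A i))) sums l (indicator (\<Union>i. A i))"
    if A: "range A \<subseteq> sets M" "disjoint_family A" for A :: "nat \<Rightarrow> 'x set"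
  proof -
    have [measurable]: "A i \<in> sets M" for i using A by auto
    define U where "U = (\<Union>i. A i)"
    have [measurable]: "U \<in> sets M" unfolding U_def by measurable
    have fin: "(\<lambda>i. measure M (A i)) sums measure M U"
      unfolding U_def by (rule finite_measure_UNION[OF A])
    have le: "\<bar>(\<Sum>i<n. l (indicator (A i))) - l (indicator U)\<bar>
        \<le> C * (measure M U - (\<Sum>i<n. measure M (A i)))" for n
    proof -
      define P where "P = (\<Union>i<n. A i)"
      have [measurable]: "P \<in> sets M" and PU: "P \<subseteq> U" unfolding P_def U_def by auto
      have disj: "disjoint_family_on A {..<n}"
        using A(2) by (rule disjoint_family_on_mono[rotated]) simp
      have "(\<Sum>i<n. indicator (A i)) = (indicator P :: 'x \<Rightarrow> real)"
        unfolding P_def by (rule ext) (simp add: sum_fun_apply indicator_UN_disjoint[OF _ disj])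
      then have "(\<Sum>i<n. l (indicator (A i))) = l (indicator P)"
        by (simp add: linear_sum[OF l, symmetric])
      moreover have "indicator U = indicator P + (indicator (U - P) :: 'x \<Rightarrow> real)"
        using PU by (intro ext) (auto simp: indicator_def)
      then have "l (indicator U) = l (indicator P) + l (indicator (U - P))"
        by (simp add: linear_add[OF l])
      moreover have "measure M P = (\<Sum>i<n. measure M (A i))"
        unfolding P_def by (rule finite_measure_finite_Union) (use disj in auto)
      moreover have "measure M (U - P) = measure M U - measure M P"
        by (rule finite_measure_Diff) (use PU in auto)
      ultimately show ?thesis
        using bound_ind[of "U - P"] by simp
    qed
    have "(\<lambda>n. (\<Sum>i<n. l (indicator (A i))) - l (indicator U)) \<longlonglongrightarrow> 0"
    proof (rule Lim_null_comparison)
      show "(\<lambda>n. C * (measure M U - (\<Sum>i<n. measure M (A i)))) \<longlonglongrightarrow> 0"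
        using fin unfolding sums_def by (auto intro!: tendsto_eq_intros)
    qed (use le in auto)
    then show ?thesis
      unfolding sums_def U_def[symmetric] by (simp add: LIM_zero_iff)
  qed
  have emeasure_N: "emeasure N A = ennreal (m A)" if "A \<in> sets M" for A
    unfolding N_def
  proof (rule emeasure_measure_of_sigma)
    show "sigma_algebra (space M) (sets M)" ..
    show "positive (sets M) (\<lambda>A. ennreal (m A))"
      using bound_ind[of "{}"] by (simp add: positive_def m_def)
    show "countably_additive (sets M) (\<lambda>A. ennreal (m A))"
    proof (rule countably_additiveI)
      fix A :: "nat \<Rightarrow> 'x set" assume A: "range A \<subseteq> sets M" "disjoint_family A" "(\<Union>i. A i) \<in> sets M"
      have "(\<lambda>i. m (A i)) sums m (\<Union>i. A i)"
        unfolding m_def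
        by (intro sums_add sums_mult l_sums[OF A(1,2)] finite_measure_UNION[OF A(1,2)])
      then show "(\<Sum>i. ennreal (m (A i))) = ennreal (m (\<Union>i. A i))"
        using A by (intro suminf_ennreal_eq m_nonneg) auto
    qed
  qed fact
  have "absolutely_continuous M N"
    unfolding absolutely_continuous_def
  proof
    fix A assume A: "A \<in> null_sets M"
    then have "measure M A = 0" "A \<in> sets M" by (auto simp: measure_eq_emeasure_eq_ennreal null_sets_def measure_def)
    then show "A \<in> null_sets N"
      using bound_ind[of A] by (simp add: null_sets_def sets_N emeasure_N m_def)
  qed
  then obtain f where f[measurable]: "f \<in> borel_measurable M" and N: "density M f = N"
    using Radon_Nikodym[OF _ sets_N] by blast
  have f_int: "(\<integral>\<^sup>+x. f x * indicator A x \<partial>M) = ennreal (m A)" if "A \<in> sets M" for A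
    using emeasure_N[OF that] that by (simp add: N[symmetric] emeasure_density)
  define f' where "f' x = enn2real (f x)" for x
  have [measurable]: "f' \<in> borel_measurable M" unfolding f'_def by measurable
  have "(\<integral>\<^sup>+x. f x \<partial>M) = ennreal (m (space M))"
    using f_int[of "space M"] by (simp cong: nn_integral_cong)
  then have fin: "AE x in M. f x \<noteq> \<infinity>"
    by (intro nn_integral_noteq_infinite) auto
  then have ff': "AE x in M. f x = ennreal (f' x)"
    by eventually_elim (simp add: f'_def less_top)
  have f'_ind: "has_bochner_integral M (\<lambda>x. f' x * indicator A x) (m A)" if [measurable]: "A \<in> sets M" for A
  proof (rule has_bochner_integral_nn_integral)
    have "(\<integral>\<^sup>+x. ennreal (f' x * indicator A x) \<partial>M) = (\<integral>\<^sup>+x. f x * indicator A x \<partial>M)"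
      using ff' by (intro nn_integral_cong_AE) (auto split: split_indicator)
    then show "(\<integral>\<^sup>+x. ennreal (f' x * indicator A x) \<partial>M) = ennreal (m A)"
      using f_int[OF that] by simp
  qed (auto simp: f'_def m_nonneg that)
  define v where "v x = f' x - C" for x
  have [measurable]: "v \<in> borel_measurable M" unfolding v_def by measurable
  have v_ind: "has_bochner_integral M (\<lambda>x. v x * indicator A x) (l (indicator A))"
    if [measurable]: "A \<in> sets M" for A
  proof -
    have "has_bochner_integral M (\<lambda>x. f' x * indicator A x - C * indicator A x) (m A - C * measure M A)"
      by (intro has_bochner_integral_diff f'_ind has_bochner_integral_mult_right
          has_bochner_integral_real_indicator) (auto simp: less_top[symmetric])
    then show ?thesis by (simp add: v_def m_def left_diff_distrib)
  qed
  have v_int: "integrable M v"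
    using v_ind[of "space M"]
    by (simp add: has_bochner_integral_iff cong: Bochner_Integration.integrable_cong)
  \<comment> \<open>Only this side of \<open>\<bar>v x\<bar> \<le> C\<close> needs an argument; the
    other one holds because \<open>f'\<close> is nonnegative.\<close>
  have "AE x in M. 0 \<le> C - v x"
  proof (rule density_nonneg)
    show "integrable M (\<lambda>x. C - v x)" using v_int by simp
    fix A assume A[measurable]: "A \<in> sets M"
    have "has_bochner_integral M (\<lambda>x. C * indicator A x - v x * indicator A x) (C * measure M A - l (indicator A))"
      by (intro has_bochner_integral_diff v_ind has_bochner_integral_mult_right
          has_bochner_integral_real_indicator) (auto simp: less_top[symmetric])
    then have "set_lebesgue_integral M A (\<lambda>x. C - v x) = C * measure M A - l (indicator A)"
      unfolding set_lebesgue_integral_def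
      by (subst has_bochner_integral_integral_eq[symmetric]) (auto simp: algebra_simps)
    then show "0 \<le> set_lebesgue_integral M A (\<lambda>x. C - v x)"
      using bound_ind[OF A] by simp
  qed
  then have v_le: "AE x in M. \<bar>v x\<bar> \<le> C"
    by eventually_elim (auto simp: v_def f'_def abs_le_iff)
  have vg_int: "integrable M (\<lambda>x. v x * g x)" if g: "integrable M g" for g
  proof (rule Bochner_Integration.integrable_bound)
    show "integrable M (\<lambda>x. C * g x)" using g by simp
    show "AE x in M. norm (v x * g x) \<le> norm (C * g x)"
      using v_le by eventually_elim (auto simp: abs_mult intro!: mult_right_mono)
  qed (use g in measurable)
  have "l g = (LINT x|M. v x * g x)" if "integrable M g" for g
    using that
  proof (induction rule: integrable_induct)
    case (base A c)
    have "(\<lambda>x. indicator A x *\<^sub>R c) = c *\<^sub>R (indicator A :: 'x \<Rightarrow> real)"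
      by (auto simp: scaleR_fun_def)
    then have "l (\<lambda>x. indicator A x *\<^sub>R c) = c * l (indicator A)"
      by (simp add: linear_scale[OF l])
    then show ?case
      using has_bochner_integral_integral_eq[OF v_ind[OF base(1)]]
      by (simp add: integral_mult_left_zero mult.assoc[symmetric])
  next
    case (add f g)
    have "l (\<lambda>x. f x + g x) = l f + l g"
      using linear_add[OF l, of f g] by (simp add: plus_fun_def)
    with add show ?case
      using vg_int by (simp add: distrib_left)
  next
    case (lim f s)
    have "(\<lambda>i. LINT x|M. \<bar>s i x - f x\<bar>) \<longlonglongrightarrow> (LINT x|M. 0)"
    proof (rule integral_dominated_convergence)
      \<comment> \<open>The approximating simple functions satisfy
        \<open>\<bar>s i x\<bar> \<le> 2 * \<bar>f x\<bar>\<close>, whence the constant 3 for the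
        difference from \<open>f\<close>.\<close>
      show "integrable M (\<lambda>x. 3 * \<bar>f x\<bar>)" using lim.hyps(4) by simp
      show "AE x in M. (\<lambda>i. \<bar>s i x - f x\<bar>) \<longlonglongrightarrow> 0"
        using lim.hyps(2) by (intro AE_I2 tendsto_rabs_zero LIM_zero)
      show "AE x in M. norm \<bar>s i x - f x\<bar> \<le> 3 * \<bar>f x\<bar>" for i
      proof (intro AE_I2)
        fix x assume "x \<in> space M"
        from lim.hyps(3)[OF this, of i] show "norm \<bar>s i x - f x\<bar> \<le> 3 * \<bar>f x\<bar>"
          by simp
      qed
    qed (use lim.hyps(1,4) in auto)
    then have C0: "(\<lambda>i. C * (LINT x|M. \<bar>s i x - f x\<bar>)) \<longlonglongrightarrow> 0"
      by (auto intro!: tendsto_eq_intros)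
    have "\<bar>l (s i) - l f\<bar> \<le> C * (LINT x|M. \<bar>s i x - f x\<bar>)" for i
      using bound[of "\<lambda>x. s i x - f x"] lim.hyps(1,4) linear_diff[OF l, of "s i" f]
      by (simp add: fun_diff_def)
    then have "(\<lambda>i. l (s i) - l f) \<longlonglongrightarrow> 0"
      by (intro Lim_null_comparison[OF _ C0] always_eventually) auto
    then have 1: "(\<lambda>i. l (s i)) \<longlonglongrightarrow> l f"
      by (simp add: LIM_zero_iff)
    have 2: "(\<lambda>i. LINT x|M. v x * s i x) \<longlonglongrightarrow> (LINT x|M. v x * f x)"
    proof (rule integral_dominated_convergence)
      show "integrable M (\<lambda>x. C * (2 * \<bar>f x\<bar>))" using lim.hyps(4) by simp
      show "AE x in M. (\<lambda>i. v x * s i x) \<longlonglongrightarrow> v x * f x"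
        using lim.hyps(2) by (intro AE_I2 tendsto_intros)
      show "AE x in M. norm (v x * s i x) \<le> C * (2 * \<bar>f x\<bar>)" for i
        using v_le AE_space
      proof eventually_elim
        case (elim x)
        then show ?case
          using mult_mono[OF elim(1) lim.hyps(3)[OF elim(2), of i]] by (simp add: abs_mult)
      qed
    qed (use lim.hyps(1,4) in auto)
    have "(\<lambda>i. l (s i)) \<longlonglongrightarrow> (LINT x|M. v x * f x)"
      using 2 unfolding lim.IH .
    with 1 show ?case by (rule LIMSEQ_unique)
  qed
  with vg_int show ?thesis
    by (intro bexI[of _ v]) auto
qed

text \<open>One scalar density for each basis vector; the constant is inherited because basis
  vectors have norm 1.\<close>

lemma L1_functional_representation_vector:
  fixes l :: "('x \<Rightarrow> 'e::euclidean_space) \<Rightarrow> real"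
  assumes M: "finite_measure M" and l: "linear l"
    and bound: "\<And>g. integrable M g \<Longrightarrow> \<bar>l g\<bar> \<le> C * (LINT x|M. norm (g x))"
  shows "\<exists>v\<in>borel_measurable M. \<forall>g. integrable M g \<longrightarrow>
           integrable M (\<lambda>x. v x \<bullet> g x) \<and> l g = (LINT x|M. v x \<bullet> g x)"
proof -
  have "\<exists>v\<in>borel_measurable M. \<forall>g. integrable M g \<longrightarrow>
           integrable M (\<lambda>x. v x * g x) \<and> l (\<lambda>x. g x *\<^sub>R b) = (LINT x|M. v x * g x)"
    if b: "b \<in> Basis" for b
  proof (rule L1_functional_representation[OF M])
    show "linear (\<lambda>g. l (\<lambda>x. g x *\<^sub>R b))"
    proof (rule linearI)
      fix f g :: "'x \<Rightarrow> real"
      show "l (\<lambda>x. (f + g) x *\<^sub>R b) = l (\<lambda>x. f x *\<^sub>R b) + l (\<lambda>x. g x *\<^sub>R b)"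
        using linear_add[OF l, of "\<lambda>x. f x *\<^sub>R b" "\<lambda>x. g x *\<^sub>R b"]
        by (simp add: plus_fun_def scaleR_left_distrib)
    next
      fix c and g :: "'x \<Rightarrow> real"
      show "l (\<lambda>x. (c *\<^sub>R g) x *\<^sub>R b) = c *\<^sub>R l (\<lambda>x. g x *\<^sub>R b)"
        using linear_scale[OF l, of c "\<lambda>x. g x *\<^sub>R b"]
        by (simp add: scaleR_fun_def)
    qed
    show "\<bar>l (\<lambda>x. g x *\<^sub>R b)\<bar> \<le> C * (LINT x|M. \<bar>g x\<bar>)" if "integrable M g" for g
      using bound[of "\<lambda>x. g x *\<^sub>R b"] that b by simp
  qed
  then obtain v where v: "\<And>b. b \<in> Basis \<Longrightarrow> v b \<in> borel_measurable M"
    and int: "\<And>b g. b \<in> Basis \<Longrightarrow> integrable M g \<Longrightarrow> integrable M (\<lambda>x. v b x * g x)"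
    and eq: "\<And>b g. b \<in> Basis \<Longrightarrow> integrable M g \<Longrightarrow> l (\<lambda>x. g x *\<^sub>R b) = (LINT x|M. v b x * g x)"
    by metis
  define V where "V x = (\<Sum>b\<in>Basis. v b x *\<^sub>R b)" for x
  have inner_V: "V x \<bullet> g = (\<Sum>b\<in>Basis. v b x * (g \<bullet> b))" for x g
    unfolding V_def inner_sum_left inner_scaleR_left by (simp add: inner_commute)
  have "V \<in> borel_measurable M"
    unfolding V_def[abs_def] using v by (intro borel_measurable_sum borel_measurable_scaleR) auto
  moreover have "integrable M (\<lambda>x. V x \<bullet> g x) \<and> l g = (LINT x|M. V x \<bullet> g x)"
    if g: "integrable M g" for g
  proof
    have gb: "integrable M (\<lambda>x. g x \<bullet> b)" for b using g by simp
    show "integrable M (\<lambda>x. V x \<bullet> g x)"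
      unfolding inner_V by (intro Bochner_Integration.integrable_sum int gb)
    have "g = (\<Sum>b\<in>Basis. (\<lambda>x. (g x \<bullet> b) *\<^sub>R b))"
      by (rule ext) (simp add: sum_fun_apply euclidean_representation)
    then have "l g = (\<Sum>b\<in>Basis. l (\<lambda>x. (g x \<bullet> b) *\<^sub>R b))"
      using linear_sum[OF l, of "\<lambda>b x. (g x \<bullet> b) *\<^sub>R b" Basis] by simp
    also have "\<dots> = (\<Sum>b\<in>Basis. LINT x|M. v b x * (g x \<bullet> b))"
      by (intro sum.cong refl eq gb)
    also have "\<dots> = (LINT x|M. V x \<bullet> g x)"
      unfolding inner_V by (rule Bochner_Integration.integral_sum[symmetric]) (intro int gb)
    finally show "l g = (LINT x|M. V x \<bullet> g x)" .
  qed
  ultimately show ?thesis by blast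
qed

text \<open>An inequality known almost everywhere for each fixed \<xi> has an exceptional set that
  depends on \<xi>. Countably many \<xi> can be handled at once, and continuity of finite convex
  functions in finite dimension gives the remaining ones.\<close>

lemma inner_le_convex_from_dense:
  fixes f :: "'e::euclidean_space \<Rightarrow> real"
  assumes D: "\<And>U :: 'e set. open U \<Longrightarrow> U \<noteq> {} \<Longrightarrow> \<exists>d\<in>D. d \<in> U"
    and f: "convex_on UNIV f" and le: "\<And>d. d \<in> D \<Longrightarrow> v \<bullet> d \<le> f d"
  shows "v \<bullet> \<xi> \<le> f \<xi>"
proof (rule ccontr)
  assume "\<not> v \<bullet> \<xi> \<le> f \<xi>"
  moreover have "continuous_on UNIV f"
    using convex_on_continuous[OF open_UNIV f] .
  then have "open {x. f x < v \<bullet> x}"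
    by (intro open_Collect_less continuous_intros)
  ultimately obtain d where "d \<in> D" "f d < v \<bullet> d"
    using D[of "{x. f x < v \<bullet> x}"] by (metis empty_Collect_eq mem_Collect_eq not_le)
  then show False using le[of d] by simp
qed

text \<open>The bound \<open>norm \<xi>\<close> is a normalization: it keeps the integral functional
  \<open>Q\<close> below the \<open>L^1\<close> norm, so every linear functional below
  \<open>Q\<close> is bounded by that norm with constant 1 and has a density
  \<open>v\<close>.\<close>

lemma integral_convex_selection_finite:
  fixes \<Phi> :: "'x \<Rightarrow> 'e::euclidean_space \<Rightarrow> real"
  assumes "finite_measure M"
    and meas: "\<And>g. g \<in> borel_measurable M \<Longrightarrow> (\<lambda>x. \<Phi> x (g x)) \<in> borel_measurable M"
    and cvx: "AE x in M. convex_on UNIV (\<Phi> x)"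
    and bound: "AE x in M. \<forall>\<xi>. \<bar>\<Phi> x \<xi>\<bar> \<le> norm \<xi>"
    and S: "subspace S" "\<And>g. g \<in> S \<Longrightarrow> integrable M g"
      "\<And>g. g \<in> S \<Longrightarrow> 0 \<le> (LINT x|M. \<Phi> x (g x))"
  shows "\<exists>v\<in>borel_measurable M. (AE x in M. \<forall>\<xi>. v x \<bullet> \<xi> \<le> \<Phi> x \<xi>) \<and>
           (\<forall>g\<in>S. (LINT x|M. v x \<bullet> g x) = 0)"
proof -
  interpret finite_measure M by fact
  define V where "V = {g :: 'x \<Rightarrow> 'e. integrable M g}"
  define Q where "Q g = (LINT x|M. \<Phi> x (g x))" for g
  have int: "integrable M (\<lambda>x. \<Phi> x (g x))" if g: "integrable M g" for g
  proof (rule Bochner_Integration.integrable_bound)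
    show "integrable M (\<lambda>x. norm (g x))" using g by simp
    show "(\<lambda>x. \<Phi> x (g x)) \<in> borel_measurable M" using g by (intro meas) auto
    show "AE x in M. norm (\<Phi> x (g x)) \<le> norm (norm (g x))"
      using bound by eventually_elim simp
  qed
  have Q_le: "\<bar>Q g\<bar> \<le> (LINT x|M. norm (g x))" if g: "integrable M g" for g
  proof -
    have "\<bar>Q g\<bar> \<le> (LINT x|M. \<bar>\<Phi> x (g x)\<bar>)"
      unfolding Q_def using integral_norm_bound[of M "\<lambda>x. \<Phi> x (g x)"] by simp
    also have "\<dots> \<le> (LINT x|M. norm (g x))"
    proof (rule integral_mono_AE)
      show "AE x in M. \<bar>\<Phi> x (g x)\<bar> \<le> norm (g x)"
        using bound by eventually_elim simp
    qed (use int[OF g] g in auto)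
    finally show ?thesis .
  qed
  have V: "subspace V"
    by (auto simp: subspace_def V_def plus_fun_def zero_fun_def scaleR_fun_def)
  have "\<exists>l. linear l \<and> (\<forall>x\<in>V. l x \<le> Q x) \<and> (\<forall>s\<in>S. l s = 0)"
  proof (rule convex_dominates_linear_on[OF V])
    show "convex_on V Q"
    proof (rule convex_onI)
      fix t :: real and f g assume t: "0 < t" "t < 1" and fg: "f \<in> V" "g \<in> V"
      have "Q ((1 - t) *\<^sub>R f + t *\<^sub>R g) \<le> (LINT x|M. (1 - t) * \<Phi> x (f x) + t * \<Phi> x (g x))"
        unfolding Q_def
      proof (rule integral_mono_AE)
        show "AE x in M. \<Phi> x (((1 - t) *\<^sub>R f + t *\<^sub>R g) x) \<le> (1 - t) * \<Phi> x (f x) + t * \<Phi> x (g x)"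
          using cvx
        proof eventually_elim
          case (elim x)
          then show ?case
            using convex_onD[OF elim, of t "f x" "g x"] t by (simp add: scaleR_fun_def)
        qed
        show "integrable M (\<lambda>x. \<Phi> x (((1 - t) *\<^sub>R f + t *\<^sub>R g) x))"
          using fg V by (intro int) (auto simp: V_def scaleR_fun_def)
      qed (use fg in \<open>auto simp: V_def int\<close>)
      then show "Q ((1 - t) *\<^sub>R f + t *\<^sub>R g) \<le> (1 - t) * Q f + t * Q g"
        using fg by (simp add: Q_def int V_def)
    qed (rule subspace_imp_convex[OF V])
    show "Q 0 = 0" using Q_le[of 0] by (simp add: zero_fun_def)
  qed (use S in \<open>auto simp: V_def Q_def\<close>)
  then obtain l where l: "linear l" and l_le: "\<And>g. integrable M g \<Longrightarrow> l g \<le> Q g"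
    and l_S: "\<And>s. s \<in> S \<Longrightarrow> l s = 0"
    by (auto simp: V_def)
  have "\<bar>l g\<bar> \<le> 1 * (LINT x|M. norm (g x))" if g: "integrable M g" for g
  proof -
    have "- l g = l (- g)" by (simp add: linear_neg[OF l])
    moreover have "integrable M (- g)" using g by (simp add: fun_Compl_def)
    ultimately show ?thesis
      using l_le[OF g] l_le[of "- g"] Q_le[OF g] Q_le[of "- g"] by (simp add: fun_Compl_def)
  qed
  then obtain v where v[measurable]: "v \<in> borel_measurable M"
    and v_int: "\<And>g. integrable M g \<Longrightarrow> integrable M (\<lambda>x. v x \<bullet> g x)"
    and v_eq: "\<And>g. integrable M g \<Longrightarrow> l g = (LINT x|M. v x \<bullet> g x)"
    using L1_functional_representation_vector[OF assms(1) l] by metis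
  \<comment> \<open>The global inequality \<open>l \<le> Q\<close> is localized by functions equal
    to \<xi> on an arbitrary set \<open>A\<close> and to 0 elsewhere; off \<open>A\<close> the
    integrand vanishes because \<open>\<Phi> x 0 = 0\<close>.\<close>
  have le: "AE x in M. v x \<bullet> \<xi> \<le> \<Phi> x \<xi>" for \<xi>
  proof -
    have "AE x in M. 0 \<le> \<Phi> x \<xi> - v x \<bullet> \<xi>"
    proof (rule density_nonneg)
      show "integrable M (\<lambda>x. \<Phi> x \<xi> - v x \<bullet> \<xi>)"
        using int[of "\<lambda>_. \<xi>"] v_int[of "\<lambda>_. \<xi>"] by simp
      fix A assume A[measurable]: "A \<in> sets M"
      have ind: "integrable M (\<lambda>x. indicator A x *\<^sub>R \<xi>)"
        by (simp add: integrable_indicator_iff less_top[symmetric])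
      have \<Phi>0: "AE x in M. \<Phi> x 0 = 0"
        using bound by eventually_elim (metis abs_le_zero_iff norm_zero)
      have "set_lebesgue_integral M A (\<lambda>x. \<Phi> x \<xi> - v x \<bullet> \<xi>)
          = (LINT x|M. \<Phi> x (indicator A x *\<^sub>R \<xi>) - v x \<bullet> (indicator A x *\<^sub>R \<xi>))"
        unfolding set_lebesgue_integral_def
      proof (rule integral_cong_AE)
        show "AE x in M. indicat_real A x *\<^sub>R (\<Phi> x \<xi> - v x \<bullet> \<xi>)
            = \<Phi> x (indicator A x *\<^sub>R \<xi>) - v x \<bullet> (indicator A x *\<^sub>R \<xi>)"
          using \<Phi>0 by eventually_elim (auto split: split_indicator)
        show "(\<lambda>x. indicat_real A x *\<^sub>R (\<Phi> x \<xi> - v x \<bullet> \<xi>)) \<in> borel_measurable M"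
          using meas[of "\<lambda>_. \<xi>"] by measurable
        show "(\<lambda>x. \<Phi> x (indicator A x *\<^sub>R \<xi>) - v x \<bullet> (indicator A x *\<^sub>R \<xi>)) \<in> borel_measurable M"
          using meas[of "\<lambda>x. indicator A x *\<^sub>R \<xi>"] by measurable
      qed
      also have "\<dots> = Q (\<lambda>x. indicator A x *\<^sub>R \<xi>) - l (\<lambda>x. indicator A x *\<^sub>R \<xi>)"
        unfolding v_eq[OF ind] Q_def
        by (rule Bochner_Integration.integral_diff[OF int[OF ind] v_int[OF ind]])
      finally show "0 \<le> set_lebesgue_integral M A (\<lambda>x. \<Phi> x \<xi> - v x \<bullet> \<xi>)"
        using l_le[OF ind] by simp
    qed
    then show ?thesis by simp
  qed
  obtain D :: "'e set" where D: "countable D" "\<And>U :: 'e set. open U \<Longrightarrow> U \<noteq> {} \<Longrightarrow> \<exists>d\<in>D. d \<in> U"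
    using countable_dense_exists by blast
  have "AE x in M. \<forall>d\<in>D. v x \<bullet> d \<le> \<Phi> x d"
    using le D(1) by (simp add: AE_ball_countable)
  then have "AE x in M. \<forall>\<xi>. v x \<bullet> \<xi> \<le> \<Phi> x \<xi>"
    using cvx by eventually_elim (use inner_le_convex_from_dense[OF D(2)] in blast)
  moreover have "(LINT x|M. v x \<bullet> g x) = 0" if "g \<in> S" for g
    using v_eq[OF S(2)[OF that]] l_S[OF that] by simp
  ultimately show ?thesis using v by blast
qed

text \<open>Weight and infinite measure are removed together: the measure is replaced by a finite
  one with positive density \<rho>, which exists by sigma-finiteness, and the argument of
  \<open>\<Phi> x\<close> is rescaled.\<close>

lemma integral_convex_selection:
  fixes \<Phi> :: "'x \<Rightarrow> 'e::euclidean_space \<Rightarrow> real" and \<kappa> :: "'x \<Rightarrow> real"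
  assumes "sigma_finite_measure M"
    and meas: "\<And>g. g \<in> borel_measurable M \<Longrightarrow> (\<lambda>x. \<Phi> x (g x)) \<in> borel_measurable M"
    and cvx: "AE x in M. convex_on UNIV (\<Phi> x)"
    and \<kappa>[measurable]: "\<kappa> \<in> borel_measurable M" and \<kappa>_pos: "\<And>x. 0 < \<kappa> x"
    and bound: "AE x in M. \<forall>\<xi>. \<bar>\<Phi> x \<xi>\<bar> \<le> \<kappa> x * norm \<xi>"
    and S: "subspace S" "\<And>g. g \<in> S \<Longrightarrow> g \<in> borel_measurable M"
      "\<And>g. g \<in> S \<Longrightarrow> integrable M (\<lambda>x. \<kappa> x * norm (g x))"
      "\<And>g. g \<in> S \<Longrightarrow> 0 \<le> (LINT x|M. \<Phi> x (g x))"
  shows "\<exists>v\<in>borel_measurable M. (AE x in M. \<forall>\<xi>. v x \<bullet> \<xi> \<le> \<Phi> x \<xi>) \<and>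
           (\<forall>g\<in>S. (LINT x|M. v x \<bullet> g x) = 0)"
proof -
  interpret sigma_finite_measure M by fact
  obtain \<rho> :: "'x \<Rightarrow> real" where \<rho>[measurable]: "\<rho> \<in> borel_measurable M"
    and \<rho>_pos: "\<And>x. 0 < \<rho> x" and \<rho>_int: "integrable M \<rho>"
    by (rule obtain_positive_integrable_function) blast
  define N where "N = density M (\<lambda>x. ennreal (\<rho> x))"
  have sets_N[measurable_cong]: "sets N = sets M" by (simp add: N_def)
  have AE_N: "(AE x in N. P x) \<longleftrightarrow> (AE x in M. P x)" for P
    unfolding N_def using \<rho>_pos by (subst AE_density) auto
  have fin: "finite_measure N"
  proof
    have "emeasure N (space N) = (\<integral>\<^sup>+x. ennreal (\<rho> x) \<partial>M)"
      by (simp add: N_def emeasure_density cong: nn_integral_cong)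
    also have "\<dots> < \<infinity>"
      using \<rho>_int \<rho>_pos by (simp add: integrable_iff_bounded less_imp_le)
    finally show "emeasure N (space N) \<noteq> \<infinity>" by simp
  qed
  have int_N: "integrable N g \<longleftrightarrow> integrable M (\<lambda>x. \<rho> x *\<^sub>R g x)" if "g \<in> borel_measurable M"
    for g :: "'x \<Rightarrow> 'c::{banach, second_countable_topology}"
    unfolding N_def using \<rho>_pos that by (intro integrable_density) (auto simp: less_imp_le)
  have integral_N: "integral\<^sup>L N g = (LINT x|M. \<rho> x *\<^sub>R g x)" if "g \<in> borel_measurable M"
    for g :: "'x \<Rightarrow> real"
    unfolding N_def using \<rho>_pos that by (intro integral_density) (auto simp: less_imp_le)
  have nz: "\<rho> x \<noteq> 0" "\<kappa> x \<noteq> 0" for x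
    using \<rho>_pos[of x] \<kappa>_pos[of x] by auto
  \<comment> \<open>The scale is fixed by \<open>\<kappa> x * \<tau> x = \<rho> x\<close>. It makes
    \<open>\<bar>\<Phi> x (\<tau> x *\<^sub>R \<xi>)\<bar> / \<rho> x \<le> norm \<xi>\<close>, and
    the \<open>L^1(N)\<close> norm of \<open>T h\<close> equals the \<kappa>-weighted
    \<open>L^1(M)\<close> norm of \<open>h\<close>.\<close>
  define \<tau> where "\<tau> x = \<rho> x / \<kappa> x" for x
  have [measurable]: "\<tau> \<in> borel_measurable M" unfolding \<tau>_def[abs_def] by measurable
  have \<tau>_pos: "0 < \<tau> x" for x
    using \<rho>_pos[of x] \<kappa>_pos[of x] by (simp add: \<tau>_def)
  define T where "T g = (\<lambda>x. (1 / \<tau> x) *\<^sub>R g x)" for g :: "'x \<Rightarrow> 'e"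
  have T: "linear T"
    by (rule linearI) (auto simp: T_def plus_fun_def scaleR_fun_def algebra_simps)
  have "\<exists>v\<in>borel_measurable N. (AE x in N. \<forall>\<xi>. v x \<bullet> \<xi> \<le> \<Phi> x (\<tau> x *\<^sub>R \<xi>) / \<rho> x) \<and>
           (\<forall>g\<in>T ` S. (LINT x|N. v x \<bullet> g x) = 0)"
  proof (rule integral_convex_selection_finite[OF fin])
    fix g :: "'x \<Rightarrow> 'e" assume [measurable]: "g \<in> borel_measurable N"
    have [measurable]: "(\<lambda>x. \<Phi> x (\<tau> x *\<^sub>R g x)) \<in> borel_measurable M"
      by (intro meas) measurable
    show "(\<lambda>x. \<Phi> x (\<tau> x *\<^sub>R g x) / \<rho> x) \<in> borel_measurable N"
      by measurable
  next
    show "AE x in N. convex_on UNIV (\<lambda>\<xi>. \<Phi> x (\<tau> x *\<^sub>R \<xi>) / \<rho> x)"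
      unfolding AE_N using cvx
    proof eventually_elim
      case (elim x)
      show ?case
      proof (rule convex_onI)
        fix t :: real and \<xi> \<eta> :: 'e assume "0 < t" "t < 1"
        then have "\<Phi> x ((1 - t) *\<^sub>R \<tau> x *\<^sub>R \<xi> + t *\<^sub>R \<tau> x *\<^sub>R \<eta>)
            \<le> (1 - t) * \<Phi> x (\<tau> x *\<^sub>R \<xi>) + t * \<Phi> x (\<tau> x *\<^sub>R \<eta>)"
          by (intro convex_onD[OF elim]) auto
        then show "\<Phi> x (\<tau> x *\<^sub>R ((1 - t) *\<^sub>R \<xi> + t *\<^sub>R \<eta>)) / \<rho> x
            \<le> (1 - t) * (\<Phi> x (\<tau> x *\<^sub>R \<xi>) / \<rho> x) + t * (\<Phi> x (\<tau> x *\<^sub>R \<eta>) / \<rho> x)"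
          using \<rho>_pos[of x]
          by (simp add: divide_right_mono add_divide_distrib[symmetric] scaleR_add_right mult.commute)
      qed simp
    qed
    show "AE x in N. \<forall>\<xi>. \<bar>\<Phi> x (\<tau> x *\<^sub>R \<xi>) / \<rho> x\<bar> \<le> norm \<xi>"
      unfolding AE_N using bound
    proof eventually_elim
      case (elim x)
      show ?case
      proof
        fix \<xi>
        have "\<bar>\<Phi> x (\<tau> x *\<^sub>R \<xi>)\<bar> \<le> \<kappa> x * (\<tau> x * norm \<xi>)"
          using elim[rule_format, of "\<tau> x *\<^sub>R \<xi>"] \<tau>_pos[of x] by simp
        also have "\<dots> = \<rho> x * norm \<xi>" using nz by (simp add: \<tau>_def)
        finally show "\<bar>\<Phi> x (\<tau> x *\<^sub>R \<xi>) / \<rho> x\<bar> \<le> norm \<xi>"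
          using \<rho>_pos[of x] by (simp add: abs_divide divide_le_eq mult.commute)
      qed
    qed
    show "subspace (T ` S)"
      by (rule linear_subspace_image[OF T S(1)])
    fix g assume "g \<in> T ` S"
    then obtain h where h: "h \<in> S" "g = T h" by blast
    have [measurable]: "h \<in> borel_measurable M" "T h \<in> borel_measurable M"
      using S(2)[OF h(1)] by (auto simp: T_def)
    show "integrable N g"
      unfolding h(2)
    proof (subst int_N)
      show "integrable M (\<lambda>x. \<rho> x *\<^sub>R T h x)"
      proof (rule Bochner_Integration.integrable_bound[OF S(3)[OF h(1)]])
        show "AE x in M. norm (\<rho> x *\<^sub>R T h x) \<le> norm (\<kappa> x * norm (h x))"
          using \<rho>_pos \<kappa>_pos nz by (simp add: T_def \<tau>_def abs_mult)
      qed measurable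
    qed measurable
    have [measurable]: "(\<lambda>x. \<Phi> x (h x)) \<in> borel_measurable M"
      by (intro meas) measurable
    have "(LINT x|N. \<Phi> x (\<tau> x *\<^sub>R T h x) / \<rho> x) = (LINT x|M. \<Phi> x (h x))"
      using \<tau>_pos nz by (subst integral_N) (auto simp: T_def less_imp_neq[symmetric])
    then show "0 \<le> (LINT x|N. \<Phi> x (\<tau> x *\<^sub>R g x) / \<rho> x)"
      using S(4)[OF h(1)] h(2) by simp
  qed
  then obtain v where v[measurable]: "v \<in> borel_measurable N"
    and v_le: "AE x in M. \<forall>\<xi>. v x \<bullet> \<xi> \<le> \<Phi> x (\<tau> x *\<^sub>R \<xi>) / \<rho> x"
    and v_S: "\<And>g. g \<in> S \<Longrightarrow> (LINT x|N. v x \<bullet> T g x) = 0"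
    unfolding AE_N by auto
  show ?thesis
  proof (intro bexI conjI ballI)
    \<comment> \<open>Undoing the substitution multiplies \<open>v\<close> by
      \<open>\<rho> x / \<tau> x\<close>, which is \<open>\<kappa> x\<close>.\<close>
    show "AE x in M. \<forall>\<xi>. (\<kappa> x *\<^sub>R v x) \<bullet> \<xi> \<le> \<Phi> x \<xi>"
      using v_le
    proof eventually_elim
      case (elim x)
      show ?case
      proof
        fix \<xi>
        have "v x \<bullet> ((1 / \<tau> x) *\<^sub>R \<xi>) \<le> \<Phi> x \<xi> / \<rho> x"
          using elim[rule_format, of "(1 / \<tau> x) *\<^sub>R \<xi>"] \<tau>_pos[of x] by simp
        then show "(\<kappa> x *\<^sub>R v x) \<bullet> \<xi> \<le> \<Phi> x \<xi>"
          using \<rho>_pos[of x] nz[of x] by (simp add: \<tau>_def divide_le_cancel)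
      qed
    qed
    fix g assume g: "g \<in> S"
    have [measurable]: "g \<in> borel_measurable M" "T g \<in> borel_measurable M"
      using S(2)[OF g] by (auto simp: T_def)
    have "(LINT x|N. v x \<bullet> T g x) = (LINT x|M. (\<kappa> x *\<^sub>R v x) \<bullet> g x)"
      using nz by (subst integral_N) (auto simp: T_def \<tau>_def)
    then show "(LINT x|M. (\<kappa> x *\<^sub>R v x) \<bullet> g x) = 0"
      using v_S[OF g] by simp
  qed measurable
qed

section \<open>Smooth functions with compact support\<close>

text \<open>\<open>frechet_derivative\<close> is a choice; uniqueness of derivatives identifies it
  with an explicit \<open>D\<close>, so that smoothness can be derived from the differentiation
  rules.\<close>

lemma C_k_SucI:
  assumes "\<And>x. (g has_derivative D x) (at x)" and "\<And>v. C_k k (\<lambda>x. D x v)"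
  shows "C_k (Suc k) g"
proof -
  have "frechet_derivative g (at x) = D x" for x
    using frechet_derivative_at[OF assms(1)] by simp
  then show ?thesis
    using assms by (auto simp: differentiable_on_def differentiable_def)
qed

lemma C_k_has_derivative:
  assumes "C_k (Suc k) g"
  shows "(g has_derivative frechet_derivative g (at x)) (at x)"
  using assms by (simp add: differentiable_on_def frechet_derivative_works)

lemma C_k_derivative: "C_k (Suc k) g \<Longrightarrow> C_k k (\<lambda>x. frechet_derivative g (at x) v)"
  by simp

lemma C_k_continuous: "C_k k g \<Longrightarrow> continuous_on UNIV g"
  by (cases k) (auto intro: differentiable_imp_continuous_on)

lemma C_k_Suc_imp: "C_k (Suc k) g \<Longrightarrow> C_k k g"
proof (induction k arbitrary: g)
  case 0
  then show ?case using C_k_continuous[of "Suc 0" g] by simp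
next
  case (Suc k)
  show ?case
    by (rule C_k_SucI[OF C_k_has_derivative[OF Suc.prems]]) (rule Suc.IH[OF C_k_derivative[OF Suc.prems]])
qed

lemma C_k_const [simp]: "C_k k (\<lambda>x. c)"
  by (induction k arbitrary: c) (auto intro!: C_k_SucI derivative_eq_intros simp del: C_k.simps(2))

lemma C_k_add: "C_k k f \<Longrightarrow> C_k k g \<Longrightarrow> C_k k (\<lambda>x. f x + g x)"
proof (induction k arbitrary: f g)
  case (Suc k)
  show ?case
    by (rule C_k_SucI[OF has_derivative_add[OF C_k_has_derivative[OF Suc.prems(1)] C_k_has_derivative[OF Suc.prems(2)]]])
      (rule Suc.IH[OF C_k_derivative[OF Suc.prems(1)] C_k_derivative[OF Suc.prems(2)]])
qed (auto intro: continuous_intros)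

lemma C_k_bounded_linear: "bounded_linear L \<Longrightarrow> C_k k g \<Longrightarrow> C_k k (\<lambda>x. L (g x))"
proof (induction k arbitrary: g)
  case (Suc k)
  show ?case
    by (rule C_k_SucI[OF bounded_linear.has_derivative[OF Suc.prems(1) C_k_has_derivative[OF Suc.prems(2)]]])
      (rule Suc.IH[OF Suc.prems(1) C_k_derivative[OF Suc.prems(2)]])
qed (auto intro: bounded_linear.continuous_on)

lemma C_k_affine: "bounded_linear L \<Longrightarrow> C_k k g \<Longrightarrow> C_k k (\<lambda>x. g (L x + c))"
proof (induction k arbitrary: g)
  case 0
  then have "continuous_on UNIV (\<lambda>x. L x + c)"
    by (intro continuous_on_add linear_continuous_on continuous_on_const)
  then show ?case
    using 0 continuous_on_compose2[of UNIV g UNIV "\<lambda>x. L x + c"] by simp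
next
  case (Suc k)
  have "((\<lambda>x. L x + c) has_derivative L) (at x)" for x
    using has_derivative_add[OF bounded_linear_imp_has_derivative[OF Suc.prems(1)] has_derivative_const]
    by simp
  then have "((\<lambda>x. g (L x + c)) has_derivative (\<lambda>v. frechet_derivative g (at (L x + c)) (L v))) (at x)" for x
    by (rule has_derivative_compose[OF _ C_k_has_derivative[OF Suc.prems(2)]])
  then show ?case
    by (rule C_k_SucI) (rule Suc.IH[OF Suc.prems(1) C_k_derivative[OF Suc.prems(2)]])
qed

lemma C_k_mult:
  fixes f g :: "'a::euclidean_space \<Rightarrow> real"
  shows "C_k k f \<Longrightarrow> C_k k g \<Longrightarrow> C_k k (\<lambda>x. f x * g x)"
proof (induction k arbitrary: f g)
  case (Suc k)
  show ?case
  proof (rule C_k_SucI)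
    show "((\<lambda>x. f x * g x) has_derivative
        (\<lambda>v. f x * frechet_derivative g (at x) v + frechet_derivative f (at x) v * g x)) (at x)" for x
      by (rule has_derivative_mult[OF C_k_has_derivative[OF Suc.prems(1)] C_k_has_derivative[OF Suc.prems(2)]])
    show "C_k k (\<lambda>x. f x * frechet_derivative g (at x) v + frechet_derivative f (at x) v * g x)" for v
      using Suc.prems by (intro C_k_add Suc.IH C_k_Suc_imp[of k f] C_k_Suc_imp[of k g] C_k_derivative)
  qed
qed (auto intro: continuous_intros)

lemma C_k_prod:
  fixes f :: "'i \<Rightarrow> 'a::euclidean_space \<Rightarrow> real"
  assumes "\<And>i. i \<in> I \<Longrightarrow> C_k k (f i)"
  shows "C_k k (\<lambda>x. \<Prod>i\<in>I. f i x)"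
  using assms by (induction I rule: infinite_finite_induct) (auto intro: C_k_mult)

text \<open>For \<open>n = 0\<close> this is the classical smooth function \<open>exp (-1/x)\<close>; the family is closed under
  differentiation up to linear combinations.\<close>

definition flat :: "nat \<Rightarrow> real \<Rightarrow> real" where
  "flat n x = (if x \<le> 0 then 0 else inverse x ^ n / exp (inverse x))"

lemma flat_tendsto_0: "(flat n \<longlongrightarrow> 0) (at 0)"
proof (rule filterlim_split_at_real)
  show "(flat n \<longlongrightarrow> 0) (at_left 0)"
    by (rule tendsto_eventually) (auto simp: flat_def eventually_at_left_field intro: exI[of _ "-1"])
  have "((\<lambda>x. inverse x ^ n / exp (inverse x)) \<longlongrightarrow> 0) (at_right (0::real))"
    by (rule filterlim_compose[OF tendsto_power_div_exp_0 filterlim_inverse_at_top_right])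
  then show "(flat n \<longlongrightarrow> 0) (at_right 0)"
    by (rule Lim_transform_eventually) (auto simp: flat_def eventually_at_right_field intro: exI[of _ 1])
qed

text \<open>At 0 the difference quotient of \<open>flat n\<close> is \<open>flat (Suc n)\<close>,
  whose limit is 0. On the two open half lines the function coincides with one elementary formula,
  and derivatives are local.\<close>

lemma flat_has_derivative:
  "(flat n has_real_derivative flat (n + 2) x - real n * flat (n + 1) x) (at x)"
proof -
  consider "x < 0" | "x = 0" | "0 < x" by linarith
  then show ?thesis
  proof cases
    case 1
    then have "((\<lambda>_. 0) has_real_derivative flat (n + 2) x - real n * flat (n + 1) x) (at x)"
      by (simp add: flat_def)
    then show ?thesis
      by (rule has_field_derivative_transform_within_open[where S = "{..<0}"])
        (use 1 in \<open>auto simp: flat_def\<close>)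
  next
    case 2
    have "((\<lambda>h. (flat n (0 + h) - flat n 0) / h) \<longlongrightarrow> 0) (at 0)"
      by (rule Lim_transform_eventually[OF flat_tendsto_0[of "Suc n"]])
        (auto simp: flat_def eventually_at_filter field_simps)
    then have "(flat n has_real_derivative 0) (at 0)"
      by (simp add: DERIV_def)
    with 2 show ?thesis by (simp add: flat_def)
  next
    case 3
    have "((\<lambda>x. inverse x ^ n / exp (inverse x)) has_real_derivative
        flat (n + 2) x - real n * flat (n + 1) x) (at x)"
    proof (rule DERIV_cong)
      show "((\<lambda>x. inverse x ^ n / exp (inverse x)) has_real_derivative
        ((real n * inverse x ^ (n - 1) * (- (inverse x * inverse x))) * exp (inverse x)
         - inverse x ^ n * (exp (inverse x) * (- (inverse x * inverse x)))) / (exp (inverse x))\<^sup>2) (at x)"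
        using 3 by (auto intro!: derivative_eq_intros simp: power2_eq_square)
      show "((real n * inverse x ^ (n - 1) * (- (inverse x * inverse x))) * exp (inverse x)
         - inverse x ^ n * (exp (inverse x) * (- (inverse x * inverse x)))) / (exp (inverse x))\<^sup>2
         = flat (n + 2) x - real n * flat (n + 1) x"
        using 3 by (cases n) (simp_all add: flat_def power2_eq_square divide_simps, simp_all add: algebra_simps)
    qed
    then show ?thesis
      by (rule has_field_derivative_transform_within_open[where S = "{0<..}"])
        (use 3 in \<open>auto simp: flat_def\<close>)
  qed
qed

lemma C_k_flat: "C_k k (flat n)"
proof (induction k arbitrary: n)
  case 0
  then show ?case
    using flat_has_derivative by (auto intro!: continuous_at_imp_continuous_on DERIV_isCont)
next
  case (Suc k)
  show ?case
  proof (rule C_k_SucI)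
    show "(flat n has_derivative (\<lambda>v. (flat (n + 2) x - real n * flat (n + 1) x) * v)) (at x)" for x
      using flat_has_derivative[of n x] by (simp add: has_field_derivative_def)
    have "C_k k (\<lambda>x. flat (n + 2) x + (- real n) * flat (n + 1) x)"
      by (intro C_k_add C_k_mult C_k_const Suc.IH)
    then show "C_k k (\<lambda>x. (flat (n + 2) x - real n * flat (n + 1) x) * v)" for v
      using C_k_mult[OF _ C_k_const, of k "\<lambda>x. flat (n + 2) x + (- real n) * flat (n + 1) x" v] by simp
  qed
qed

lemma flat_0_bounds: "0 \<le> flat 0 x" "flat 0 x \<le> 1" "flat 0 x = 0 \<longleftrightarrow> x \<le> 0"
  by (auto simp: flat_def divide_simps)

section \<open>Smooth approximation of indicators of boxes\<close>

definition bump :: "'a::euclidean_space \<Rightarrow> 'a \<Rightarrow> nat \<Rightarrow> 'a \<Rightarrow> real" where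
  "bump a b n x = (\<Prod>i\<in>Basis. flat 0 (real (Suc n) * (x \<bullet> i - a \<bullet> i)) * flat 0 (real (Suc n) * (b \<bullet> i - x \<bullet> i)))"

lemma C_k_bump: "C_k k (bump a b n)"
proof -
  have flat: "C_k k (\<lambda>x. flat 0 (N * (x \<bullet> i) + c))" for N c :: real and i :: 'a
    by (rule C_k_affine[OF bounded_linear_const_mult[OF bounded_linear_inner_left] C_k_flat])
  have 1: "C_k k (\<lambda>x. flat 0 (N * (x \<bullet> i - c)))" for N c :: real and i :: 'a
    using flat[of N i "- (N * c)"] by (simp add: right_diff_distrib)
  have 2: "C_k k (\<lambda>x. flat 0 (N * (c - x \<bullet> i)))" for N c :: real and i :: 'a
    using flat[of "- N" i "N * c"] by (simp add: right_diff_distrib)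
  show ?thesis
    unfolding bump_def[abs_def] by (intro C_k_prod C_k_mult 1 2)
qed

lemma bump_bounds: "0 \<le> bump a b n x" "bump a b n x \<le> 1"
  unfolding bump_def by (auto intro!: prod_nonneg prod_le_1 mult_nonneg_nonneg mult_le_one flat_0_bounds)

lemma bump_eq_0_iff: "bump a b n x = 0 \<longleftrightarrow> x \<notin> box a b"
  unfolding bump_def by (auto simp: flat_0_bounds box_def mult_le_0_iff not_less)

text \<open>Inside the box each factor is \<open>exp (- 1 / (Suc n * y))\<close> with a fixed
  \<open>y > 0\<close> and tends to 1; outside all terms are 0, including the boundary, so the limit
  belongs to the open box. \<open>Suc n\<close> keeps the factors positive inside already for
  \<open>n = 0\<close>.\<close>

lemma bump_tendsto: "(\<lambda>n. bump a b n x) \<longlonglongrightarrow> indicator (box a b) x"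
proof (cases "x \<in> box a b")
  case True
  have 1: "(\<lambda>n. flat 0 (real (Suc n) * y)) \<longlonglongrightarrow> 1" if "0 < y" for y
  proof -
    have "(\<lambda>n. 1 / exp (inverse (real (Suc n)) * inverse y)) \<longlonglongrightarrow> 1 / exp (0 * inverse y)"
      by (intro tendsto_intros LIMSEQ_inverse_real_of_nat) simp
    moreover have "1 / exp (inverse (real (Suc n)) * inverse y) = flat 0 (real (Suc n) * y)" for n
      using that by (auto simp: flat_def mult_le_0_iff inverse_mult_distrib)
    ultimately show ?thesis by simp
  qed
  have "(\<lambda>n. bump a b n x) \<longlonglongrightarrow> (\<Prod>i\<in>(Basis::'a set). 1 * 1)"
    unfolding bump_def using True by (intro tendsto_prod tendsto_mult 1) (auto simp: box_def)
  with True show ?thesis by simp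
next
  case False
  then have "bump a b n x = 0" for n by (simp add: bump_eq_0_iff)
  with False show ?thesis by simp
qed

lemma bump_test_function:
  assumes "cbox a b \<subseteq> S"
  shows "bump a b n \<in> test_functions S"
proof -
  have "{x. bump a b n x \<noteq> 0} = box a b" by (simp add: bump_eq_0_iff)
  then have sub: "closure {x. bump a b n x \<noteq> 0} \<subseteq> cbox a b"
    using closure_minimal[OF box_subset_cbox closed_cbox] by simp
  then have "compact (closure {x. bump a b n x \<noteq> 0})"
    by (meson bounded_cbox bounded_subset closed_closure compact_eq_bounded_closed)
  with sub assms show ?thesis
    by (auto simp: test_functions_def C_k_bump)
qed

section \<open>The vector space of test functions\<close>

lemma test_functionsI:
  assumes "\<And>k. C_k k \<phi>" "compact K" "K \<subseteq> S" "\<And>x. x \<notin> K \<Longrightarrow> \<phi> x = 0"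
  shows "\<phi> \<in> test_functions S"
proof -
  have "closure {x. \<phi> x \<noteq> 0} \<subseteq> K"
    using assms by (intro closure_minimal) (auto intro: compact_imp_closed)
  moreover from this have "compact (closure {x. \<phi> x \<noteq> 0})"
    using assms(2) by (meson bounded_subset closed_closure compact_eq_bounded_closed)
  ultimately show ?thesis
    using assms by (auto simp: test_functions_def)
qed

lemma test_functionsE:
  assumes "\<phi> \<in> test_functions S"
  obtains K where "compact K" "K \<subseteq> S" "\<And>x. x \<notin> K \<Longrightarrow> \<phi> x = 0"
proof (rule that)
  show "compact (closure {x. \<phi> x \<noteq> 0})" "closure {x. \<phi> x \<noteq> 0} \<subseteq> S"
    using assms by (auto simp: test_functions_def)
  show "\<phi> x = 0" if "x \<notin> closure {x. \<phi> x \<noteq> 0}" for x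
    using that closure_subset[of "{x. \<phi> x \<noteq> 0}"] by blast
qed

lemma test_functions_C_k: "\<phi> \<in> test_functions S \<Longrightarrow> C_k k \<phi>"
  by (simp add: test_functions_def)

lemma test_functions_add:
  assumes "\<phi> \<in> test_functions S" "\<psi> \<in> test_functions S"
  shows "(\<lambda>x. \<phi> x + \<psi> x) \<in> test_functions S"
proof -
  obtain K where "compact K" "K \<subseteq> S" "\<And>x. x \<notin> K \<Longrightarrow> \<phi> x = 0"
    by (rule test_functionsE[OF assms(1)]) blast
  moreover obtain L where "compact L" "L \<subseteq> S" "\<And>x. x \<notin> L \<Longrightarrow> \<psi> x = 0"
    by (rule test_functionsE[OF assms(2)]) blast
  ultimately show ?thesis
    by (intro test_functionsI[where K = "K \<union> L"]
        C_k_add[OF test_functions_C_k[OF assms(1)] test_functions_C_k[OF assms(2)]]) auto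
qed

lemma test_functions_bounded_linear:
  assumes "\<phi> \<in> test_functions S" "bounded_linear L"
  shows "(\<lambda>x. L (\<phi> x)) \<in> test_functions S"
proof -
  obtain K where "compact K" "K \<subseteq> S" "\<And>x. x \<notin> K \<Longrightarrow> \<phi> x = 0"
    by (rule test_functionsE[OF assms(1)]) blast
  then show ?thesis
    by (intro test_functionsI[where K = K] C_k_bounded_linear[OF assms(2) test_functions_C_k[OF assms(1)]])
      (auto simp: linear_0 bounded_linear.linear assms(2))
qed

lemma test_functions_zero: "(\<lambda>x. 0) \<in> test_functions S"
  by (rule test_functionsI[where K = "{}"]) auto

lemma continuous_compact_support_bounded:
  fixes \<phi> :: "'a::euclidean_space \<Rightarrow> 'b::real_normed_vector"
  assumes "continuous_on UNIV \<phi>" "compact K" "\<And>x. x \<notin> K \<Longrightarrow> \<phi> x = 0"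
  shows "\<exists>B>0. \<forall>x. norm (\<phi> x) \<le> B"
proof -
  have "bounded (\<phi> ` K)"
    using assms by (intro compact_imp_bounded compact_continuous_image) (auto intro: continuous_on_subset)
  then obtain B where B: "0 < B" "\<And>x. x \<in> K \<Longrightarrow> norm (\<phi> x) \<le> B"
    by (auto simp: bounded_pos)
  have "norm (\<phi> x) \<le> B" for x
    using B assms(3)[of x] by (cases "x \<in> K") auto
  with B(1) show ?thesis by blast
qed

lemma frechet_derivative_outside:
  assumes K: "compact K" "\<And>x. x \<notin> K \<Longrightarrow> \<phi> x = 0" and x: "x \<notin> K"
  shows "frechet_derivative \<phi> (at x) = (\<lambda>v. 0)"
proof -
  have "((\<lambda>x. 0) has_derivative (\<lambda>v. 0)) (at x)" by simp
  then have "(\<phi> has_derivative (\<lambda>v. 0)) (at x)"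
    by (rule has_derivative_transform_within_open[where s = "- K"])
      (use assms in \<open>auto intro: compact_imp_closed\<close>)
  then show ?thesis by (simp add: frechet_derivative_at[symmetric])
qed

section \<open>The fundamental lemma and integration by parts\<close>

lemma sigma_finite_lebesgue_on:
  fixes S :: "'a::euclidean_space set"
  assumes S: "S \<in> sets lebesgue"
  shows "sigma_finite_measure (lebesgue_on S)"
proof
  define A where "A = range (\<lambda>n::nat. S \<inter> cball 0 (real n))"
  have "emeasure (lebesgue_on S) (S \<inter> cball 0 (real n)) \<noteq> \<infinity>" for n :: nat
  proof -
    have "emeasure (lebesgue_on S) (S \<inter> cball 0 (real n)) = emeasure lebesgue (S \<inter> cball 0 (real n))"
      using S by (intro emeasure_restrict_space) auto
    also have "\<dots> \<le> emeasure lebesgue (cball (0::'a) (real n))"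
      by (intro emeasure_mono) auto
    also have "\<dots> < \<infinity>"
      using lmeasurable_compact[OF compact_cball] by (auto simp: fmeasurable_def)
    finally show ?thesis by simp
  qed
  moreover have "\<Union>A = S"
  proof
    show "S \<subseteq> \<Union>A"
    proof
      fix x assume x: "x \<in> S"
      obtain n :: nat where "norm x \<le> real n" using real_arch_simple by blast
      with x have "x \<in> S \<inter> cball 0 (real n)" by simp
      then show "x \<in> \<Union>A" by (auto simp: A_def)
    qed
  qed (auto simp: A_def)
  moreover have "A \<subseteq> sets (lebesgue_on S)"
  proof -
    have "S \<inter> cball 0 (real n) \<in> sets lebesgue" for n
      using S by (intro sets.Int) auto
    then show ?thesis
      using S by (auto simp: A_def sets_restrict_space_iff)
  qed
  ultimately show "\<exists>A. countable A \<and> A \<subseteq> sets (lebesgue_on S) \<and> \<Union>A = space (lebesgue_on S)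
      \<and> (\<forall>a\<in>A. emeasure (lebesgue_on S) a \<noteq> \<infinity>)"
    by (intro exI[of _ A]) (auto simp: A_def space_restrict_space)
qed

lemma sigma_finite_lebesgue: "sigma_finite_measure (lebesgue :: 'a::euclidean_space measure)"
  using sigma_finite_lebesgue_on[of "UNIV :: 'a set"] by (simp add: lebesgue_on_UNIV_eq)

text \<open>Open boxes are stable under intersection and generate the Borel sets, so a Dynkin
  argument carries the vanishing from boxes to Borel sets and then to Lebesgue sets, after which
  uniqueness of densities applies.\<close>

lemma AE_zero_if_box_integrals_zero:
  fixes f :: "'a::euclidean_space \<Rightarrow> real"
  assumes f: "integrable lebesgue f"
    and box: "\<And>a b. (LINT x:box a b|lebesgue. f x) = 0"
  shows "AE x in lebesgue. f x = 0"
proof -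
  have int: "set_integrable lebesgue A f" if "A \<in> sets lebesgue" for A
    unfolding set_integrable_def using that f by (rule integrable_mult_indicator)
  have borel: "(LINT x:A|lebesgue. f x) = 0" if A: "A \<in> sets borel" for A
  proof -
    define G where "G = range (\<lambda>(a, b). box a b :: 'a set)"
    have sets: "sigma_sets UNIV G = sets borel"
      by (simp add: borel_eq_box G_def)
    have leb: "B \<in> sets lebesgue" if "B \<in> sigma_sets UNIV G" for B
      using that by (simp add: sets)
    have stable: "Int_stable G"
      unfolding G_def Int_stable_def by (auto simp: box_Int_box)
    \<comment> \<open>Complements in the Dynkin argument require the integral over the whole space,
      which is the limit over growing cubes.\<close>
    have total: "(LINT x|lebesgue. f x) = 0"
    proof -
      have "(\<lambda>n. LINT x:box (- real n *\<^sub>R One) (real n *\<^sub>R One)|lebesgue. f x) \<longlonglongrightarrow> (LINT x|lebesgue. f x)"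
        unfolding set_lebesgue_integral_def
      proof (rule integral_dominated_convergence)
        show "integrable lebesgue (\<lambda>x. \<bar>f x\<bar>)" using f by simp
        show "AE x in lebesgue. (\<lambda>n. indicat_real (box (- real n *\<^sub>R One) (real n *\<^sub>R One)) x *\<^sub>R f x) \<longlonglongrightarrow> f x"
        proof (intro AE_I2 tendsto_eventually)
          fix x :: 'a
          obtain N :: nat where N: "norm x < real N" using reals_Archimedean2 by blast
          have "x \<in> box (- real n *\<^sub>R One) (real n *\<^sub>R One)" if "N \<le> n" for n
          proof -
            have "- real n < x \<bullet> i \<and> x \<bullet> i < real n" if "i \<in> Basis" for i
              using Basis_le_norm[OF that, of x] N \<open>N \<le> n\<close> by linarith
            then show ?thesis by (auto simp: box_def)
          qed
          then show "\<forall>\<^sub>F n in sequentially. indicat_real (box (- real n *\<^sub>R One) (real n *\<^sub>R One)) x *\<^sub>R f x = f x"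
            by (auto simp: eventually_sequentially intro!: exI[of _ N])
        qed
        show "(\<lambda>x. indicat_real (box (- real n *\<^sub>R One) (real n *\<^sub>R One)) x *\<^sub>R f x)
            \<in> borel_measurable lebesgue" for n
          using f by (intro borel_measurable_scaleR borel_measurable_indicator) auto
      qed (use f in \<open>auto simp: indicator_def\<close>)
      then show ?thesis
        unfolding box by (simp add: LIMSEQ_const_iff)
    qed
    have G_Pow: "G \<subseteq> Pow UNIV" by simp
    have "A \<in> sigma_sets UNIV G" using A by (simp add: sets)
    with stable G_Pow show ?thesis
    proof (induction rule: sigma_sets_induct_disjoint)
      case (compl A)
      have A: "A \<in> sets lebesgue" using leb compl by blast
      have "(LINT x:UNIV - A|lebesgue. f x) = (LINT x|lebesgue. f x - indicator A x *\<^sub>R f x)"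
        unfolding set_lebesgue_integral_def
        by (intro Bochner_Integration.integral_cong) (auto simp: indicator_def)
      also have "\<dots> = (LINT x|lebesgue. f x) - (LINT x:A|lebesgue. f x)"
        using f int[OF A] by (simp add: set_lebesgue_integral_def set_integrable_def)
      finally show ?case using compl total by simp
    next
      case (union A)
      have A: "A i \<in> sets lebesgue" for i using union(2) leb by blast
      have "(\<Union>i. A i) \<in> sets lebesgue" using A by blast
      then have "(LINT x:(\<Union>i. A i)|lebesgue. f x) = (\<Sum>i. (LINT x:A i|lebesgue. f x))"
        using union(1) A by (intro lebesgue_integral_countable_add int) (auto simp: disjoint_family_on_def)
      then show ?case using union by simp
    next
      case (basic A)
      then show ?case using box by (auto simp: G_def)
    next
      case empty
      show ?case by (simp add: set_lebesgue_integral_def)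
    qed
  qed
  \<comment> \<open>A Lebesgue set differs from a Borel set by a negligible set.\<close>
  have "set_lebesgue_integral lebesgue A f = 0" if A: "A \<in> sets lebesgue" for A
  proof -
    obtain B N where BN: "B \<in> sets borel" "negligible N" "B \<union> N = A"
      using sets_lebesgue_almost_borel[OF A] .
    have "AE x in lebesgue. x \<notin> N"
      using BN(2) by (simp add: negligible_iff_null_sets AE_not_in)
    then have "AE x in lebesgue. indicat_real A x *\<^sub>R f x = indicat_real B x *\<^sub>R f x"
      by eventually_elim (use BN(3) in \<open>auto simp: indicator_def\<close>)
    then have "set_lebesgue_integral lebesgue A f = set_lebesgue_integral lebesgue B f"
      unfolding set_lebesgue_integral_def
      using int[OF A] int[of B] BN(1) by (intro integral_cong_AE) (auto simp: set_integrable_def)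
    then show ?thesis using borel[OF BN(1)] by simp
  qed
  then show ?thesis
    by (rule sigma_finite_measure.density_zero[OF sigma_finite_lebesgue f])
qed

lemma integrable_lebesgue_on_iff:
  fixes f :: "'a::euclidean_space \<Rightarrow> 'b::euclidean_space"
  assumes "S \<in> sets lebesgue"
  shows "integrable (lebesgue_on S) f \<longleftrightarrow> integrable lebesgue (\<lambda>x. indicator S x *\<^sub>R f x)"
  using assms by (intro integrable_restrict_space) simp

lemma integral_lebesgue_on_eq:
  fixes f :: "'a::euclidean_space \<Rightarrow> 'b::euclidean_space"
  assumes "S \<in> sets lebesgue"
  shows "integral\<^sup>L (lebesgue_on S) f = (LINT x|lebesgue. indicator S x *\<^sub>R f x)"
  using assms by (intro integral_restrict_space) simp

lemma L1_loc_integrable_indicator: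
  fixes g :: "'a::euclidean_space \<Rightarrow> 'b::euclidean_space"
  assumes g: "g \<in> L1_loc S" and K: "compact K" "K \<subseteq> S"
  shows "integrable lebesgue (\<lambda>x. indicator K x *\<^sub>R g x)"
  using assms by (simp add: L1_loc_def integrable_lebesgue_on_iff[symmetric] lmeasurable_compact fmeasurableD)

lemma L1_loc_integrable_mult:
  fixes g \<psi> :: "'a::euclidean_space \<Rightarrow> real"
  assumes S: "S \<in> sets lebesgue" and g: "g \<in> L1_loc S" and K: "compact K" "K \<subseteq> S"
    and \<psi>: "continuous_on UNIV \<psi>" "\<And>x. x \<notin> K \<Longrightarrow> \<psi> x = 0"
  shows "integrable (lebesgue_on S) (\<lambda>x. g x * \<psi> x)"
proof -
  obtain B where B: "0 < B" "\<And>x. norm (\<psi> x) \<le> B"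
    using continuous_compact_support_bounded[OF \<psi>(1) K(1) \<psi>(2)] by blast
  have [measurable]: "\<psi> \<in> borel_measurable lebesgue"
    using borel_measurable_continuous_onI[OF \<psi>(1)] by (simp add: measurable_completion)
  have int: "integrable lebesgue (\<lambda>x. indicator K x *\<^sub>R g x)"
    by (rule L1_loc_integrable_indicator[OF g K])
  have "integrable lebesgue (\<lambda>x. (indicator K x *\<^sub>R g x) * \<psi> x)"
  proof (rule Bochner_Integration.integrable_bound)
    show "integrable lebesgue (\<lambda>x. B * (indicator K x *\<^sub>R g x))" using int by simp
    show "AE x in lebesgue. norm ((indicator K x *\<^sub>R g x) * \<psi> x) \<le> norm (B * (indicator K x *\<^sub>R g x))"
      using B by (intro AE_I2)
        (auto simp: abs_mult mult.commute[of "\<bar>g x\<bar>" for x] intro!: mult_right_mono split: split_indicator)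
    show "(\<lambda>x. (indicator K x *\<^sub>R g x) * \<psi> x) \<in> borel_measurable lebesgue"
      using borel_measurable_integrable[OF int] by measurable
  qed
  moreover have "(\<lambda>x. (indicator K x *\<^sub>R g x) * \<psi> x) = (\<lambda>x. indicator S x *\<^sub>R (g x * \<psi> x))"
    using K(2) \<psi>(2) by (intro ext) (auto simp: indicator_def)
  ultimately show ?thesis
    by (simp add: integrable_lebesgue_on_iff[OF S])
qed

text \<open>No mollification is involved: bump functions converge boundedly to indicators of boxes,
  so the integrals of \<open>g\<close> over open boxes whose closed box lies in \<open>S\<close>
  vanish, and an open set is a countable union of closed boxes.\<close>

lemma du_Bois_Reymond:
  fixes g :: "'a::euclidean_space \<Rightarrow> real"
  assumes S: "open S" and g: "g \<in> L1_loc S"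
    and zero: "\<And>\<phi>. \<phi> \<in> test_functions S \<Longrightarrow> (LINT x|lebesgue_on S. g x * \<phi> x) = 0"
  shows "AE x in lebesgue_on S. g x = 0"
proof -
  have S': "S \<in> sets lebesgue" using S by simp
  \<comment> \<open>The restriction of \<open>g\<close> to a closed box inside \<open>S\<close>,
    extended by 0, is integrable over the whole space although \<open>g\<close> is only locally
    integrable in \<open>S\<close>.\<close>
  define k where "k a b x = indicator (cbox a b) x *\<^sub>R g x" for a b x
  have box0: "(LINT x|lebesgue. indicator (box a b) x * g x) = 0" if ab: "cbox a b \<subseteq> S" for a b
  proof -
    have 0: "(LINT x|lebesgue. indicator S x *\<^sub>R (g x * bump a b n x)) = 0" for n
      using zero[OF bump_test_function[OF ab, of n]] by (simp add: integral_lebesgue_on_eq[OF S'])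
    have int: "integrable lebesgue (k a b)"
      unfolding k_def[abs_def] by (rule L1_loc_integrable_indicator[OF g compact_cbox ab])
    have [measurable]: "bump a b n \<in> borel_measurable lebesgue" for n
      using borel_measurable_continuous_onI[OF C_k_continuous[OF C_k_bump[of 0 a b n]]]
      by (simp add: measurable_completion)
    have eq: "indicator S x *\<^sub>R (g x * bump a b n x) = k a b x * bump a b n x" for x n
      using ab bump_eq_0_iff[of a b n x] box_subset_cbox[of a b] by (auto simp: indicator_def k_def)
    have eq2: "indicator (box a b) x * g x = k a b x * indicator (box a b) x" for x
      using box_subset_cbox[of a b] by (auto simp: indicator_def k_def)
    have "(\<lambda>n. LINT x|lebesgue. indicator S x *\<^sub>R (g x * bump a b n x))
        \<longlonglongrightarrow> (LINT x|lebesgue. indicator (box a b) x * g x)"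
      unfolding eq eq2
    proof (rule integral_dominated_convergence)
      show "integrable lebesgue (\<lambda>x. \<bar>k a b x\<bar>)"
        using int by (rule integrable_abs)
      show "AE x in lebesgue. (\<lambda>n. k a b x * bump a b n x)
          \<longlonglongrightarrow> k a b x * indicator (box a b) x"
        by (intro AE_I2 tendsto_mult tendsto_const bump_tendsto)
      show "AE x in lebesgue. norm (k a b x * bump a b n x)
          \<le> \<bar>k a b x\<bar>" for n
        using bump_bounds[of a b n] by (intro AE_I2) (simp add: abs_mult mult_left_le)
      show "(\<lambda>x. k a b x * bump a b n x) \<in> borel_measurable lebesgue" for n
        using borel_measurable_integrable[OF int] by measurable
      show "(\<lambda>x. k a b x * indicator (box a b) x) \<in> borel_measurable lebesgue"
        using borel_measurable_integrable[OF int]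
        by (intro borel_measurable_times borel_measurable_indicator) auto
    qed
    then show ?thesis unfolding 0 by (simp add: LIMSEQ_const_iff)
  qed
  have AE_box: "AE x in lebesgue. x \<in> cbox a b \<longrightarrow> g x = 0" if ab: "cbox a b \<subseteq> S" for a b
  proof -
    have int: "integrable lebesgue (k a b)"
      unfolding k_def[abs_def] by (rule L1_loc_integrable_indicator[OF g compact_cbox ab])
    have "AE x in lebesgue. indicator (box a b) x *\<^sub>R k a b x = 0"
    proof (rule AE_zero_if_box_integrals_zero)
      show "integrable lebesgue (\<lambda>x. indicat_real (box a b) x *\<^sub>R k a b x)"
        by (rule integrable_mult_indicator[OF _ int]) auto
      fix c d
      obtain c' d' where cd: "box c d \<inter> box a b = box c' d'"
        by (rule that) (rule box_Int_box)
      have "(LINT x:box c d|lebesgue. indicator (box a b) x *\<^sub>R k a b x)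
          = (LINT x|lebesgue. indicator (box c' d') x * g x)"
        unfolding set_lebesgue_integral_def cd[symmetric]
        using box_subset_cbox[of a b]
        by (intro Bochner_Integration.integral_cong) (auto simp: indicator_def k_def)
      also have "\<dots> = 0"
      \<comment> \<open>A nonempty open box has \<open>cbox c' d'\<close> as its closure, which
        gives the inclusion in \<open>S\<close> required by \<open>box0\<close>. For an empty open
        box the closed one may leave \<open>S\<close>, but then the integral is 0 anyway.\<close>
      proof (cases "box c' d' = {}")
        case False
        have "cbox c' d' = closure (box c' d')" using False by simp
        also have "\<dots> \<subseteq> closure (cbox a b)"
          unfolding cd[symmetric] using box_subset_cbox by (intro closure_mono) blast
        finally show ?thesis using ab by (intro box0) auto
      qed simp
      finally show "(LINT x:box c d|lebesgue. indicator (box a b) x *\<^sub>R k a b x) = 0" .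
    qed
    \<comment> \<open>The boundary of the box, on which the previous claim says nothing about
      \<open>g\<close>, is negligible.\<close>
    moreover have "AE x in lebesgue. x \<notin> cbox a b - box a b"
      by (intro AE_not_in) (simp add: negligible_frontier_interval flip: negligible_iff_null_sets)
    ultimately show ?thesis
      by eventually_elim (auto simp: indicator_def k_def split: if_splits)
  qed
  obtain \<D> where \<D>: "countable \<D>" "\<D> \<subseteq> Pow S" "\<And>X. X \<in> \<D> \<Longrightarrow> \<exists>a b. X = cbox a b" "\<Union>\<D> = S"
    using open_countable_Union_open_cbox[OF S] by metis
  have "AE x in lebesgue. \<forall>X\<in>\<D>. x \<in> X \<longrightarrow> g x = 0"
    using AE_box \<D>(2,3) by (subst AE_ball_countable[OF \<D>(1)]) (metis PowD subsetD)
  then have "AE x in lebesgue. x \<in> S \<longrightarrow> g x = 0"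
    by eventually_elim (use \<D>(4) in blast)
  then show ?thesis
    using S' by (subst AE_restrict_space_iff) auto
qed

lemma integrable_continuous_compact_support:
  fixes \<psi> :: "'a::euclidean_space \<Rightarrow> 'b::euclidean_space"
  assumes "continuous_on UNIV \<psi>" "compact K" "\<And>x. x \<notin> K \<Longrightarrow> \<psi> x = 0"
  shows "integrable lborel \<psi>"
proof -
  have "integrable lborel (\<lambda>x. indicator K x *\<^sub>R \<psi> x)"
    using assms by (intro borel_integrable_compact) (auto intro: continuous_on_subset)
  moreover have "(\<lambda>x. indicator K x *\<^sub>R \<psi> x) = \<psi>"
    using assms(3) by (auto simp: indicator_def)
  ultimately show ?thesis by simp
qed

lemma directional_derivative:
  assumes "C_k (Suc 0) F"
  shows "((\<lambda>s. F (x + s *\<^sub>R v)) has_real_derivative frechet_derivative F (at (x + s *\<^sub>R v)) v) (at s)"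
proof -
  have "((\<lambda>s. x + s *\<^sub>R v) has_derivative (\<lambda>h. h *\<^sub>R v)) (at s)"
    by (auto intro!: derivative_eq_intros)
  from has_derivative_compose[OF this C_k_has_derivative[OF assms]]
  have "((\<lambda>s. F (x + s *\<^sub>R v)) has_derivative (\<lambda>h. frechet_derivative F (at (x + s *\<^sub>R v)) (h *\<^sub>R v))) (at s)" .
  moreover have "frechet_derivative F (at (x + s *\<^sub>R v)) (h *\<^sub>R v) = frechet_derivative F (at (x + s *\<^sub>R v)) v * h" for h
    using linear_scale[OF has_derivative_linear[OF C_k_has_derivative[OF assms]]] by simp
  ultimately show ?thesis by (simp add: has_field_derivative_def)
qed

text \<open>Difference quotients have integral zero by translation invariance.\<close>

lemma integral_directional_derivative_zero:
  fixes F :: "'a::euclidean_space \<Rightarrow> real"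
  assumes F: "C_k (Suc 0) F" and K: "compact K" "\<And>x. x \<notin> K \<Longrightarrow> F x = 0"
  shows "(LINT x|lborel. frechet_derivative F (at x) v) = 0"
proof -
  let ?D = "\<lambda>x. frechet_derivative F (at x) v"
  have cont: "continuous_on UNIV F" "continuous_on UNIV ?D"
    using C_k_continuous[OF F] C_k_continuous[OF C_k_derivative[OF F]] by auto
  have D0: "?D x = 0" if "x \<notin> K" for x
    using frechet_derivative_outside[OF K that] by simp
  obtain B where B: "0 < B" "\<And>x. norm (?D x) \<le> B"
    using continuous_compact_support_bounded[OF cont(2) K(1) D0] by blast
  obtain R where R: "\<And>x. x \<in> K \<Longrightarrow> norm x \<le> R"
    using compact_imp_bounded[OF K(1)] by (auto simp: bounded_iff)
  define t where "t n = inverse (real (Suc n))" for n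
  have t: "0 < t n" "t n \<le> 1" for n by (auto simp: t_def divide_simps)
  have F_int: "integrable lborel F"
    by (rule integrable_continuous_compact_support[OF cont(1) K])
  have shift: "has_bochner_integral lborel (\<lambda>x. F (x + c)) (LINT x|lborel. F x)" for c
    using F_int integrable_distr_eq[of "(+) c" lborel borel F] integral_distr[of "(+) c" lborel borel F]
      borel_measurable_integrable[OF F_int] lborel_distr_plus[of c]
    by (simp add: has_bochner_integral_iff add.commute)
  have "(\<lambda>n. LINT x|lborel. (F (x + t n *\<^sub>R v) - F x) / t n) \<longlonglongrightarrow> (LINT x|lborel. ?D x)"
  proof (rule integral_dominated_convergence)
    have "integrable lborel (\<lambda>x::'a. indicator (cball 0 (R + norm v)) x *\<^sub>R B)"
      by (rule borel_integrable_compact) auto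
    then show "integrable lborel (\<lambda>x::'a. B * indicator (cball 0 (R + norm v)) x)"
      by (simp add: mult.commute)
    show "AE x in lborel. norm ((F (x + t n *\<^sub>R v) - F x) / t n) \<le> B * indicator (cball 0 (R + norm v)) x" for n
    proof (rule AE_I2)
      fix x :: 'a
      show "norm ((F (x + t n *\<^sub>R v) - F x) / t n) \<le> B * indicator (cball 0 (R + norm v)) x"
      proof (cases "norm x \<le> R + norm v")
        case True
        obtain z where "F (x + t n *\<^sub>R v) - F (x + 0 *\<^sub>R v) = (t n - 0) * ?D (x + z *\<^sub>R v)"
          using MVT2[OF t(1)[of n], of "\<lambda>s. F (x + s *\<^sub>R v)" "\<lambda>s. ?D (x + s *\<^sub>R v)"]
            directional_derivative[OF F] by blast
        then have "(F (x + t n *\<^sub>R v) - F x) / t n = ?D (x + z *\<^sub>R v)"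
          using t(1)[of n] by simp
        then show ?thesis using B(2) True by simp
      next
        \<comment> \<open>This far out both \<open>x\<close> and \<open>x + t n *\<^sub>R v\<close>
          lie outside the ball of radius \<open>R\<close> that contains \<open>K\<close>, so the
          difference quotient is 0.\<close>
        case False
        have "norm (t n *\<^sub>R v) \<le> norm v"
          using t[of n] by (simp add: mult_left_le_one_le)
        then have "R < norm (x + t n *\<^sub>R v)"
          using False norm_triangle_ineq2[of x "- (t n *\<^sub>R v)"] by simp
        moreover have "R < norm x" using False norm_ge_zero[of v] by linarith
        ultimately show ?thesis using R K(2) False by (metis diff_self div_0 indicator_simps(2) mem_cball_0 mult_zero_right norm_zero not_le order_refl)
      qed
    qed
    show "AE x in lborel. (\<lambda>n. (F (x + t n *\<^sub>R v) - F x) / t n) \<longlonglongrightarrow> ?D x"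
    proof (rule AE_I2)
      fix x
      have "((\<lambda>h. (F (x + (0 + h) *\<^sub>R v) - F (x + 0 *\<^sub>R v)) / h) \<longlongrightarrow> ?D (x + 0 *\<^sub>R v)) (at 0)"
        using directional_derivative[OF F, of x v 0] unfolding DERIV_def .
      moreover have "filterlim t (at 0) sequentially"
        using LIMSEQ_inverse_real_of_nat t(1) unfolding t_def
        by (intro filterlim_atI) (auto simp: less_imp_neq)
      ultimately show "(\<lambda>n. (F (x + t n *\<^sub>R v) - F x) / t n) \<longlonglongrightarrow> ?D x"
        using filterlim_compose by fastforce
    qed
    show "?D \<in> borel_measurable lborel"
      using borel_measurable_continuous_onI[OF cont(2)] by simp
    show "(\<lambda>x. (F (x + t n *\<^sub>R v) - F x) / t n) \<in> borel_measurable lborel" for n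
      using shift[of "t n *\<^sub>R v"] F_int by (auto simp: has_bochner_integral_iff)
  qed
  moreover have "(LINT x|lborel. (F (x + t n *\<^sub>R v) - F x) / t n) = 0" for n
    using shift[of "t n *\<^sub>R v"] F_int by (simp add: has_bochner_integral_iff)
  ultimately have "(\<lambda>n. 0) \<longlonglongrightarrow> (LINT x|lborel. ?D x)" by (simp only:)
  then show ?thesis by (simp add: LIMSEQ_const_iff)
qed

text \<open>The product has compact support as soon as \<phi> has, so the integral of its derivative
  vanishes. The asymmetric form is what a weak gradient asks for, with \<phi> as the test
  function.\<close>

lemma integration_by_parts_compact_support:
  fixes \<phi> \<psi> :: "'a::euclidean_space \<Rightarrow> real"
  assumes \<phi>: "C_k (Suc 0) \<phi>" and \<psi>: "C_k (Suc 0) \<psi>" and K: "compact K" "\<And>x. x \<notin> K \<Longrightarrow> \<phi> x = 0"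
  shows "(LINT x|lebesgue. \<psi> x * frechet_derivative \<phi> (at x) v)
           = - (LINT x|lebesgue. frechet_derivative \<psi> (at x) v * \<phi> x)"
proof -
  let ?f = "\<lambda>x. \<psi> x * frechet_derivative \<phi> (at x) v"
  let ?g = "\<lambda>x. frechet_derivative \<psi> (at x) v * \<phi> x"
  have cont: "continuous_on UNIV ?f" "continuous_on UNIV ?g"
    using C_k_continuous[OF C_k_derivative[OF \<phi>]] C_k_continuous[OF C_k_derivative[OF \<psi>]]
      C_k_continuous[OF \<phi>] C_k_continuous[OF \<psi>]
    by (auto intro!: continuous_on_mult)
  have int: "integrable lborel ?f" "integrable lborel ?g"
    using frechet_derivative_outside[OF K] K(2)
    by (auto intro!: integrable_continuous_compact_support[OF _ K(1)] cont)
  have deriv: "((\<lambda>x. \<psi> x * \<phi> x) has_derivative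
      (\<lambda>v. \<psi> x * frechet_derivative \<phi> (at x) v + frechet_derivative \<psi> (at x) v * \<phi> x)) (at x)" for x
    by (rule has_derivative_mult[OF C_k_has_derivative[OF \<psi>] C_k_has_derivative[OF \<phi>]])
  have "frechet_derivative (\<lambda>x. \<psi> x * \<phi> x) (at x) v = ?f x + ?g x" for x
    by (simp add: frechet_derivative_at[OF deriv, symmetric])
  moreover have "(LINT x|lborel. frechet_derivative (\<lambda>x. \<psi> x * \<phi> x) (at x) v) = 0"
    using K by (intro integral_directional_derivative_zero C_k_mult[OF \<psi> \<phi>]) auto
  ultimately have "(LINT x|lborel. ?f x) + (LINT x|lborel. ?g x) = 0"
    using int by simp
  moreover have "(LINT x|lebesgue. ?f x) = (LINT x|lborel. ?f x)" "(LINT x|lebesgue. ?g x) = (LINT x|lborel. ?g x)"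
    using int by (auto intro!: integral_completion)
  ultimately show ?thesis by linarith
qed

section \<open>Weak derivatives\<close>

lemma L1_loc_add:
  assumes "f \<in> L1_loc S" "g \<in> L1_loc S"
  shows "(\<lambda>x. f x + g x) \<in> L1_loc S"
  using assms by (auto simp: L1_loc_def)

lemma L1_loc_bounded_linear:
  fixes g :: "'a::euclidean_space \<Rightarrow> 'b::euclidean_space" and L :: "'b \<Rightarrow> 'c::euclidean_space"
  assumes "bounded_linear L" "g \<in> L1_loc S"
  shows "(\<lambda>x. L (g x)) \<in> L1_loc S"
  using assms unfolding L1_loc_def
  by (auto intro: integrable_bounded_linear borel_measurable_continuous_on linear_continuous_on)

lemma L1_loc_diff:
  fixes f g :: "'a::euclidean_space \<Rightarrow> 'b::euclidean_space"
  assumes "f \<in> L1_loc S" "g \<in> L1_loc S"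
  shows "(\<lambda>x. f x - g x) \<in> L1_loc S"
  using assms by (auto simp: L1_loc_def)

lemma continuous_measurable_lebesgue_on:
  fixes g :: "'a::euclidean_space \<Rightarrow> 'b::euclidean_space"
  assumes "continuous_on UNIV g"
  shows "g \<in> borel_measurable (lebesgue_on S)"
  using borel_measurable_continuous_onI[OF assms]
  by (intro measurable_restrict_space1) (simp add: measurable_completion)

lemma continuous_L1_loc:
  fixes g :: "'a::euclidean_space \<Rightarrow> 'b::euclidean_space"
  assumes "continuous_on UNIV g"
  shows "g \<in> L1_loc S"
  unfolding L1_loc_def
proof (intro CollectI conjI allI impI continuous_measurable_lebesgue_on[OF assms])
  fix K :: "'a set" assume K: "compact K \<and> K \<subseteq> S"
  then have "integrable lborel (\<lambda>x. indicator K x *\<^sub>R g x)"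
    using assms by (intro borel_integrable_compact) (auto intro: continuous_on_subset)
  then have "integrable lebesgue (\<lambda>x. indicator K x *\<^sub>R g x)"
    by (intro integrable_completion[THEN iffD2]) auto
  then show "integrable (lebesgue_on K) g"
    using K by (simp add: integrable_lebesgue_on_iff lmeasurable_compact fmeasurableD)
qed

lemma grad_nth: "grad \<phi> x $ j = frechet_derivative \<phi> (at x) (axis j 1)"
  by (simp add: grad_def)

lemma L1_loc_integrable_test:
  fixes g :: "'a::euclidean_space \<Rightarrow> real"
  assumes S: "open S" and g: "g \<in> L1_loc S" and \<phi>: "\<phi> \<in> test_functions S"
  shows "integrable (lebesgue_on S) (\<lambda>x. g x * \<phi> x)"
    and "integrable (lebesgue_on S) (\<lambda>x. g x * frechet_derivative \<phi> (at x) v)"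
proof -
  obtain K where K: "compact K" "K \<subseteq> S" "\<And>x. x \<notin> K \<Longrightarrow> \<phi> x = 0"
    by (rule test_functionsE[OF \<phi>]) blast
  have C: "C_k (Suc 0) \<phi>" by (rule test_functions_C_k[OF \<phi>])
  have S': "S \<in> sets lebesgue" using S by simp
  show "integrable (lebesgue_on S) (\<lambda>x. g x * \<phi> x)"
    by (rule L1_loc_integrable_mult[OF S' g K(1,2) C_k_continuous[OF C] K(3)])
  show "integrable (lebesgue_on S) (\<lambda>x. g x * frechet_derivative \<phi> (at x) v)"
    using frechet_derivative_outside[OF K(1,3)]
    by (intro L1_loc_integrable_mult[OF S' g K(1,2)] C_k_continuous[OF C_k_derivative[OF C]]) auto
qed

lemma has_weak_gradient_nth:
  assumes "has_weak_gradient S u G"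
  shows "(\<lambda>x. u x $ i) \<in> L1_loc S" "(\<lambda>x. G x $ i $ j) \<in> L1_loc S"
proof -
  have "u \<in> L1_loc S" "G \<in> L1_loc S"
    using assms by (auto simp: has_weak_gradient_def)
  then show "(\<lambda>x. u x $ i) \<in> L1_loc S" "(\<lambda>x. G x $ i $ j) \<in> L1_loc S"
    by (auto intro!: L1_loc_bounded_linear[of "\<lambda>x. x $ i"] L1_loc_bounded_linear[of "\<lambda>x. x $ i $ j"]
        bounded_linear_compose[OF bounded_linear_vec_nth[of j] bounded_linear_vec_nth[of i]])
qed

lemma has_weak_gradient_add_scaled:
  fixes u v :: "real^'d::finite \<Rightarrow> real^'m::finite"
  assumes S: "open S" and u: "has_weak_gradient S u G" and v: "has_weak_gradient S v H"
  shows "has_weak_gradient S (\<lambda>x. u x + c *\<^sub>R v x) (\<lambda>x. G x + c *\<^sub>R H x)"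
  unfolding has_weak_gradient_def
proof (intro conjI ballI allI)
  let ?M = "lebesgue_on S"
  show "(\<lambda>x. u x + c *\<^sub>R v x) \<in> L1_loc S" "(\<lambda>x. G x + c *\<^sub>R H x) \<in> L1_loc S"
    using u v by (auto simp: has_weak_gradient_def
        intro!: L1_loc_add L1_loc_bounded_linear[OF bounded_linear_scaleR_right])
  fix \<phi> :: "real^'d \<Rightarrow> real" and i j assume \<phi>: "\<phi> \<in> test_functions S"
  note int = L1_loc_integrable_test[OF S _ \<phi>]
  have eq: "(LINT x|?M. u x $ i * grad \<phi> x $ j) = - (LINT x|?M. G x $ i $ j * \<phi> x)"
    "(LINT x|?M. v x $ i * grad \<phi> x $ j) = - (LINT x|?M. H x $ i $ j * \<phi> x)"
    using u v \<phi> by (auto simp: has_weak_gradient_def)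
  have "(LINT x|?M. (u x + c *\<^sub>R v x) $ i * grad \<phi> x $ j)
      = (LINT x|?M. u x $ i * grad \<phi> x $ j + c * (v x $ i * grad \<phi> x $ j))"
    by (simp add: algebra_simps)
  also have "\<dots> = (LINT x|?M. u x $ i * grad \<phi> x $ j) + c * (LINT x|?M. v x $ i * grad \<phi> x $ j)"
    using int(2)[OF has_weak_gradient_nth(1)[OF u]] int(2)[OF has_weak_gradient_nth(1)[OF v]]
    by (simp add: grad_nth)
  also have "\<dots> = - ((LINT x|?M. G x $ i $ j * \<phi> x) + c * (LINT x|?M. H x $ i $ j * \<phi> x))"
    unfolding eq by simp
  also have "(LINT x|?M. G x $ i $ j * \<phi> x) + c * (LINT x|?M. H x $ i $ j * \<phi> x)
      = (LINT x|?M. G x $ i $ j * \<phi> x + c * (H x $ i $ j * \<phi> x))"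
    using int(1)[OF has_weak_gradient_nth(2)[OF u]] int(1)[OF has_weak_gradient_nth(2)[OF v]]
    by simp
  also have "\<dots> = (LINT x|?M. (G x + c *\<^sub>R H x) $ i $ j * \<phi> x)"
    by (simp add: algebra_simps)
  finally show "(LINT x|?M. (u x + c *\<^sub>R v x) $ i * grad \<phi> x $ j)
      = - (LINT x|?M. (G x + c *\<^sub>R H x) $ i $ j * \<phi> x)" .
qed

lemma has_weak_gradient_unique:
  fixes u :: "real^'d::finite \<Rightarrow> real^'m::finite"
  assumes S: "open S" and G: "has_weak_gradient S u G" and H: "has_weak_gradient S u H"
  shows "AE x in lebesgue_on S. G x = H x"
proof -
  let ?M = "lebesgue_on S"
  have "AE x in ?M. G x $ i $ j - H x $ i $ j = 0" for i j
  proof (rule du_Bois_Reymond[OF S])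
    show "(\<lambda>x. G x $ i $ j - H x $ i $ j) \<in> L1_loc S"
      by (intro L1_loc_diff has_weak_gradient_nth(2)[OF G] has_weak_gradient_nth(2)[OF H])
    fix \<phi> :: "real^'d \<Rightarrow> real" assume \<phi>: "\<phi> \<in> test_functions S"
    note int = L1_loc_integrable_test(1)[OF S _ \<phi>]
    have "(LINT x|?M. G x $ i $ j * \<phi> x) = (LINT x|?M. H x $ i $ j * \<phi> x)"
    proof -
      have "(LINT x|?M. u x $ i * grad \<phi> x $ j) = - (LINT x|?M. G x $ i $ j * \<phi> x)"
        "(LINT x|?M. u x $ i * grad \<phi> x $ j) = - (LINT x|?M. H x $ i $ j * \<phi> x)"
        using G H \<phi> unfolding has_weak_gradient_def by blast+
      then show ?thesis by simp
    qed
    then show "(LINT x|?M. (G x $ i $ j - H x $ i $ j) * \<phi> x) = 0"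
      using int[OF has_weak_gradient_nth(2)[OF G]] int[OF has_weak_gradient_nth(2)[OF H]]
      by (simp add: left_diff_distrib)
  qed
  then have "AE x in ?M. \<forall>j. G x $ i $ j - H x $ i $ j = 0" for i
    by (rule eventually_all_finite)
  then have "AE x in ?M. \<forall>i j. G x $ i $ j - H x $ i $ j = 0"
    by (rule eventually_all_finite)
  then show ?thesis
    by eventually_elim (simp add: vec_eq_iff)
qed

text \<open>Connects the representative picked by \<open>SOME\<close> with a concretely known weak
  gradient.\<close>

lemma weak_gradient_AE:
  assumes "open S" "has_weak_gradient S u G"
  shows "has_weak_gradient S u (weak_gradient S u)"
    and "AE x in lebesgue_on S. weak_gradient S u x = G x"
proof -
  show "has_weak_gradient S u (weak_gradient S u)"
    unfolding weak_gradient_def using someI[of "has_weak_gradient S u" G] assms(2) by simp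
  then show "AE x in lebesgue_on S. weak_gradient S u x = G x"
    using has_weak_gradient_unique assms by blast
qed

lemma weak_div_AE:
  fixes u :: "real^'d::finite \<Rightarrow> real^'d"
  assumes S: "open S" and v: "has_weak_div S u v"
  shows "has_weak_div S u (weak_div S u)"
    and "AE x in lebesgue_on S. weak_div S u x = v x"
proof -
  let ?M = "lebesgue_on S"
  show w: "has_weak_div S u (weak_div S u)"
    unfolding weak_div_def using someI[of "has_weak_div S u" v] v by simp
  let ?w = "weak_div S u"
  have L: "v \<in> L1_loc S" "?w \<in> L1_loc S"
    using v w by (auto simp: has_weak_div_def)
  have "AE x in ?M. ?w x - v x = 0"
  proof (rule du_Bois_Reymond[OF S])
    show "(\<lambda>x. ?w x - v x) \<in> L1_loc S" using L by (intro L1_loc_diff)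
    fix \<phi> :: "real^'d \<Rightarrow> real" assume \<phi>: "\<phi> \<in> test_functions S"
    have "(LINT x|?M. ?w x * \<phi> x) = (LINT x|?M. v x * \<phi> x)"
      using v w \<phi> by (simp add: has_weak_div_def)
    then show "(LINT x|?M. (?w x - v x) * \<phi> x) = 0"
      using L1_loc_integrable_test(1)[OF S L(1) \<phi>] L1_loc_integrable_test(1)[OF S L(2) \<phi>]
      by (simp add: left_diff_distrib)
  qed
  then show "AE x in ?M. weak_div S u x = v x" by simp
qed

text \<open>The classical Jacobian matrix, whose row \<open>i\<close> is the gradient of the
  component \<open>i\<close>. Unlike \<open>weak_gradient\<close> it is linear at every point and
  not only almost everywhere, so the pairs formed with it are a genuine subspace of
  functions.\<close>

definition test_gradient :: "(real^'d::finite \<Rightarrow> real^'m::finite) \<Rightarrow> real^'d \<Rightarrow> real^'d^'m" where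
  "test_gradient h x = (\<chi> i j. frechet_derivative h (at x) (axis j 1) $ i)"

lemma frechet_derivative_nth:
  assumes "C_k (Suc 0) h"
  shows "frechet_derivative (\<lambda>y. h y $ i) (at x) v = frechet_derivative h (at x) v $ i"
  using frechet_derivative_at[OF bounded_linear.has_derivative[OF bounded_linear_vec_nth C_k_has_derivative[OF assms]]]
  by metis

lemma continuous_test_gradient:
  assumes "C_k (Suc 0) h"
  shows "continuous_on UNIV (test_gradient h)"
  unfolding test_gradient_def[abs_def]
  using C_k_continuous[OF C_k_derivative[OF assms]]
  by (intro continuous_on_vec_lambda continuous_on_component)

lemma test_gradient_outside:
  assumes "compact K" "\<And>x. x \<notin> K \<Longrightarrow> h x = 0" "x \<notin> K"
  shows "test_gradient h x = 0"
  using frechet_derivative_outside[OF assms] by (simp add: test_gradient_def vec_eq_iff)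

lemma test_gradient_add:
  assumes "C_k (Suc 0) g" "C_k (Suc 0) h"
  shows "test_gradient (\<lambda>x. g x + h x) x = test_gradient g x + test_gradient h x"
  using frechet_derivative_at[OF has_derivative_add[OF C_k_has_derivative[OF assms(1)] C_k_has_derivative[OF assms(2)]], symmetric]
  by (simp add: test_gradient_def vec_eq_iff)

lemma test_gradient_scaleR:
  assumes "C_k (Suc 0) h"
  shows "test_gradient (\<lambda>x. c *\<^sub>R h x) x = c *\<^sub>R test_gradient h x"
  using frechet_derivative_at[OF has_derivative_scaleR_right[OF C_k_has_derivative[OF assms]], symmetric]
  by (simp add: test_gradient_def vec_eq_iff)

text \<open>Both a test function and its derivative vanish outside \<open>S\<close>, so the
  integrals over \<open>S\<close> are integrals over the whole space, where integration by parts
  holds.\<close>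

lemma has_weak_gradient_test_function:
  fixes h :: "real^'d::finite \<Rightarrow> real^'m::finite"
  assumes S: "open S" and h: "h \<in> test_functions S"
  shows "has_weak_gradient S h (test_gradient h)"
  unfolding has_weak_gradient_def
proof (intro conjI ballI allI)
  have C: "C_k (Suc 0) h" by (rule test_functions_C_k[OF h])
  show "h \<in> L1_loc S" "test_gradient h \<in> L1_loc S"
    by (auto intro!: continuous_L1_loc C_k_continuous[OF C] continuous_test_gradient[OF C])
  fix \<phi> :: "real^'d \<Rightarrow> real" and i j assume \<phi>: "\<phi> \<in> test_functions S"
  obtain K where K: "compact K" "K \<subseteq> S" "\<And>x. x \<notin> K \<Longrightarrow> \<phi> x = 0"
    by (rule test_functionsE[OF \<phi>]) blast
  have C\<phi>: "C_k (Suc 0) \<phi>" by (rule test_functions_C_k[OF \<phi>])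
  have Ci: "C_k (Suc 0) (\<lambda>y. h y $ i)"
    by (rule C_k_bounded_linear[OF bounded_linear_vec_nth C])
  have S': "S \<in> sets lebesgue" using S by simp
  have outside: "frechet_derivative \<phi> (at x) = (\<lambda>v. 0)" if "x \<notin> S" for x
    using frechet_derivative_outside[where \<phi> = \<phi> and x = x, OF K(1,3)] K(2) that by blast
  have "(LINT x|lebesgue_on S. h x $ i * grad \<phi> x $ j) = (LINT x|lebesgue. h x $ i * grad \<phi> x $ j)"
    unfolding integral_lebesgue_on_eq[OF S']
    by (intro Bochner_Integration.integral_cong) (auto simp: indicator_def grad_nth outside)
  also have "\<dots> = - (LINT x|lebesgue. test_gradient h x $ i $ j * \<phi> x)"
    using integration_by_parts_compact_support[OF C\<phi> Ci K(1,3), of "axis j 1"]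
    by (simp add: grad_nth test_gradient_def frechet_derivative_nth[OF C])
  also have "(LINT x|lebesgue. test_gradient h x $ i $ j * \<phi> x)
      = (LINT x|lebesgue_on S. test_gradient h x $ i $ j * \<phi> x)"
    unfolding integral_lebesgue_on_eq[OF S'] using K(2,3)
    by (intro Bochner_Integration.integral_cong) (auto simp: indicator_def)
  finally show "(LINT x|lebesgue_on S. h x $ i * grad \<phi> x $ j)
      = - (LINT x|lebesgue_on S. test_gradient h x $ i $ j * \<phi> x)" .
qed

section \<open>Lebesgue spaces\<close>

lemma exponent_cases:
  fixes q :: ennreal
  assumes "1 \<le> q"
  obtains "q = top" | r where "q = ennreal r" "1 \<le> r" "q \<noteq> top" "enn2real q = r"
  using assms by (cases q) auto

lemma conj_exponent_top [simp]: "conj_exponent top = 1"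
  by (simp add: conj_exponent_def)

lemma conj_exponent_1 [simp]: "conj_exponent 1 = top"
  by (simp add: conj_exponent_def)

lemma conj_exponent_ennreal:
  assumes "1 < r"
  shows "conj_exponent (ennreal r) = ennreal (r / (r - 1))"
proof -
  have "1 - inverse (ennreal r) = ennreal (1 - 1 / r)"
    using assms by (simp add: inverse_ennreal ennreal_minus[symmetric] inverse_eq_divide flip: ennreal_1)
  also have "inverse \<dots> = ennreal (r / (r - 1))"
    using assms by (subst inverse_ennreal) (auto simp: divide_simps)
  finally show ?thesis by (simp add: conj_exponent_def)
qed

lemma conj_exponent_ge_1:
  assumes "1 \<le> p"
  shows "1 \<le> conj_exponent p"
  using assms
proof (cases rule: exponent_cases)
  case (2 r)
  show ?thesis
  proof (cases "r = 1")
    case False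
    with 2 have "1 < r" by simp
    then show ?thesis
      using 2 by (simp add: conj_exponent_ennreal flip: ennreal_1)
  qed (simp add: 2)
qed simp

text \<open>Replaces the extended-real essential supremum by a real bound almost everywhere.\<close>

lemma Lp_top_iff: "g \<in> Lp M top \<longleftrightarrow> g \<in> borel_measurable M \<and> (\<exists>B\<ge>0. AE x in M. norm (g x) \<le> B)"
proof (intro iffI conjI)
  assume g: "g \<in> Lp M top"
  then show "g \<in> borel_measurable M" by (simp add: Lp_def)
  have fin: "esssup M (\<lambda>x. ennreal (norm (g x))) < top" using g by (simp add: Lp_def)
  show "\<exists>B\<ge>0. AE x in M. norm (g x) \<le> B"
  proof (intro exI conjI)
    show "AE x in M. norm (g x) \<le> enn2real (esssup M (\<lambda>x. ennreal (norm (g x))))"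
      using esssup_AE[of "\<lambda>x. ennreal (norm (g x))" M]
    proof eventually_elim
      case (elim x)
      then show ?case
        using fin by (metis enn2real_ennreal enn2real_mono norm_ge_zero)
    qed
  qed simp
next
  assume g: "g \<in> borel_measurable M \<and> (\<exists>B\<ge>0. AE x in M. norm (g x) \<le> B)"
  then obtain B where "0 \<le> B" "AE x in M. norm (g x) \<le> B" by blast
  then have "AE x in M. ennreal (norm (g x)) \<le> ennreal B"
    by (auto elim!: eventually_mono intro: ennreal_leI)
  then have "esssup M (\<lambda>x. ennreal (norm (g x))) \<le> ennreal B"
    using g by (intro esssup_I) auto
  then show "g \<in> Lp M top"
    using g by (auto simp: Lp_def intro: le_less_trans)
qed

lemma Lp_measurable: "g \<in> Lp M q \<Longrightarrow> g \<in> borel_measurable M"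
  by (simp add: Lp_def)

lemma Lp_finite_iff:
  assumes "q \<noteq> top"
  shows "g \<in> Lp M q \<longleftrightarrow> g \<in> borel_measurable M \<and> integrable M (\<lambda>x. norm (g x) powr enn2real q)"
  using assms by (simp add: Lp_def)

lemma Lp_bound:
  assumes q: "1 \<le> q" and g: "g \<in> Lp M q" and f: "f \<in> borel_measurable M"
    and le: "AE x in M. norm (f x) \<le> norm (g x)"
  shows "f \<in> Lp M q"
  using q
proof (cases rule: exponent_cases)
  case 1
  then obtain B where "0 \<le> B" "AE x in M. norm (g x) \<le> B"
    using g by (auto simp: Lp_top_iff)
  moreover from this(2) le have "AE x in M. norm (f x) \<le> B"
    by eventually_elim linarith
  ultimately show ?thesis using 1 f by (auto simp: Lp_top_iff)
next
  case (2 r)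
  have "integrable M (\<lambda>x. norm (f x) powr r)"
  proof (rule Bochner_Integration.integrable_bound)
    show "integrable M (\<lambda>x. norm (g x) powr r)" using g 2 by (simp add: Lp_finite_iff)
    show "AE x in M. norm (norm (f x) powr r) \<le> norm (norm (g x) powr r)"
      using le by eventually_elim (use 2 in \<open>auto intro: powr_mono2\<close>)
  qed (use f in measurable)
  with 2 f show ?thesis by (simp add: Lp_finite_iff)
qed

text \<open>The larger summand dominates, at the price of the crude constant
  \<open>2 powr r\<close>. This is enough to close \<open>Lp\<close> under addition without
  Minkowski's inequality.\<close>

lemma powr_add_le:
  fixes a b r :: real
  assumes "0 \<le> a" "0 \<le> b" "0 \<le> r"
  shows "(a + b) powr r \<le> 2 powr r * (a powr r + b powr r)"
proof -
  have "(a + b) powr r \<le> (2 * max a b) powr r"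
    using assms by (intro powr_mono2) auto
  also have "\<dots> = 2 powr r * max a b powr r"
    using assms by (simp add: powr_mult)
  also have "max a b powr r \<le> a powr r + b powr r"
    by (simp add: max_def)
  finally show ?thesis by simp
qed

lemma Lp_add:
  assumes q: "1 \<le> q" and f: "f \<in> Lp M q" and g: "g \<in> Lp M q"
  shows "(\<lambda>x. f x + g x) \<in> Lp M q"
proof -
  have [measurable]: "f \<in> borel_measurable M" "g \<in> borel_measurable M"
    using f g by (auto intro: Lp_measurable)
  show ?thesis
    using q
  proof (cases rule: exponent_cases)
    case 1
    then obtain A B where "0 \<le> A" "AE x in M. norm (f x) \<le> A" "0 \<le> B" "AE x in M. norm (g x) \<le> B"
      using f g by (auto simp: Lp_top_iff)
    moreover from this(2,4) have "AE x in M. norm (f x + g x) \<le> A + B"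
      by eventually_elim (rule norm_triangle_mono)
    ultimately show ?thesis
      using 1 by (auto simp: Lp_top_iff intro!: exI[of _ "A + B"])
  next
    case (2 r)
    have "integrable M (\<lambda>x. norm (f x + g x) powr r)"
    proof (rule Bochner_Integration.integrable_bound)
      show "integrable M (\<lambda>x. 2 powr r * (norm (f x) powr r + norm (g x) powr r))"
        using f g 2 by (simp add: Lp_finite_iff)
      have "norm (f x + g x) powr r \<le> 2 powr r * (norm (f x) powr r + norm (g x) powr r)" for x
      proof -
        have "norm (f x + g x) powr r \<le> (norm (f x) + norm (g x)) powr r"
          using 2 by (intro powr_mono2 norm_triangle_ineq) auto
        also have "\<dots> \<le> 2 powr r * (norm (f x) powr r + norm (g x) powr r)"
          using 2 by (intro powr_add_le) auto
        finally show ?thesis .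
      qed
      then show "AE x in M. norm (norm (f x + g x) powr r)
          \<le> norm (2 powr r * (norm (f x) powr r + norm (g x) powr r))"
        by (intro AE_I2) simp
    qed measurable
    with 2 show ?thesis by (simp add: Lp_finite_iff)
  qed
qed

lemma Lp_scaleR:
  assumes q: "1 \<le> q" and f: "f \<in> Lp M q"
  shows "(\<lambda>x. c *\<^sub>R f x) \<in> Lp M q"
proof -
  have [measurable]: "f \<in> borel_measurable M"
    using f by (rule Lp_measurable)
  show ?thesis
    using q
  proof (cases rule: exponent_cases)
    case 1
    then obtain A where "0 \<le> A" "AE x in M. norm (f x) \<le> A"
      using f by (auto simp: Lp_top_iff)
    moreover from this(2) have "AE x in M. norm (c *\<^sub>R f x) \<le> \<bar>c\<bar> * A"
      by eventually_elim (simp add: mult_left_mono)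
    ultimately show ?thesis
      using 1 by (auto simp: Lp_top_iff intro!: exI[of _ "\<bar>c\<bar> * A"])
  next
    case (2 r)
    then show ?thesis
      using f by (simp add: Lp_finite_iff powr_mult)
  qed
qed

lemma Lp_norm_real: "f \<in> Lp M q \<Longrightarrow> (\<lambda>x. norm (f x)) \<in> Lp M q"
  by (auto simp: Lp_def)

lemma Lp_const_bounded: "AE x in M. norm (f x) \<le> B \<Longrightarrow> f \<in> borel_measurable M \<Longrightarrow> f \<in> Lp M top"
  by (auto simp: Lp_top_iff intro!: exI[of _ "max B 0"] elim: eventually_mono)

text \<open>For finite exponents \<open>norm (g x) \<le> 1 + norm (g x) powr r\<close>, and the
  constant 1 is integrable over compact sets; this takes the place of Hoelder's inequality.\<close>

lemma Lp_subset_L1_loc: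
  fixes g :: "'a::euclidean_space \<Rightarrow> 'b::euclidean_space"
  assumes q: "1 \<le> q" and g: "g \<in> Lp (lebesgue_on S) q" and S: "S \<in> sets lebesgue"
  shows "g \<in> L1_loc S"
  unfolding L1_loc_def
proof (intro CollectI conjI allI impI)
  show g_meas: "g \<in> borel_measurable (lebesgue_on S)" using g by (rule Lp_measurable)
  fix K :: "'a set" assume K: "compact K \<and> K \<subseteq> S"
  then have K': "K \<in> sets lebesgue" by (simp add: lmeasurable_compact fmeasurableD)
  have one: "integrable lebesgue (indicat_real K)"
    using K lmeasurable_compact[of K] by (intro integrable_real_indicator) (auto simp: fmeasurable_def)
  have meas: "(\<lambda>x. indicator S x *\<^sub>R g x) \<in> borel_measurable lebesgue"
    using g_meas S by (subst (asm) borel_measurable_restrict_space_iff) auto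
  have "(\<lambda>x. indicator K x *\<^sub>R (indicator S x *\<^sub>R g x)) \<in> borel_measurable lebesgue"
    using K' by (intro borel_measurable_scaleR borel_measurable_indicator meas) auto
  moreover have "(\<lambda>x. indicator K x *\<^sub>R (indicator S x *\<^sub>R g x)) = (\<lambda>x. indicator K x *\<^sub>R g x)"
    using K by (intro ext) (auto simp: indicator_def)
  ultimately have meas': "(\<lambda>x. indicator K x *\<^sub>R g x) \<in> borel_measurable lebesgue" by simp
  have "integrable lebesgue (\<lambda>x. indicator K x *\<^sub>R g x)"
    using q
  proof (cases rule: exponent_cases)
    case 1
    then obtain B where B: "0 \<le> B" "AE x in lebesgue_on S. norm (g x) \<le> B"
      using g by (auto simp: Lp_top_iff)
    have "AE x in lebesgue. x \<in> S \<longrightarrow> norm (g x) \<le> B"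
      using B(2) S by (subst (asm) AE_restrict_space_iff) auto
    then have "AE x in lebesgue. norm (indicator K x *\<^sub>R g x) \<le> norm (B * indicat_real K x)"
      by eventually_elim (use K B(1) in \<open>auto simp: indicator_def\<close>)
    then show ?thesis
      by (rule Bochner_Integration.integrable_bound[OF integrable_mult_right[OF one] meas'])
  next
    case (2 r)
    have "integrable (lebesgue_on S) (\<lambda>x. norm (g x) powr r)"
      using g 2 by (simp add: Lp_finite_iff)
    then have int: "integrable lebesgue (\<lambda>x. indicat_real S x * norm (g x) powr r)"
      by (simp add: integrable_lebesgue_on_iff[OF S])
    have "norm (indicator K x *\<^sub>R g x) \<le> norm (indicat_real K x + indicat_real S x * norm (g x) powr r)" for x
    proof (cases "x \<in> K")
      case True
      have "norm (g x) \<le> 1 + norm (g x) powr r"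
      proof (cases "norm (g x) \<le> 1")
        case True
        then show ?thesis using powr_ge_zero[of "norm (g x)" r] by linarith
      next
        case False
        then have "norm (g x) powr 1 \<le> norm (g x) powr r"
          using 2 by (intro powr_mono) auto
        then show ?thesis by simp
      qed
      with True K show ?thesis by (auto simp: indicator_def)
    qed simp
    then show ?thesis
      by (intro Bochner_Integration.integrable_bound[OF Bochner_Integration.integrable_add[OF one int] meas']) auto
  qed
  then show "integrable (lebesgue_on K) g"
    by (simp add: integrable_lebesgue_on_iff[OF K'])
qed

lemma continuous_compact_support_Lp:
  fixes g :: "'a::euclidean_space \<Rightarrow> 'b::euclidean_space"
  assumes q: "1 \<le> q" and g: "continuous_on UNIV g" and K: "compact K" "\<And>x. x \<notin> K \<Longrightarrow> g x = 0"
    and S: "S \<in> sets lebesgue"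
  shows "g \<in> Lp (lebesgue_on S) q"
proof -
  obtain B where B: "0 < B" "\<And>x. norm (g x) \<le> B"
    using continuous_compact_support_bounded[OF g K] by blast
  have m: "g \<in> borel_measurable (lebesgue_on S)"
    by (rule continuous_measurable_lebesgue_on[OF g])
  show ?thesis
    using q
  proof (cases rule: exponent_cases)
    case 1
    then show ?thesis
      using B m by (auto intro: Lp_const_bounded[where B = B])
  next
    case (2 r)
    have "integrable lebesgue (indicat_real K)"
      using K lmeasurable_compact[of K] by (intro integrable_real_indicator) (auto simp: fmeasurable_def)
    then have "integrable lebesgue (\<lambda>x. indicator S x *\<^sub>R (B powr r * indicat_real K x))"
      by (intro integrable_mult_indicator S integrable_mult_right)
    then have int: "integrable (lebesgue_on S) (\<lambda>x. B powr r * indicat_real K x)"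
      by (simp only: integrable_lebesgue_on_iff[OF S])
    have "norm (norm (g x) powr r) \<le> norm (B powr r * indicat_real K x)" for x
      using B 2 K(2)[of x] by (cases "x \<in> K") (auto intro: powr_mono2)
    then have "integrable (lebesgue_on S) (\<lambda>x. norm (g x) powr r)"
      using m by (intro Bochner_Integration.integrable_bound[OF int]) auto
    with 2 m show ?thesis by (simp add: Lp_finite_iff)
  qed
qed

text \<open>Since \<open>(r - 1) * (r / (r - 1)) = r\<close>, the growth terms with exponent
  \<open>r - 1\<close> belong to the same conjugate space as \<gamma>.\<close>

lemma Lp_powr_conj:
  fixes U :: "'x \<Rightarrow> real"
  assumes r: "1 \<le> r" and U: "U \<in> Lp M (ennreal r)" "\<And>x. 0 \<le> U x"
  shows "(\<lambda>x. U x powr (r - 1)) \<in> Lp M (conj_exponent (ennreal r))"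
proof -
  have [measurable]: "U \<in> borel_measurable M" using U(1) by (rule Lp_measurable)
  have fin: "integrable M (\<lambda>x. U x powr r)" using U r by (simp add: Lp_finite_iff)
  show ?thesis
  proof (cases "r = 1")
    \<comment> \<open>Here the function is \<open>U x powr 0\<close>, with values 0 and 1, and the
      conjugate exponent is infinite.\<close>
    case True
    then show ?thesis
      by (auto intro!: Lp_const_bounded[where B = 1] AE_I2)
  next
    case False
    with r have r: "1 < r" by simp
    have "(U x powr (r - 1)) powr (r / (r - 1)) = U x powr r" for x
      using r by (simp add: powr_powr)
    with fin have "integrable M (\<lambda>x. \<bar>U x powr (r - 1)\<bar> powr (r / (r - 1)))"
      by simp
    moreover have "0 \<le> r / (r - 1)" using r by simp
    ultimately show ?thesis
      using r by (simp add: conj_exponent_ennreal Lp_finite_iff enn2real_ennreal)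
  qed
qed

lemma integrable_imp_Lp_1: "integrable M f \<Longrightarrow> f \<in> Lp M 1"
  by (auto simp: Lp_finite_iff integrable_norm)

section \<open>Caratheodory maps and codifferentials\<close>

lemma complete_measure_lebesgue_on:
  assumes "S \<in> sets lebesgue"
  shows "complete_measure (lebesgue_on S)"
proof
  fix A B assume "B \<subseteq> A" "A \<in> null_sets (lebesgue_on S)"
  then have A: "A \<in> null_sets lebesgue" "A \<subseteq> S"
    using assms by (auto simp: null_sets_restrict_space)
  then have "B \<in> null_sets lebesgue"
    using \<open>B \<subseteq> A\<close> by (meson negligible_iff_null_sets negligible_subset)
  then show "B \<in> sets (lebesgue_on S)"
    using A(2) \<open>B \<subseteq> A\<close> assms by (auto simp: sets_restrict_space_iff)
qed

text \<open>Continuity of the integrand and compactness of the codifferentials hold only off null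
  sets, so measurability has to survive arbitrary changes there. This is the use of completeness of
  Lebesgue measure.\<close>

lemma (in complete_measure) borel_measurable_AE_eq:
  fixes f h :: "'a \<Rightarrow> real"
  assumes h: "h \<in> borel_measurable M" and eq: "AE x in M. f x = h x"
  shows "f \<in> borel_measurable M"
  unfolding borel_measurable_iff_greater
proof
  fix a
  obtain N where N: "N \<in> null_sets M" "{x \<in> space M. f x \<noteq> h x} \<subseteq> N"
    using eq by (auto simp: eventually_ae_filter)
  have "{x \<in> space M. a < h x} - N \<in> sets M" "{x \<in> space M. a < f x} \<inter> N \<in> sets M"
    using h N(1) complete[of "{x \<in> space M. a < f x} \<inter> N" N] by auto
  then have "({x \<in> space M. a < h x} - N) \<union> ({x \<in> space M. a < f x} \<inter> N) \<in> sets M"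
    by (rule sets.Un)
  also have "({x \<in> space M. a < h x} - N) \<union> ({x \<in> space M. a < f x} \<inter> N) = {x \<in> space M. a < f x}"
    using N(2) by auto
  finally show "{x \<in> space M. a < f x} \<in> sets M" .
qed

text \<open>Along a simple function the composition is a finite sum of measurable sections cut off
  by level sets. Continuity in the second argument passes to the limit, off a null set.\<close>

lemma (in complete_measure) caratheodory_fun_compose:
  fixes F :: "'a \<Rightarrow> 'y::{second_countable_topology, metric_space} \<Rightarrow> real"
  assumes F: "caratheodory_fun M F" and g: "g \<in> borel_measurable M"
  shows "(\<lambda>x. F x (g x)) \<in> borel_measurable M"
proof -
  obtain s where s: "\<And>i. simple_function M (s i)" "\<And>x. x \<in> space M \<Longrightarrow> (\<lambda>i. s i x) \<longlonglongrightarrow> g x"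
    using borel_measurable_implies_sequence_metric[OF g, of undefined] by blast
  have F_meas: "(\<lambda>x. F x y) \<in> borel_measurable M" for y
    using F by (simp add: caratheodory_fun_def)
  have step: "(\<lambda>x. F x (s i x)) \<in> borel_measurable M" for i
  proof -
    have fin: "finite (s i ` space M)" and pre: "\<And>y. s i -` {y} \<inter> space M \<in> sets M"
      using s(1)[of i] by (auto simp: simple_function_def intro: simple_functionD(2)[OF s(1)])
    have "(\<lambda>x. \<Sum>y\<in>s i ` space M. indicator (s i -` {y} \<inter> space M) x * F x y) \<in> borel_measurable M"
      by (intro borel_measurable_sum borel_measurable_times borel_measurable_indicator pre F_meas)
    moreover have "F x (s i x) = (\<Sum>y\<in>s i ` space M. indicator (s i -` {y} \<inter> space M) x * F x y)"
      if "x \<in> space M" for x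
    proof -
      have "(\<Sum>y\<in>s i ` space M. indicator (s i -` {y} \<inter> space M) x * F x y)
          = (\<Sum>y\<in>s i ` space M. if y = s i x then F x y else 0)"
        using that by (intro sum.cong) (auto simp: indicator_def)
      then show ?thesis using that fin by simp
    qed
    ultimately show ?thesis by (simp cong: measurable_cong)
  qed
  obtain N where N: "N \<in> null_sets M" "\<And>x. x \<in> space M \<Longrightarrow> x \<notin> N \<Longrightarrow> continuous_on UNIV (F x)"
    using F unfolding caratheodory_fun_def eventually_ae_filter by blast
  have N': "N \<in> sets M" using N(1) by auto
  have "(\<lambda>x. indicator (space M - N) x * F x (g x)) \<in> borel_measurable M"
  proof (rule borel_measurable_LIMSEQ_metric)
    show "(\<lambda>x. indicator (space M - N) x * F x (s i x)) \<in> borel_measurable M" for i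
      using N' by (intro borel_measurable_times borel_measurable_indicator step) auto
    fix x assume x: "x \<in> space M"
    show "(\<lambda>i. indicator (space M - N) x * F x (s i x)) \<longlonglongrightarrow> indicator (space M - N) x * F x (g x)"
    proof (cases "x \<in> N")
      case False
      then have "isCont (F x) (g x)"
        using N(2)[OF x] by (simp add: continuous_on_eq_continuous_at)
      then have "(\<lambda>i. F x (s i x)) \<longlonglongrightarrow> F x (g x)"
        using s(2)[OF x] by (rule isCont_tendsto_compose)
      then show ?thesis by (intro tendsto_intros)
    qed simp
  qed
  moreover have "AE x in M. F x (g x) = indicator (space M - N) x * F x (g x)"
    using AE_not_in[OF N(1)] AE_space by eventually_elim simp
  ultimately show ?thesis by (rule borel_measurable_AE_eq)
qed

section \<open>Support functions of codifferentials\<close>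

lemma infdist_le_hausdorff_dist:
  fixes A B :: "'z::metric_space set"
  assumes "compact A" "compact B"
  shows "a \<in> A \<Longrightarrow> infdist a B \<le> hausdorff_dist A B" "b \<in> B \<Longrightarrow> infdist b A \<le> hausdorff_dist A B"
proof -
  have bdd: "bdd_above ((\<lambda>a. infdist a B) ` A)" if "compact A" for A B :: "'z set"
    using that by (intro bounded_imp_bdd_above compact_imp_bounded compact_continuous_image continuous_intros)
  show "infdist a B \<le> hausdorff_dist A B" if "a \<in> A"
    unfolding hausdorff_dist_def using cSUP_upper[OF that bdd[OF assms(1)]] by (rule max.coboundedI1)
  show "infdist b A \<le> hausdorff_dist A B" if "b \<in> B"
    unfolding hausdorff_dist_def using cSUP_upper[OF that bdd[OF assms(2)]] by (rule max.coboundedI2)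
qed

lemma codiff_Phi_le_iff:
  assumes "compact A" "A \<noteq> {}"
  shows "codiff_Phi A h \<le> c \<longleftrightarrow> (\<forall>(a, v)\<in>A. a + v \<bullet> h \<le> c)"
proof
  assume "codiff_Phi A h \<le> c"
  then show "\<forall>(a, v)\<in>A. a + v \<bullet> h \<le> c"
    using order_trans[OF codiff_Phi_attained(2)[OF assms, of _ _ h]] by blast
next
  assume "\<forall>(a, v)\<in>A. a + v \<bullet> h \<le> c"
  then show "codiff_Phi A h \<le> c"
    using codiff_Phi_attained(1)[OF assms, of h] by auto
qed

lemma codiff_Phi_less_iff:
  assumes "compact A" "A \<noteq> {}"
  shows "c < codiff_Phi A h \<longleftrightarrow> (\<exists>(a, v)\<in>A. c < a + v \<bullet> h)"
  using codiff_Phi_le_iff[OF assms, of h c] by (auto simp: split_beta not_le[symmetric])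

text \<open>Moving a maximizer to a nearest point of the other set, at distance \<open>D\<close>,
  changes its first component by at most \<open>D\<close> and its inner product with
  \<open>h\<close> by at most \<open>D * norm h\<close>.\<close>

lemma codiff_Phi_hausdorff:
  fixes A B :: "(real \<times> 'a::euclidean_space) set"
  assumes A: "compact A" "A \<noteq> {}" and B: "compact B" "B \<noteq> {}"
  shows "\<bar>codiff_Phi A h - codiff_Phi B h\<bar> \<le> hausdorff_dist A B * (1 + norm h)"
proof -
  have one_sided: "codiff_Phi A h \<le> codiff_Phi B h + D * (1 + norm h)"
    if A: "compact A" "A \<noteq> {}" and B: "compact B" "B \<noteq> {}"
      and D: "\<And>a. a \<in> A \<Longrightarrow> infdist a B \<le> D" for A B :: "(real \<times> 'a) set" and D
  proof -
    obtain z where z: "z \<in> A" "codiff_Phi A h = fst z + snd z \<bullet> h"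
      using codiff_Phi_attained(1)[OF A] by blast
    obtain y where y: "y \<in> B" "infdist z B = dist z y"
      using infdist_attains_inf[OF compact_imp_closed[OF B(1)] B(2)] by blast
    have d: "dist z y \<le> D" using D[OF z(1)] y(2) by simp
    have "fst z - fst y \<le> dist z y"
      using dist_fst_le[of z y] by (simp add: dist_real_def)
    moreover have "(snd z - snd y) \<bullet> h \<le> dist z y * norm h"
      using norm_cauchy_schwarz[of "snd z - snd y" h]
        mult_right_mono[OF dist_snd_le[of z y] norm_ge_zero[of h]] by (simp add: dist_norm)
    moreover have "fst y + snd y \<bullet> h \<le> codiff_Phi B h"
      using codiff_Phi_attained(2)[OF B, of "fst y" "snd y" h] y(1) by simp
    ultimately have "codiff_Phi A h \<le> codiff_Phi B h + dist z y * (1 + norm h)"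
      unfolding z(2) by (simp add: inner_diff_left algebra_simps)
    also have "dist z y * (1 + norm h) \<le> D * (1 + norm h)"
      using d by (intro mult_right_mono) auto
    finally show ?thesis by simp
  qed
  show ?thesis
    using one_sided[OF A B infdist_le_hausdorff_dist(1)[OF A(1) B(1)]]
      one_sided[OF B A infdist_le_hausdorff_dist(2)[OF A(1) B(1)]]
    by (simp add: abs_le_iff)
qed

lemma codiff_Phi_lipschitz:
  fixes A :: "(real \<times> 'a::euclidean_space) set"
  assumes A: "compact A" "A \<noteq> {}" and R: "\<And>z. z \<in> A \<Longrightarrow> norm (snd z) \<le> R"
  shows "\<bar>codiff_Phi A h - codiff_Phi A h'\<bar> \<le> R * norm (h - h')"
proof -
  have "codiff_Phi A h \<le> codiff_Phi A h' + R * norm (h - h')" for h h'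
  proof -
    obtain z where z: "z \<in> A" "codiff_Phi A h = fst z + snd z \<bullet> h"
      using codiff_Phi_attained(1)[OF A] by blast
    have "snd z \<bullet> h = snd z \<bullet> h' + snd z \<bullet> (h - h')"
      by (simp add: inner_diff_right)
    also have "snd z \<bullet> (h - h') \<le> R * norm (h - h')"
      using mult_right_mono[OF R[OF z(1)] norm_ge_zero[of "h - h'"]] z(1)
        norm_cauchy_schwarz[of "snd z" "h - h'"] by simp
    finally show ?thesis
      using codiff_Phi_attained(2)[OF A, of "fst z" "snd z" h'] z by simp
  qed
  from this[of h h'] this[of h' h] show ?thesis
    by (simp add: abs_le_iff norm_minus_commute)
qed

text \<open>The set is changed first, at a cost measured by the Hausdorff distance, and the argument
  \<open>h\<close> afterwards. The Lipschitz constant \<open>R\<close> is then needed only for the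
  fixed set \<open>G y\<close>.\<close>

lemma continuous_codiff_Phi:
  fixes G :: "'y::metric_space \<Rightarrow> (real \<times> 'a::euclidean_space) set"
  assumes G: "hausdorff_continuous G" and comp: "\<And>y. compact (G y)" "\<And>y. G y \<noteq> {}"
  shows "continuous_on UNIV (\<lambda>(y, h). codiff_Phi (G y) h)"
proof -
  have "isCont (\<lambda>z. codiff_Phi (G (fst z)) (snd z)) (y, h)" for y h
  proof -
    obtain R where R: "\<And>z. z \<in> G y \<Longrightarrow> norm (snd z) \<le> R"
    proof -
      obtain R where "\<And>z. z \<in> G y \<Longrightarrow> norm z \<le> R"
        using compact_imp_bounded[OF comp(1)[of y]] by (auto simp: bounded_iff)
      then show ?thesis
        using that[of R] order_trans[OF norm_snd_le[of "snd z" "fst z" for z]] by (metis prod.collapse)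
    qed
    define d where "d = (\<lambda>y'. hausdorff_dist (G y') (G y))"
    \<comment> \<open>\<open>hausdorff_continuous\<close> speaks of the punctured neighbourhood.
      Together with this value it becomes continuity of \<open>d\<close>, which may be composed with
      \<open>fst\<close> even where \<open>fst z = y\<close>.\<close>
    have "d y = 0"
      using comp[of y] by (simp add: d_def hausdorff_dist_def)
    then have "isCont d y"
      using G unfolding isCont_def d_def hausdorff_continuous_def by simp
    then have "((\<lambda>z. d (fst z)) \<longlongrightarrow> d y) (at (y, h))"
      using isCont_tendsto_compose[of y d fst "at (y, h)"] tendsto_fst[OF tendsto_ident_at, of "(y, h)" UNIV] by simp
    then have d0: "((\<lambda>z. d (fst z)) \<longlongrightarrow> 0) (at (y, h))"
      using \<open>d y = 0\<close> by simp
    have snd: "(snd \<longlongrightarrow> h) (at (y, h))"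
      using tendsto_snd[OF tendsto_ident_at, of "(y, h)" UNIV] by simp
    have "((\<lambda>z. d (fst z) * (1 + norm (snd z)) + R * norm (snd z - h)) \<longlongrightarrow> 0 * (1 + norm h) + R * norm (h - h)) (at (y, h))"
      by (intro tendsto_intros d0 snd)
    then have lim: "((\<lambda>z. d (fst z) * (1 + norm (snd z)) + R * norm (snd z - h)) \<longlongrightarrow> 0) (at (y, h))"
      by simp
    have "\<bar>codiff_Phi (G (fst z)) (snd z) - codiff_Phi (G y) h\<bar> \<le> d (fst z) * (1 + norm (snd z)) + R * norm (snd z - h)" for z
      using codiff_Phi_hausdorff[OF comp[of "fst z"] comp[of y], of "snd z"]
        codiff_Phi_lipschitz[OF comp[of y], of R "snd z" h, OF R] unfolding d_def by linarith
    then have "((\<lambda>z. codiff_Phi (G (fst z)) (snd z) - codiff_Phi (G y) h) \<longlongrightarrow> 0) (at (y, h))"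
      by (intro Lim_null_comparison[OF _ lim] always_eventually) simp
    then show ?thesis
      by (simp add: isCont_def LIM_zero_iff)
  qed
  then show ?thesis
    by (auto simp: continuous_on_eq_continuous_at split_beta)
qed

text \<open>The support function exceeds \<open>c\<close> exactly if the set meets an open half
  space, which is the kind of event that \<open>measurable_multifun\<close> makes measurable. Thus
  the support function is a Caratheodory function of the pair \<open>(y, h)\<close>.\<close>

lemma (in complete_measure) codiff_Phi_compose_measurable:
  fixes G :: "'a \<Rightarrow> 'y::{second_countable_topology, metric_space} \<Rightarrow> (real \<times> 'b::euclidean_space) set"
  assumes G: "caratheodory_multifun M G"
    and comp: "AE x in M. \<forall>y. compact (G x y) \<and> G x y \<noteq> {}"
    and y: "y \<in> borel_measurable M" and h: "h \<in> borel_measurable M"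
  shows "(\<lambda>x. codiff_Phi (G x (y x)) (h x)) \<in> borel_measurable M"
proof -
  have "AE x in M. (\<forall>y. compact (G x y) \<and> G x y \<noteq> {}) \<and> hausdorff_continuous (G x)"
    using comp G by (auto simp: caratheodory_multifun_def)
  then obtain N where N: "N \<in> null_sets M"
    and good: "\<And>x. x \<in> space M \<Longrightarrow> x \<notin> N \<Longrightarrow> (\<forall>y. compact (G x y) \<and> G x y \<noteq> {}) \<and> hausdorff_continuous (G x)"
    unfolding eventually_ae_filter by blast
  have N': "N \<in> sets M" using N by auto
  \<comment> \<open>On \<open>N\<close> the sets may fail to be compact and the supremum is
    uncontrolled; the value 0 there gives measurable sections for every \<open>z\<close>.\<close>
  define F where "F x z = (if x \<in> N then 0 else codiff_Phi (G x (fst z)) (snd z))" for x and z :: "'y \<times> 'b"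
  have "caratheodory_fun M F"
    unfolding caratheodory_fun_def
  proof (intro conjI allI)
    fix z :: "'y \<times> 'b"
    show "(\<lambda>x. F x z) \<in> borel_measurable M"
      unfolding borel_measurable_iff_greater
    proof
      fix c
      have "open {w :: real \<times> 'b. c < fst w + snd w \<bullet> snd z}"
        by (intro open_Collect_less continuous_intros)
      then have m: "{x \<in> space M. G x (fst z) \<inter> {w. c < fst w + snd w \<bullet> snd z} \<noteq> {}} \<in> sets M"
        using G by (simp add: caratheodory_multifun_def measurable_multifun_def)
      have "{x \<in> space M. c < F x z} = ({x \<in> space M. G x (fst z) \<inter> {w. c < fst w + snd w \<bullet> snd z} \<noteq> {}} - N)
          \<union> (if c < 0 then N else {})"
      proof (intro equalityI subsetI)
        fix x assume x: "x \<in> {x \<in> space M. c < F x z}"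
        then show "x \<in> ({x \<in> space M. G x (fst z) \<inter> {w. c < fst w + snd w \<bullet> snd z} \<noteq> {}} - N) \<union> (if c < 0 then N else {})"
          using good[of x] codiff_Phi_less_iff[of "G x (fst z)" c "snd z"]
          by (cases "x \<in> N") (auto simp: F_def split_beta)
      next
        fix x assume x: "x \<in> ({x \<in> space M. G x (fst z) \<inter> {w. c < fst w + snd w \<bullet> snd z} \<noteq> {}} - N) \<union> (if c < 0 then N else {})"
        show "x \<in> {x \<in> space M. c < F x z}"
        proof (cases "x \<in> N")
          case True
          with x sets.sets_into_space[OF N'] show ?thesis by (auto simp: F_def split: if_splits)
        next
          case False
          with x have "x \<in> space M" "\<exists>(a, v)\<in>G x (fst z). c < a + v \<bullet> snd z"
            by (auto split: if_splits)
          then show ?thesis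
            using good[of x] False codiff_Phi_less_iff[of "G x (fst z)" c "snd z"] by (simp add: F_def)
        qed
      qed
      then show "{x \<in> space M. c < F x z} \<in> sets M"
        using m N' by simp
    qed
  next
    show "AE x in M. continuous_on UNIV (F x)"
      using AE_not_in[OF N] AE_space
    proof eventually_elim
      case (elim x)
      then have "continuous_on UNIV (\<lambda>(y, h). codiff_Phi (G x y) h)"
        using good[of x] by (intro continuous_codiff_Phi) auto
      then show ?case
        using elim by (simp add: F_def[abs_def] split_beta)
    qed
  qed
  then have "(\<lambda>x. F x (y x, h x)) \<in> borel_measurable M"
    by (rule caratheodory_fun_compose[of F "\<lambda>x. (y x, h x)", OF _ borel_measurable_Pair[OF y h]])
  moreover have "AE x in M. codiff_Phi (G x (y x)) (h x) = F x (y x, h x)"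
    using AE_not_in[OF N] by eventually_elim (simp add: F_def)
  ultimately show ?thesis by (rule borel_measurable_AE_eq)
qed

lemma convex_codiff_Phi:
  fixes A :: "(real \<times> 'a::euclidean_space) set"
  assumes A: "compact A" "A \<noteq> {}"
  shows "convex_on UNIV (codiff_Phi A)"
proof (rule convex_onI)
  fix t :: real and x y :: 'a assume t: "0 < t" "t < 1"
  obtain z where z: "z \<in> A" "codiff_Phi A ((1 - t) *\<^sub>R x + t *\<^sub>R y) = fst z + snd z \<bullet> ((1 - t) *\<^sub>R x + t *\<^sub>R y)"
    using codiff_Phi_attained(1)[OF A] by blast
  have "fst z + snd z \<bullet> ((1 - t) *\<^sub>R x + t *\<^sub>R y) = (1 - t) * (fst z + snd z \<bullet> x) + t * (fst z + snd z \<bullet> y)"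
    by (simp add: inner_add_right algebra_simps)
  also have "\<dots> \<le> (1 - t) * codiff_Phi A x + t * codiff_Phi A y"
    using t z(1) codiff_Phi_attained(2)[OF A, of "fst z" "snd z"]
    by (intro add_mono mult_left_mono) auto
  finally show "codiff_Phi A ((1 - t) *\<^sub>R x + t *\<^sub>R y) \<le> (1 - t) * codiff_Phi A x + t * codiff_Phi A y"
    using z(2) by simp
qed simp

lemma codiff_Phi_normalized:
  assumes A: "compact A" "A \<noteq> {}" and 0: "codiff_Phi A 0 = 0"
  shows "(a, v) \<in> A \<Longrightarrow> a \<le> 0" "\<exists>v. (0, v) \<in> A"
  using codiff_Phi_attained(2)[OF A, of _ _ 0] codiff_Phi_attained(1)[OF A, of 0] 0 by auto

lemma codiff_Psi_normalized:
  assumes B: "compact B" "B \<noteq> {}" and 0: "codiff_Psi B 0 = 0"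
  shows "(b, w) \<in> B \<Longrightarrow> 0 \<le> b" "\<exists>w. (0, w) \<in> B"
  using codiff_Psi_attained(2)[OF B, of _ _ 0] codiff_Psi_attained(1)[OF B, of 0] 0 by auto

text \<open>The maximizer has first component at most 0, so its inner product with \<open>h\<close>
  bounds the value from above. Some element has first component 0 and bounds it from below.\<close>

lemma codiff_Phi_abs_le:
  assumes A: "compact A" "A \<noteq> {}" "codiff_Phi A 0 = 0"
    and L: "\<And>a v. (a, v) \<in> A \<Longrightarrow> \<bar>v \<bullet> h\<bar> \<le> L"
  shows "\<bar>codiff_Phi A h\<bar> \<le> L"
proof -
  obtain v where v: "(0, v) \<in> A" using codiff_Phi_normalized(2)[OF A] by blast
  obtain z where z: "z \<in> A" "codiff_Phi A h = fst z + snd z \<bullet> h"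
    using codiff_Phi_attained(1)[OF A(1,2)] by blast
  show ?thesis
    using codiff_Phi_attained(2)[OF A(1,2) v, of h] L[OF v] L[of "fst z" "snd z"]
      codiff_Phi_normalized(1)[OF A, of "fst z" "snd z"] z by auto
qed

lemma codiff_Psi_abs_le:
  assumes B: "compact B" "B \<noteq> {}" "codiff_Psi B 0 = 0"
    and L: "\<And>b w. (b, w) \<in> B \<Longrightarrow> \<bar>w \<bullet> h\<bar> \<le> L"
  shows "\<bar>codiff_Psi B h\<bar> \<le> L"
proof -
  obtain w where w: "(0, w) \<in> B" using codiff_Psi_normalized(2)[OF B] by blast
  obtain z where z: "z \<in> B" "codiff_Psi B h = fst z + snd z \<bullet> h"
    using codiff_Psi_attained(1)[OF B(1,2)] by blast
  show ?thesis
    using codiff_Psi_attained(2)[OF B(1,2) w, of h] L[OF w] L[of "fst z" "snd z"]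
      codiff_Psi_normalized(1)[OF B, of "fst z" "snd z"] z by auto
qed

text \<open>The first components of the points of \<open>A\<close> are nonpositive, so a hyperplane separating
  \<open>(0, v)\<close> from \<open>A\<close> may be taken with nonnegative first coefficient.\<close>

lemma codiff_Phi_memI:
  fixes A :: "(real \<times> 'a::euclidean_space) set"
  assumes A: "compact A" "A \<noteq> {}" "codiff_Phi A 0 = 0" "convex A"
    and v: "\<And>h. v \<bullet> h \<le> codiff_Phi A h"
  shows "(0, v) \<in> A"
proof (rule ccontr)
  assume "(0, v) \<notin> A"
  then obtain n b where n: "n \<bullet> (0, v) < b" "\<And>z. z \<in> A \<Longrightarrow> b < n \<bullet> z"
    using separating_hyperplane_closed_point[OF A(4) compact_imp_closed[OF A(1)]] by metis
  obtain c k where ck: "n = (- c, - k)"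
    using that[of "- fst n" "- snd n"] by simp
  have sep: "c * fst z + k \<bullet> snd z < k \<bullet> v" if "z \<in> A" for z
    using n(1) n(2)[OF that] by (auto simp: ck inner_prod_def)
  show False
  proof (cases "0 < c")
    \<comment> \<open>Dividing by \<open>c\<close> normalizes the separating functional to first
      coefficient 1, so the test direction is \<open>k /\<^sub>R c\<close>.\<close>
    case True
    obtain z where z: "z \<in> A" "codiff_Phi A (k /\<^sub>R c) = fst z + snd z \<bullet> (k /\<^sub>R c)"
      using codiff_Phi_attained(1)[OF A(1,2)] by blast
    have "v \<bullet> (k /\<^sub>R c) \<le> fst z + snd z \<bullet> (k /\<^sub>R c)" using v z(2) by metis
    then have "v \<bullet> k \<le> c * fst z + snd z \<bullet> k"
      using True by (simp add: field_simps)
    with sep[OF z(1)] show False by (simp add: inner_commute)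
  next
    case False
    obtain z where z: "z \<in> A" "codiff_Phi A k = fst z + snd z \<bullet> k"
      using codiff_Phi_attained(1)[OF A(1,2)] by blast
    have "fst z \<le> 0" using codiff_Phi_normalized(1)[OF A(1-3), of "fst z" "snd z"] z(1) by simp
    moreover from this have "0 \<le> c * fst z"
      using False by (simp add: mult_nonpos_nonpos)
    ultimately show False
      using sep[OF z(1)] v[of k] z(2) by (simp add: inner_commute)
  qed
qed

text \<open>The function need not be differentiable along the segment, but near each of its points
  the increment to either side is at most \<open>2 * L + e\<close> times the distance: one
  \<open>L\<close> from \<open>codiff_Phi\<close>, one from \<open>codiff_Psi\<close>, and
  \<open>e\<close> from the remainder. Bolzano's bisection principle glues these local
  estimates.\<close>

lemma mean_value_codifferential:
  fixes F :: "'a::euclidean_space \<Rightarrow> real"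
  assumes t: "0 \<le> t"
    and cod: "\<And>s. 0 \<le> s \<Longrightarrow> s \<le> t \<Longrightarrow> has_codifferential F (A s) (B s) (y + s *\<^sub>R h)"
    and LA: "\<And>s a v. 0 \<le> s \<Longrightarrow> s \<le> t \<Longrightarrow> (a, v) \<in> A s \<Longrightarrow> \<bar>v \<bullet> h\<bar> \<le> L"
    and LB: "\<And>s b w. 0 \<le> s \<Longrightarrow> s \<le> t \<Longrightarrow> (b, w) \<in> B s \<Longrightarrow> \<bar>w \<bullet> h\<bar> \<le> L"
  shows "\<bar>F (y + t *\<^sub>R h) - F y\<bar> \<le> 2 * L * t"
proof -
  have one_sided: "\<exists>d>0. \<forall>\<alpha>. 0 < \<alpha> \<and> \<alpha> < d \<longrightarrow>
      \<bar>F (y + s *\<^sub>R h + \<alpha> *\<^sub>R (c *\<^sub>R h)) - F (y + s *\<^sub>R h)\<bar> \<le> (2 * L + e) * \<alpha>"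
    if s: "0 \<le> s" "s \<le> t" and e: "0 < e" and c: "\<bar>c\<bar> = 1" for s e c
  proof -
    let ?z = "y + s *\<^sub>R h" and ?h = "c *\<^sub>R h"
    note C = cod[OF s, unfolded has_codifferential_def]
    have "((\<lambda>\<alpha>. (1 / \<alpha>) * \<bar>F (?z + \<alpha> *\<^sub>R ?h) - F ?z
        - codiff_Phi (A s) (\<alpha> *\<^sub>R ?h) - codiff_Psi (B s) (\<alpha> *\<^sub>R ?h)\<bar>) \<longlongrightarrow> 0) (at_right 0)"
      using C by blast
    then have "\<forall>\<^sub>F \<alpha> in at_right 0. (1 / \<alpha>) * \<bar>F (?z + \<alpha> *\<^sub>R ?h) - F ?z
        - codiff_Phi (A s) (\<alpha> *\<^sub>R ?h) - codiff_Psi (B s) (\<alpha> *\<^sub>R ?h)\<bar> < e"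
      using e by (rule order_tendstoD)
    then obtain d where d: "0 < d" "\<And>\<alpha>. 0 < \<alpha> \<Longrightarrow> \<alpha> < d \<Longrightarrow> (1 / \<alpha>) * \<bar>F (?z + \<alpha> *\<^sub>R ?h) - F ?z
        - codiff_Phi (A s) (\<alpha> *\<^sub>R ?h) - codiff_Psi (B s) (\<alpha> *\<^sub>R ?h)\<bar> < e"
      unfolding eventually_at_right_field by blast
    have "\<bar>F (?z + \<alpha> *\<^sub>R ?h) - F ?z\<bar> \<le> (2 * L + e) * \<alpha>" if \<alpha>: "0 < \<alpha>" "\<alpha> < d" for \<alpha>
    proof -
      have eq: "\<bar>v \<bullet> (\<alpha> *\<^sub>R ?h)\<bar> = \<alpha> * \<bar>v \<bullet> h\<bar>" for v
        using \<alpha> c by (simp add: abs_mult)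
      have "\<bar>codiff_Phi (A s) (\<alpha> *\<^sub>R ?h)\<bar> \<le> \<alpha> * L"
        using C LA[OF s] \<alpha> by (intro codiff_Phi_abs_le) (auto simp only: eq intro!: mult_left_mono)
      moreover have "\<bar>codiff_Psi (B s) (\<alpha> *\<^sub>R ?h)\<bar> \<le> \<alpha> * L"
        using C LB[OF s] \<alpha> by (intro codiff_Psi_abs_le) (auto simp only: eq intro!: mult_left_mono)
      moreover have "\<bar>F (?z + \<alpha> *\<^sub>R ?h) - F ?z
        - codiff_Phi (A s) (\<alpha> *\<^sub>R ?h) - codiff_Psi (B s) (\<alpha> *\<^sub>R ?h)\<bar> < e * \<alpha>"
        using d(2)[OF \<alpha>] \<alpha>(1) by (simp add: divide_less_eq)
      ultimately have "\<bar>F (?z + \<alpha> *\<^sub>R ?h) - F ?z\<bar> \<le> \<alpha> * L + \<alpha> * L + e * \<alpha>"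
        by linarith
      then show ?thesis by (simp add: algebra_simps)
    qed
    with d(1) show ?thesis by blast
  qed
  define \<phi> where "\<phi> s = F (y + s *\<^sub>R h)" for s
  have "\<bar>\<phi> t - \<phi> 0\<bar> \<le> (2 * L + e) * (t - 0)" if e: "0 < e" for e
    using t
  proof (induction rule: Bolzano)
    case (trans a b c)
    then show ?case by (simp add: right_diff_distrib)
  next
    \<comment> \<open>The expansion in the direction \<open>h\<close> controls the right of
      \<open>x\<close>, the one in the direction \<open>- h\<close> the left.\<close>
    case (local x)
    obtain d1 where d1: "0 < d1" "\<And>\<alpha>. 0 < \<alpha> \<Longrightarrow> \<alpha> < d1 \<Longrightarrow> \<bar>\<phi> (x + \<alpha>) - \<phi> x\<bar> \<le> (2 * L + e) * \<alpha>"
      using one_sided[OF local e, of 1] by (simp add: \<phi>_def scaleR_add_left add.assoc) blast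
    obtain d2 where d2: "0 < d2" "\<And>\<alpha>. 0 < \<alpha> \<Longrightarrow> \<alpha> < d2 \<Longrightarrow> \<bar>\<phi> (x - \<alpha>) - \<phi> x\<bar> \<le> (2 * L + e) * \<alpha>"
      using one_sided[OF local e, of "-1"] by (simp add: \<phi>_def scaleR_diff_left add_diff_eq) blast
    show ?case
    proof (intro exI[of _ "min d1 d2"] conjI allI impI)
      fix a b assume ab: "a \<le> x \<and> x \<le> b \<and> b - a < min d1 d2"
      have "\<bar>\<phi> b - \<phi> x\<bar> \<le> (2 * L + e) * (b - x)"
        using d1(2)[of "b - x"] ab by (cases "b = x") auto
      moreover have "\<bar>\<phi> a - \<phi> x\<bar> \<le> (2 * L + e) * (x - a)"
        using d2(2)[of "x - a"] ab by (cases "a = x") auto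
      ultimately show "\<bar>\<phi> b - \<phi> a\<bar> \<le> (2 * L + e) * (b - a)"
        by (simp add: right_diff_distrib)
    qed (use d1 d2 in auto)
  qed
  then have "\<bar>\<phi> t - \<phi> 0\<bar> \<le> 2 * L * t + e * t" if "0 < e" for e
    using that by (simp add: distrib_right)
  then have "\<bar>\<phi> t - \<phi> 0\<bar> \<le> 2 * L * t"
  proof (cases "t = 0")
    case False
    with t have t: "0 < t" by simp
    show ?thesis
    proof (rule field_le_epsilon)
      fix e :: real assume "0 < e"
      with t show "\<bar>\<phi> t - \<phi> 0\<bar> \<le> 2 * L * t + e"
        using \<open>\<And>e. 0 < e \<Longrightarrow> \<bar>\<phi> t - \<phi> 0\<bar> \<le> 2 * L * t + e * t\<close>[of "e / t"] by simp
    qed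
  qed simp
  then show ?thesis by (simp add: \<phi>_def)
qed

section \<open>Sobolev spaces and growth conditions\<close>

lemma Lp_norm_cong_AE:
  assumes "f \<in> borel_measurable M" "g \<in> borel_measurable M" "AE x in M. f x = g x"
  shows "Lp_norm M q f = Lp_norm M q g"
proof -
  have "AE x in M. ennreal (norm (f x)) = ennreal (norm (g x))"
    using assms(3) by eventually_elim simp
  then have "esssup M (\<lambda>x. ennreal (norm (f x))) = esssup M (\<lambda>x. ennreal (norm (g x)))"
    using assms(1,2) by (intro esssup_AE_cong) auto
  moreover have "(LINT x|M. norm (f x) powr r) = (LINT x|M. norm (g x) powr r)" for r
  proof (rule integral_cong_AE)
    show "AE x in M. norm (f x) powr r = norm (g x) powr r"
      using assms(3) by eventually_elim simp
  qed (use assms(1,2) in measurable)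
  ultimately show ?thesis by (simp add: Lp_norm_def)
qed

lemma Lp_norm_nonneg: "0 \<le> Lp_norm M q f"
  by (simp add: Lp_norm_def)

lemma Lp_norm_scaleR_le:
  assumes q: "1 \<le> q" and f: "f \<in> Lp M q" and t: "0 \<le> t"
  shows "Lp_norm M q (\<lambda>x. t *\<^sub>R f x) \<le> t * Lp_norm M q f"
  using q
proof (cases rule: exponent_cases)
  case 1
  have fin: "esssup M (\<lambda>x. ennreal (norm (f x))) < top"
    using f 1 by (simp add: Lp_def)
  define E where "E = enn2real (esssup M (\<lambda>x. ennreal (norm (f x))))"
  have E: "esssup M (\<lambda>x. ennreal (norm (f x))) = ennreal E" "0 \<le> E"
    using fin by (auto simp: E_def)
  have "AE x in M. ennreal (norm (t *\<^sub>R f x)) \<le> ennreal (t * E)"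
    using esssup_AE[of "\<lambda>x. ennreal (norm (f x))" M] unfolding E(1)
    by eventually_elim (use t E(2) in \<open>auto intro!: ennreal_leI mult_left_mono\<close>)
  then have "esssup M (\<lambda>x. ennreal (norm (t *\<^sub>R f x))) \<le> ennreal (t * E)"
    using Lp_measurable[OF f] by (intro esssup_I) auto
  then have "enn2real (esssup M (\<lambda>x. ennreal (norm (t *\<^sub>R f x)))) \<le> t * E"
    using t E(2) by (intro enn2real_leI) auto
  then show ?thesis
    using 1 by (simp add: Lp_norm_def E_def)
next
  case (2 r)
  have "(LINT x|M. norm (t *\<^sub>R f x) powr r) = t powr r * (LINT x|M. norm (f x) powr r)"
    using t by (simp add: powr_mult)
  then have "(LINT x|M. norm (t *\<^sub>R f x) powr r) powr (1 / r) = t * (LINT x|M. norm (f x) powr r) powr (1 / r)"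
    using t 2 by (simp add: powr_mult powr_powr)
  then show ?thesis
    using 2 by (simp add: Lp_norm_def)
qed

section \<open>Sobolev functions and admissible perturbations\<close>

lemma W1p_D:
  assumes S: "open S" and u: "u \<in> W1p S p"
  shows "u \<in> Lp (lebesgue_on S) p" "has_weak_gradient S u (weak_gradient S u)"
    "weak_gradient S u \<in> Lp (lebesgue_on S) p"
  using u weak_gradient_AE(1)[OF S] by (auto simp: W1p_def)

lemma W1p_I:
  fixes u :: "real^'d::finite \<Rightarrow> real^'m::finite"
  assumes S: "open S" and p: "1 \<le> p" and u: "u \<in> Lp (lebesgue_on S) p"
    and G: "has_weak_gradient S u G" "G \<in> Lp (lebesgue_on S) p"
  shows "u \<in> W1p S p"
proof -
  let ?M = "lebesgue_on S"
  have "weak_gradient S u \<in> borel_measurable (?M)"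
    using weak_gradient_AE(1)[OF S G(1)] by (simp add: has_weak_gradient_def L1_loc_def)
  moreover have "AE x in ?M. norm (weak_gradient S u x) \<le> norm (G x)"
    using weak_gradient_AE(2)[OF S G(1)] by eventually_elim simp
  ultimately have "weak_gradient S u \<in> Lp (?M) p"
    by (rule Lp_bound[OF p G(2)])
  with u G(1) show ?thesis by (auto simp: W1p_def)
qed

lemma W1p_add_scaled:
  fixes u v :: "real^'d::finite \<Rightarrow> real^'m::finite"
  assumes S: "open S" and p: "1 \<le> p" and u: "u \<in> W1p S p" and v: "v \<in> W1p S p"
  shows "(\<lambda>x. u x + c *\<^sub>R v x) \<in> W1p S p"
    and "AE x in lebesgue_on S. weak_gradient S (\<lambda>x. u x + c *\<^sub>R v x) x
           = weak_gradient S u x + c *\<^sub>R weak_gradient S v x"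
proof -
  note G = has_weak_gradient_add_scaled[OF S W1p_D(2)[OF S u] W1p_D(2)[OF S v], of c]
  show "(\<lambda>x. u x + c *\<^sub>R v x) \<in> W1p S p"
    by (rule W1p_I[OF S p _ G])
      (intro Lp_add[OF p] Lp_scaleR[OF p] W1p_D[OF S u] W1p_D[OF S v])+
  show "AE x in lebesgue_on S. weak_gradient S (\<lambda>x. u x + c *\<^sub>R v x) x
           = weak_gradient S u x + c *\<^sub>R weak_gradient S v x"
    by (rule weak_gradient_AE(2)[OF S G])
qed

lemma test_function_W1p:
  fixes h :: "real^'d::finite \<Rightarrow> real^'m::finite"
  assumes S: "open S" and p: "1 \<le> p" and h: "h \<in> test_functions S"
  shows "h \<in> W1p S p" "h \<in> Lp (lebesgue_on S) p" "test_gradient h \<in> Lp (lebesgue_on S) p"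
    and "AE x in lebesgue_on S. weak_gradient S h x = test_gradient h x"
proof -
  let ?M = "lebesgue_on S"
  obtain K where K: "compact K" "K \<subseteq> S" "\<And>x. x \<notin> K \<Longrightarrow> h x = 0"
    by (rule test_functionsE[OF h]) blast
  have C: "C_k (Suc 0) h" by (rule test_functions_C_k[OF h])
  have S': "S \<in> sets lebesgue" using S by simp
  show 1: "h \<in> Lp (?M) p"
    by (rule continuous_compact_support_Lp[OF p C_k_continuous[OF C] K(1,3) S'])
  show 2: "test_gradient h \<in> Lp (?M) p"
    using test_gradient_outside[of K h] K
    by (intro continuous_compact_support_Lp[OF p continuous_test_gradient[OF C] K(1) _ S']) auto
  note G = has_weak_gradient_test_function[OF S h]
  show "h \<in> W1p S p" by (rule W1p_I[OF S p 1 G 2])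
  show "AE x in ?M. weak_gradient S h x = test_gradient h x"
    by (rule weak_gradient_AE(2)[OF S G])
qed

lemma W1p_norm_scaleR_le:
  fixes h :: "real^'d::finite \<Rightarrow> real^'m::finite"
  assumes S: "open S" and p: "1 \<le> p" and h: "h \<in> W1p S p" and t: "0 \<le> t"
  shows "W1p_norm S p (\<lambda>x. t *\<^sub>R h x) \<le> t * W1p_norm S p h"
proof -
  let ?M = "lebesgue_on S"
  \<comment> \<open>Homogeneity of the chosen weak gradient is obtained from
    \<open>W1p_add_scaled\<close> with the zero function as first summand, whose own chosen weak
    gradient must first be identified.\<close>
  have zero: "(\<lambda>x. 0 :: real^'m) \<in> W1p S p" "AE x in ?M. weak_gradient S (\<lambda>x. 0 :: real^'m) x = 0"
  proof -
    have "test_gradient (\<lambda>x. 0 :: real^'m) = (\<lambda>x :: real^'d. 0)"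
      by (rule ext) (simp add: test_gradient_def vec_eq_iff)
    then show "(\<lambda>x. 0 :: real^'m) \<in> W1p S p" "AE x in ?M. weak_gradient S (\<lambda>x. 0 :: real^'m) x = 0"
      using test_function_W1p(1,4)[OF S p, of "\<lambda>x. 0 :: real^'m"] test_functions_zero by auto
  qed
  have th: "(\<lambda>x. t *\<^sub>R h x) \<in> W1p S p"
    using W1p_add_scaled(1)[OF S p zero(1) h, of t] by simp
  have "AE x in ?M. weak_gradient S (\<lambda>x. t *\<^sub>R h x) x = t *\<^sub>R weak_gradient S h x"
    using W1p_add_scaled(2)[OF S p zero(1) h, of t] zero(2) by eventually_elim simp
  then have "Lp_norm ?M p (weak_gradient S (\<lambda>x. t *\<^sub>R h x)) = Lp_norm ?M p (\<lambda>x. t *\<^sub>R weak_gradient S h x)"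
    using Lp_measurable[OF W1p_D(3)[OF S th]] Lp_measurable[OF W1p_D(3)[OF S h]]
    by (intro Lp_norm_cong_AE) auto
  also have "\<dots> \<le> t * Lp_norm ?M p (weak_gradient S h)"
    by (rule Lp_norm_scaleR_le[OF p W1p_D(3)[OF S h] t])
  finally have b: "Lp_norm ?M p (weak_gradient S (\<lambda>x. t *\<^sub>R h x)) \<le> t * Lp_norm ?M p (weak_gradient S h)" .
  have a: "Lp_norm ?M p (\<lambda>x. t *\<^sub>R h x) \<le> t * Lp_norm ?M p h"
    by (rule Lp_norm_scaleR_le[OF p W1p_D(1)[OF S h] t])
  show ?thesis
    using p
  proof (cases rule: exponent_cases)
    case 1
    have "t * Lp_norm ?M p h \<le> t * max (Lp_norm ?M p h) (Lp_norm ?M p (weak_gradient S h))"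
      "t * Lp_norm ?M p (weak_gradient S h) \<le> t * max (Lp_norm ?M p h) (Lp_norm ?M p (weak_gradient S h))"
      using t by (auto intro: mult_left_mono)
    with a b 1 show ?thesis
      by (simp add: W1p_norm_def Let_def)
  next
    case (2 r)
    let ?a = "Lp_norm ?M p h" and ?b = "Lp_norm ?M p (weak_gradient S h)"
    have "W1p_norm S p (\<lambda>x. t *\<^sub>R h x) \<le> ((t * ?a) powr r + (t * ?b) powr r) powr (1 / r)"
      using 2 a b unfolding W1p_norm_def Let_def
      by (auto intro!: powr_mono2 add_mono Lp_norm_nonneg)
    also have "\<dots> = (t powr r * (?a powr r + ?b powr r)) powr (1 / r)"
      using t by (simp add: powr_mult Lp_norm_nonneg distrib_left)
    also have "\<dots> = t * (?a powr r + ?b powr r) powr (1 / r)"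
      using t 2 by (simp add: powr_mult powr_powr)
    also have "\<dots> = t * W1p_norm S p h"
      using 2 by (simp add: W1p_norm_def Let_def)
    finally show ?thesis .
  qed
qed

lemma admissible_W1p:
  assumes "open S" "1 \<le> p" "u0 \<in> W1p S p" "u \<in> admissible S p u0"
  shows "u \<in> W1p S p"
  using assms W1p_add_scaled(1)[of S p u0 _ 1] by (auto simp: admissible_def W1p_0_def)

text \<open>An approximant of \<open>k\<close> is shifted by the same test function, which leaves
  the difference unchanged.\<close>

lemma admissible_perturbation:
  fixes h :: "real^'d::finite \<Rightarrow> real^'m::finite"
  assumes S: "open S" and p: "1 \<le> p" and u: "u \<in> admissible S p u0" and h: "h \<in> test_functions S"
  shows "(\<lambda>x. u x + t *\<^sub>R h x) \<in> admissible S p u0"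
proof -
  obtain k where k: "k \<in> W1p_0 S p" "u = (\<lambda>x. u0 x + k x)"
    using u by (auto simp: admissible_def)
  have th: "(\<lambda>x. t *\<^sub>R h x) \<in> test_functions S"
    by (rule test_functions_bounded_linear[OF h bounded_linear_scaleR_right])
  have "(\<lambda>x. k x + t *\<^sub>R h x) \<in> W1p_0 S p"
    unfolding W1p_0_def
  proof (intro CollectI conjI allI impI)
    show "(\<lambda>x. k x + t *\<^sub>R h x) \<in> W1p S p"
      using k(1) by (intro W1p_add_scaled(1)[OF S p] test_function_W1p(1)[OF S p h]) (simp add: W1p_0_def)
    fix \<epsilon> :: real assume "0 < \<epsilon>"
    then obtain \<phi> where \<phi>: "\<phi> \<in> test_functions S" "W1p_norm S p (\<lambda>x. k x - \<phi> x) < \<epsilon>"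
      using k(1) by (auto simp: W1p_0_def)
    then show "\<exists>\<phi>\<in>test_functions S. W1p_norm S p (\<lambda>x. k x + t *\<^sub>R h x - \<phi> x) < \<epsilon>"
      using test_functions_add[OF \<phi>(1) th] by (intro bexI[of _ "\<lambda>x. \<phi> x + t *\<^sub>R h x"]) auto
  qed
  then show ?thesis
    unfolding admissible_def k(2) by (force simp: add.assoc)
qed

text \<open>\<open>U\<close> and \<open>\<Xi>\<close> majorize the functions along which the integrand and its codifferentials are evaluated.\<close>

lemma integrand_growth:
  fixes U \<Xi> :: "real^'d::finite \<Rightarrow> real"
    and f :: "real^'d \<Rightarrow> real^'m::finite \<Rightarrow> real^'d^'m \<Rightarrow> real"
  assumes cc: "codifferentiability_conditions S p f ld ud" and p: "1 \<le> p"
    and U: "U \<in> Lp (lebesgue_on S) p" "\<And>x. 0 \<le> U x" and \<Xi>: "\<Xi> \<in> Lp (lebesgue_on S) p" "\<And>x. 0 \<le> \<Xi> x"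
  shows "\<exists>\<beta>. integrable (lebesgue_on S) \<beta> \<and>
    (AE x in lebesgue_on S. \<forall>u \<xi>. norm u \<le> U x \<and> norm \<xi> \<le> \<Xi> x \<longrightarrow> \<bar>f x u \<xi>\<bar> \<le> \<beta> x)"
  using p
proof (cases rule: exponent_cases)
  case 1
  obtain A B where A: "0 \<le> A" "AE x in lebesgue_on S. U x \<le> A" and B: "0 \<le> B" "AE x in lebesgue_on S. \<Xi> x \<le> B"
    using U \<Xi> 1 by (auto simp: Lp_top_iff)
  \<comment> \<open>The conditions provide a bound for every strictly positive radius; the summand 1
    covers the case \<open>A = B = 0\<close>.\<close>
  define N where "N = A + B + 1"
  have "0 < N" using A B by (simp add: N_def)
  then obtain \<beta> where \<beta>: "integrable (lebesgue_on S) \<beta>"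
    "AE x in lebesgue_on S. \<forall>u \<xi>. max (norm u) (norm \<xi>) \<le> N \<longrightarrow> \<bar>f x u \<xi>\<bar> \<le> \<beta> x"
    using cc 1 by (auto simp: codifferentiability_conditions_def Let_def)
  have "AE x in lebesgue_on S. \<forall>u \<xi>. norm u \<le> U x \<and> norm \<xi> \<le> \<Xi> x \<longrightarrow> \<bar>f x u \<xi>\<bar> \<le> \<beta> x"
    using \<beta>(2) A(2) B(2)
  proof eventually_elim
    case (elim x)
    have "norm u \<le> N" "norm \<xi> \<le> N" if "norm u \<le> U x \<and> norm \<xi> \<le> \<Xi> x" for u :: "real^'m" and \<xi> :: "real^'d^'m"
      using that elim(2,3) A(1) B(1) by (auto simp: N_def)
    with elim(1) show ?case by auto
  qed
  with \<beta>(1) show ?thesis by blast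
next
  case (2 r)
  obtain \<beta> C where \<beta>: "integrable (lebesgue_on S) \<beta>" and C: "0 < C"
    and le: "AE x in lebesgue_on S. \<forall>u \<xi>. \<bar>f x u \<xi>\<bar> \<le> \<beta> x + C * (norm u powr r + norm \<xi> powr r)"
    using cc 2 by (auto simp: codifferentiability_conditions_def Let_def less_top)
  have "integrable (lebesgue_on S) (\<lambda>x. \<beta> x + C * (U x powr r + \<Xi> x powr r))"
    using \<beta> U \<Xi> 2 by (auto simp: Lp_finite_iff)
  moreover have "AE x in lebesgue_on S. \<forall>u \<xi>. norm u \<le> U x \<and> norm \<xi> \<le> \<Xi> x \<longrightarrow>
      \<bar>f x u \<xi>\<bar> \<le> \<beta> x + C * (U x powr r + \<Xi> x powr r)"
    using le
  proof eventually_elim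
    case (elim x)
    show ?case
    proof (intro allI impI)
      fix u :: "real^'m" and \<xi> :: "real^'d^'m" assume *: "norm u \<le> U x \<and> norm \<xi> \<le> \<Xi> x"
      have "C * (norm u powr r + norm \<xi> powr r) \<le> C * (U x powr r + \<Xi> x powr r)"
        using * C 2 by (intro mult_left_mono add_mono powr_mono2) auto
      with elim[rule_format, of u \<xi>] show "\<bar>f x u \<xi>\<bar> \<le> \<beta> x + C * (U x powr r + \<Xi> x powr r)"
        by linarith
    qed
  qed
  ultimately show ?thesis by blast
qed

text \<open>The growth condition quantifies jointly over both sets, so a bound for an element of one
  requires an element of the other. The factor 2 comes from the norm of a pair, and the absolute
  value makes the later majorant nonnegative also where the condition fails.\<close>

lemma norm_snd_le_components:
  fixes L R :: "(real \<times> 'a::real_normed_vector \<times> 'b::real_normed_vector) set"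
  assumes ne: "L \<noteq> {}" "R \<noteq> {}"
    and le: "\<forall>(a, v1, v2)\<in>L. \<forall>(b, w1, w2)\<in>R. Max {norm v1, norm v2, norm w1, norm w2} \<le> c"
    and z: "z \<in> L \<union> R"
  shows "norm (snd z) \<le> 2 * \<bar>c\<bar>"
proof -
  have *: "norm v1 \<le> c \<and> norm v2 \<le> c \<and> norm w1 \<le> c \<and> norm w2 \<le> c"
    if "(a, v1, v2) \<in> L" "(b, w1, w2) \<in> R" for a b v1 v2 w1 w2
    using le that by fastforce
  obtain z1 z2 where "z1 \<in> L" "z2 \<in> R" "z = z1 \<or> z = z2"
    using z ne by blast
  then have "norm (fst (snd z)) \<le> c \<and> norm (snd (snd z)) \<le> c"
    using *[of "fst z1" "fst (snd z1)" "snd (snd z1)" "fst z2" "fst (snd z2)" "snd (snd z2)"] by auto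
  then show ?thesis
    using norm_Pair_le[of "fst (snd z)" "snd (snd z)"] unfolding prod.collapse by linarith
qed

text \<open>All second components are controlled by one function in the conjugate space: for
  \<open>p = \<infinity>\<close> the integrable bound on a ball of arguments, otherwise \<gamma>
  plus the powers \<open>r - 1\<close> of the majorants.\<close>

lemma codifferential_growth:
  fixes U \<Xi> :: "real^'d::finite \<Rightarrow> real"
    and f :: "real^'d \<Rightarrow> real^'m::finite \<Rightarrow> real^'d^'m \<Rightarrow> real"
  assumes cc: "codifferentiability_conditions S p f ld ud" and p: "1 \<le> p"
    and U: "U \<in> Lp (lebesgue_on S) p" "\<And>x. 0 \<le> U x" and \<Xi>: "\<Xi> \<in> Lp (lebesgue_on S) p" "\<And>x. 0 \<le> \<Xi> x"
  shows "\<exists>\<sigma>\<in>Lp (lebesgue_on S) (conj_exponent p). (\<forall>x. 0 \<le> \<sigma> x) \<and>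
    (AE x in lebesgue_on S. \<forall>u \<xi>. norm u \<le> U x \<and> norm \<xi> \<le> \<Xi> x \<longrightarrow>
       (\<forall>z\<in>ld x u \<xi> \<union> ud x u \<xi>. norm (snd z) \<le> \<sigma> x))"
proof -
  let ?M = "lebesgue_on S"
  define B where "B x u \<xi> c \<longleftrightarrow> (\<forall>(a, v1, v2)\<in>ld x u \<xi>. \<forall>(b, w1, w2)\<in>ud x u \<xi>.
      Max {norm v1, norm v2, norm w1, norm w2} \<le> c)" for x u \<xi> c
  have ne: "AE x in ?M. \<forall>u \<xi>. ld x u \<xi> \<noteq> {} \<and> ud x u \<xi> \<noteq> {}"
    using cc by (auto simp: codifferentiability_conditions_def Let_def has_codifferential_def elim: eventually_mono)
  have p': "1 \<le> conj_exponent p" by (rule conj_exponent_ge_1[OF p])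
  have "\<exists>\<sigma>\<in>Lp ?M (conj_exponent p). AE x in ?M. \<forall>u \<xi>. norm u \<le> U x \<and> norm \<xi> \<le> \<Xi> x \<longrightarrow> B x u \<xi> (\<sigma> x)"
    using p
  proof (cases rule: exponent_cases)
    case 1
    obtain N1 N2 where N: "0 \<le> N1" "AE x in ?M. U x \<le> N1" "0 \<le> N2" "AE x in ?M. \<Xi> x \<le> N2"
      using U \<Xi> 1 by (auto simp: Lp_top_iff)
    have "\<forall>N>0. \<exists>\<beta>. integrable ?M \<beta> \<and> (AE x in ?M. 0 \<le> \<beta> x) \<and>
        (AE x in ?M. \<forall>u \<xi>. max (norm u) (norm \<xi>) \<le> N \<longrightarrow>
              (\<forall>(a, v1, v2)\<in>ld x u \<xi>. \<forall>(b, w1, w2)\<in>ud x u \<xi>.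
                 Max {\<bar>a\<bar>, norm v1, norm v2, \<bar>b\<bar>, norm w1, norm w2} \<le> \<beta> x))"
      using cc 1 unfolding codifferentiability_conditions_def Let_def by simp
    moreover have "0 < N1 + N2 + 1" using N by simp
    ultimately obtain \<beta> where \<beta>: "integrable ?M \<beta>"
      "AE x in ?M. \<forall>u \<xi>. max (norm u) (norm \<xi>) \<le> N1 + N2 + 1 \<longrightarrow>
              (\<forall>(a, v1, v2)\<in>ld x u \<xi>. \<forall>(b, w1, w2)\<in>ud x u \<xi>.
                 Max {\<bar>a\<bar>, norm v1, norm v2, \<bar>b\<bar>, norm w1, norm w2} \<le> \<beta> x)"
      by blast
    have "AE x in ?M. \<forall>u \<xi>. norm u \<le> U x \<and> norm \<xi> \<le> \<Xi> x \<longrightarrow> B x u \<xi> (\<beta> x)"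
      using \<beta>(2) N(2,4)
    proof eventually_elim
      case (elim x)
      show ?case
      proof (intro allI impI)
        fix u :: "real^'m" and \<xi> :: "real^'d^'m" assume "norm u \<le> U x \<and> norm \<xi> \<le> \<Xi> x"
        then have "max (norm u) (norm \<xi>) \<le> N1 + N2 + 1"
          using elim(2,3) N(1,3) by auto
        then have H: "\<forall>(a, v1, v2)\<in>ld x u \<xi>. \<forall>(b, w1, w2)\<in>ud x u \<xi>.
                 Max {\<bar>a\<bar>, norm v1, norm v2, \<bar>b\<bar>, norm w1, norm w2} \<le> \<beta> x"
          using elim(1) by blast
        show "B x u \<xi> (\<beta> x)"
          unfolding B_def
        proof clarify
          fix a v1 v2 b w1 w2 assume "(a, v1, v2) \<in> ld x u \<xi>" "(b, w1, w2) \<in> ud x u \<xi>"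
          with H have "Max {\<bar>a\<bar>, norm v1, norm v2, \<bar>b\<bar>, norm w1, norm w2} \<le> \<beta> x"
            by fastforce
          then show "Max {norm v1, norm v2, norm w1, norm w2} \<le> \<beta> x" by simp
        qed
      qed
    qed
    moreover have "\<beta> \<in> Lp ?M (conj_exponent p)"
      using integrable_imp_Lp_1[OF \<beta>(1)] conj_exponent_top 1 by simp
    ultimately show ?thesis by blast
  next
    case (2 r)
    obtain C \<beta> \<gamma> where C: "0 < C" and \<gamma>: "\<gamma> \<in> Lp ?M (conj_exponent p)"
      and le: "AE x in ?M. \<forall>u \<xi>. \<forall>(a, v1, v2)\<in>ld x u \<xi>. \<forall>(b, w1, w2)\<in>ud x u \<xi>.
              Max {\<bar>a\<bar>, \<bar>b\<bar>} \<le> \<beta> x + C * (norm u powr r + norm \<xi> powr r) \<and>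
              Max {norm v1, norm v2, norm w1, norm w2}
                \<le> \<gamma> x + C * (norm u powr (r - 1) + norm \<xi> powr (r - 1))"
      using cc 2 unfolding codifferentiability_conditions_def Let_def by (auto simp: less_top)
    define s where "s x = \<gamma> x + C *\<^sub>R (U x powr (r - 1) + \<Xi> x powr (r - 1))" for x
    have "(\<lambda>x. U x powr (r - 1)) \<in> Lp ?M (conj_exponent p)" "(\<lambda>x. \<Xi> x powr (r - 1)) \<in> Lp ?M (conj_exponent p)"
      using Lp_powr_conj[of r U ?M] Lp_powr_conj[of r \<Xi> ?M] U \<Xi> 2 by auto
    then have "s \<in> Lp ?M (conj_exponent p)"
      unfolding s_def[abs_def] by (intro Lp_add[OF p'] Lp_scaleR[OF p'] \<gamma>)
    moreover have "AE x in ?M. \<forall>u \<xi>. norm u \<le> U x \<and> norm \<xi> \<le> \<Xi> x \<longrightarrow> B x u \<xi> (s x)"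
      using le
    proof eventually_elim
      case (elim x)
      show ?case
      proof (intro allI impI)
        fix u :: "real^'m" and \<xi> :: "real^'d^'m" assume *: "norm u \<le> U x \<and> norm \<xi> \<le> \<Xi> x"
        have mono: "C * (norm u powr (r - 1) + norm \<xi> powr (r - 1)) \<le> C *\<^sub>R (U x powr (r - 1) + \<Xi> x powr (r - 1))"
          using * C 2 unfolding real_scaleR_def by (intro mult_left_mono add_mono powr_mono2) auto
        show "B x u \<xi> (s x)"
          unfolding B_def
        proof clarify
          fix a v1 v2 b w1 w2 assume "(a, v1, v2) \<in> ld x u \<xi>" "(b, w1, w2) \<in> ud x u \<xi>"
          then have "Max {\<bar>a\<bar>, \<bar>b\<bar>} \<le> \<beta> x + C * (norm u powr r + norm \<xi> powr r) \<and>
              Max {norm v1, norm v2, norm w1, norm w2} \<le> \<gamma> x + C * (norm u powr (r - 1) + norm \<xi> powr (r - 1))"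
            using elim[THEN spec, THEN spec, of u \<xi>] by blast
          with mono show "Max {norm v1, norm v2, norm w1, norm w2} \<le> s x"
            unfolding s_def by linarith
        qed
      qed
    qed
    ultimately show ?thesis by blast
  qed
  then obtain \<sigma> where \<sigma>: "\<sigma> \<in> Lp ?M (conj_exponent p)"
    and le: "AE x in ?M. \<forall>u \<xi>. norm u \<le> U x \<and> norm \<xi> \<le> \<Xi> x \<longrightarrow> B x u \<xi> (\<sigma> x)"
    by blast
  have "(\<lambda>x. 2 * \<bar>\<sigma> x\<bar>) \<in> Lp ?M (conj_exponent p)"
    using Lp_scaleR[OF p' Lp_norm_real[OF \<sigma>], of 2] by simp
  moreover have "AE x in ?M. \<forall>u \<xi>. norm u \<le> U x \<and> norm \<xi> \<le> \<Xi> x \<longrightarrow>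
       (\<forall>z\<in>ld x u \<xi> \<union> ud x u \<xi>. norm (snd z) \<le> 2 * \<bar>\<sigma> x\<bar>)"
    using le ne
  proof eventually_elim
    case (elim x)
    show ?case
    proof (intro allI impI ballI)
      fix u :: "real^'m" and \<xi> :: "real^'d^'m" and z
      assume "norm u \<le> U x \<and> norm \<xi> \<le> \<Xi> x" and z: "z \<in> ld x u \<xi> \<union> ud x u \<xi>"
      then have "B x u \<xi> (\<sigma> x)" using elim(1) by blast
      from norm_snd_le_components[OF _ _ this[unfolded B_def] z] show "norm (snd z) \<le> 2 * \<bar>\<sigma> x\<bar>"
        using elim(2) by blast
    qed
  qed
  ultimately show ?thesis by (intro bexI[of _ "\<lambda>x. 2 * \<bar>\<sigma> x\<bar>"]) auto
qed

section \<open>The Euler-Lagrange inclusion\<close>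

lemma borel_measurable_vec_lambda:
  fixes f :: "'x \<Rightarrow> 'i::finite \<Rightarrow> real"
  assumes "\<And>i. (\<lambda>x. f x i) \<in> borel_measurable M"
  shows "(\<lambda>x. \<chi> i. f x i) \<in> borel_measurable M"
proof (rule borel_measurable_euclidean_space[THEN iffD2], intro ballI)
  fix b :: "real^'i" assume "b \<in> Basis"
  then obtain i where "b = axis i 1" by (auto simp: Basis_vec_def)
  then show "(\<lambda>x. (\<chi> i. f x i) \<bullet> b) \<in> borel_measurable M"
    using assms by (simp add: inner_axis)
qed

lemma abs_inner_le:
  fixes v \<xi> :: "'e::real_inner"
  assumes "norm v \<le> s"
  shows "\<bar>v \<bullet> \<xi>\<bar> \<le> s * norm \<xi>"
  using Cauchy_Schwarz_ineq2[of v \<xi>] mult_right_mono[OF assms norm_ge_zero[of \<xi>]] by linarith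

lemma test_gradient_axis:
  assumes "C_k (Suc 0) \<phi>"
  shows "test_gradient (\<lambda>x. \<phi> x *\<^sub>R axis i 1) x = axis i (grad \<phi> x)"
proof -
  have "((\<lambda>x. \<phi> x *\<^sub>R axis i (1::real)) has_derivative (\<lambda>v. frechet_derivative \<phi> (at x) v *\<^sub>R axis i 1)) (at x)"
    by (rule has_derivative_scaleR_left[OF C_k_has_derivative[OF assms]])
  from frechet_derivative_at[OF this, symmetric] show ?thesis
    by (auto simp: test_gradient_def vec_eq_iff axis_def grad_def)
qed

lemma test_pair_integrable:
  fixes h :: "real^'d::finite \<Rightarrow> real^'m::finite" and \<kappa> :: "real^'d \<Rightarrow> real"
  assumes \<Omega>: "\<Omega> \<in> sets lebesgue" and h: "h \<in> test_functions \<Omega>" and \<kappa>: "\<kappa> \<in> L1_loc \<Omega>"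
  shows "(\<lambda>x. (h x, test_gradient h x)) \<in> borel_measurable (lebesgue_on \<Omega>)"
    and "integrable (lebesgue_on \<Omega>) (\<lambda>x. \<kappa> x * norm (h x, test_gradient h x))"
proof -
  obtain K where K: "compact K" "K \<subseteq> \<Omega>" "\<And>x. x \<notin> K \<Longrightarrow> h x = 0"
    by (rule test_functionsE[OF h]) blast
  have C: "C_k (Suc 0) h" by (rule test_functions_C_k[OF h])
  have cont: "continuous_on UNIV (\<lambda>x. (h x, test_gradient h x))"
    by (intro continuous_on_Pair C_k_continuous[OF C] continuous_test_gradient[OF C])
  then show "(\<lambda>x. (h x, test_gradient h x)) \<in> borel_measurable (lebesgue_on \<Omega>)"
    by (rule continuous_measurable_lebesgue_on)
  show "integrable (lebesgue_on \<Omega>) (\<lambda>x. \<kappa> x * norm (h x, test_gradient h x))"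
    using K(3) test_gradient_outside[of K h, OF K(1,3)]
    by (intro L1_loc_integrable_mult[OF \<Omega> \<kappa> K(1,2)] continuous_on_norm cont) (auto simp: zero_prod_def)
qed

lemma measurable_selection_components:
  fixes w1 :: "'x \<Rightarrow> 'a::euclidean_space" and w2 :: "'x \<Rightarrow> 'b::euclidean_space"
  assumes "measurable_selection M G (\<lambda>x. (0 :: real, w1 x, w2 x))"
  shows "(\<lambda>x. (w1 x, w2 x)) \<in> borel_measurable M"
proof -
  have "(\<lambda>x. snd (0 :: real, w1 x, w2 x)) \<in> borel_measurable M"
    using assms unfolding measurable_selection_def
    by (intro borel_measurable_continuous_on[of snd]) (auto intro: continuous_on_snd continuous_on_id)
  then show ?thesis by simp
qed

lemma hypodifferential_measurable:
  assumes \<Omega>: "\<Omega> \<in> sets lebesgue" and cc: "codifferentiability_conditions \<Omega> p f ld ud"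
    and u: "u \<in> borel_measurable (lebesgue_on \<Omega>)" and g: "g \<in> borel_measurable (lebesgue_on \<Omega>)"
    and H: "H \<in> borel_measurable (lebesgue_on \<Omega>)"
  shows "(\<lambda>x. codiff_Phi (ld x (u x) (g x)) (H x)) \<in> borel_measurable (lebesgue_on \<Omega>)"
proof -
  interpret complete_measure "lebesgue_on \<Omega>" by (rule complete_measure_lebesgue_on[OF \<Omega>])
  have "(\<lambda>x. codiff_Phi ((\<lambda>(u, \<xi>). ld x u \<xi>) (u x, g x)) (H x)) \<in> borel_measurable (lebesgue_on \<Omega>)"
  proof (rule codiff_Phi_compose_measurable[OF _ _ borel_measurable_Pair[OF u g] H])
    show "caratheodory_multifun (lebesgue_on \<Omega>) (\<lambda>x (u, \<xi>). ld x u \<xi>)"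
      using cc by (simp add: codifferentiability_conditions_def Let_def)
    show "AE x in lebesgue_on \<Omega>. \<forall>y. compact ((\<lambda>(u, \<xi>). ld x u \<xi>) y) \<and> (\<lambda>(u, \<xi>). ld x u \<xi>) y \<noteq> {}"
      using cc by (auto simp: codifferentiability_conditions_def Let_def has_codifferential_def elim: eventually_mono)
  qed
  then show ?thesis by simp
qed

text \<open>One \<sigma> comes from the support function and one from the selection, whence
  \<open>2 * \<sigma> x\<close>. The first components do not enter because \<open>codiff_Phi\<close>
  vanishes at 0.\<close>

lemma linearization_bound:
  assumes cc: "codifferentiability_conditions \<Omega> p f ld ud"
    and le: "AE x in lebesgue_on \<Omega>. \<forall>u \<xi>. norm u \<le> U x \<and> norm \<xi> \<le> V x \<longrightarrow>
      (\<forall>z\<in>ld x u \<xi> \<union> ud x u \<xi>. norm (snd z) \<le> \<sigma> x)"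
    and ug: "\<And>x. norm (u x) \<le> U x" "\<And>x. norm (g x) \<le> V x"
    and W: "AE x in lebesgue_on \<Omega>. (0, W x) \<in> ud x (u x) (g x)"
  shows "AE x in lebesgue_on \<Omega>. (\<forall>z\<in>ld x (u x) (g x). norm (snd z) \<le> \<sigma> x) \<and> norm (W x) \<le> \<sigma> x \<and>
    (\<forall>\<xi>. \<bar>codiff_Phi (ld x (u x) (g x)) \<xi> + W x \<bullet> \<xi>\<bar> \<le> 2 * \<sigma> x * norm \<xi>)"
proof -
  have "AE x in lebesgue_on \<Omega>. \<forall>u \<xi>. has_codifferential (\<lambda>(u, \<xi>). f x u \<xi>) (ld x u \<xi>) (ud x u \<xi>) (u, \<xi>)"
    using cc by (simp add: codifferentiability_conditions_def Let_def)
  with le W show ?thesis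
  proof eventually_elim
    case (elim x)
    let ?A = "ld x (u x) (g x)"
    have A: "compact ?A" "?A \<noteq> {}" "codiff_Phi ?A 0 = 0"
      using elim(3) by (auto simp: has_codifferential_def)
    have le: "\<forall>z\<in>?A \<union> ud x (u x) (g x). norm (snd z) \<le> \<sigma> x"
      using elim(1) ug by blast
    with elim(2) have "norm (snd (0 :: real, W x)) \<le> \<sigma> x" by blast
    then have W: "norm (W x) \<le> \<sigma> x" by simp
    have "\<bar>codiff_Phi ?A \<xi> + W x \<bullet> \<xi>\<bar> \<le> 2 * \<sigma> x * norm \<xi>" for \<xi>
    proof -
      have "\<bar>codiff_Phi ?A \<xi>\<bar> \<le> \<sigma> x * norm \<xi>"
        using le by (intro codiff_Phi_abs_le[OF A] abs_inner_le) force
      then show ?thesis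
        using abs_inner_le[OF W, of \<xi>] by simp
    qed
    with le W show ?case by blast
  qed
qed

text \<open>Minimality makes the integrals of the difference quotients \<open>q n\<close>
  nonnegative for large \<open>n\<close>. They need not converge to \<open>D\<close>, yet their
  excess over \<open>D\<close> tends to 0 in \<open>L^1\<close>, and this suffices for the
  sign.\<close>

lemma optimality_test_functions:
  fixes f :: "real^'d::finite \<Rightarrow> real^'m::finite \<Rightarrow> real^'d^'m \<Rightarrow> real"
    and w1 :: "real^'d \<Rightarrow> real^'m" and w2 :: "real^'d \<Rightarrow> real^'d^'m"
  assumes \<Omega>: "open \<Omega>" and p: "1 \<le> p"
    and cc: "codifferentiability_conditions \<Omega> p f ld ud"
    and us: "us \<in> W1p \<Omega> p" and opt: "locally_optimal \<Omega> p f u0 us"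
    and sel: "measurable_selection (lebesgue_on \<Omega>)
           (\<lambda>x. ud x (us x) (weak_gradient \<Omega> us x)) (\<lambda>x. (0, w1 x, w2 x))"
    and h: "h \<in> test_functions \<Omega>"
  shows "0 \<le> (LINT x|lebesgue_on \<Omega>. codiff_Phi (ld x (us x) (weak_gradient \<Omega> us x)) (h x, test_gradient h x)
                + (w1 x, w2 x) \<bullet> (h x, test_gradient h x))"
proof -
  let ?M = "lebesgue_on \<Omega>"
  have \<Omega>': "\<Omega> \<in> sets lebesgue" using \<Omega> by simp
  interpret complete_measure ?M by (rule complete_measure_lebesgue_on[OF \<Omega>'])
  define g where "g = weak_gradient \<Omega> us"
  define G where "G = test_gradient h"
  define H where "H x = (h x, G x)" for x
  define y where "y x = (us x, g x)" for x
  define F where "F x = (\<lambda>(u, \<xi>). f x u \<xi>)" for x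
  define A where "A x = ld x (us x) (g x)" for x
  define W where "W x = (w1 x, w2 x)" for x
  define D where "D x = codiff_Phi (A x) (H x) + W x \<bullet> H x" for x
  have us_Lp: "us \<in> Lp ?M p" "g \<in> Lp ?M p"
    using W1p_D[OF \<Omega> us] by (auto simp: g_def)
  have h_W: "h \<in> W1p \<Omega> p" and h_Lp: "h \<in> Lp ?M p" "G \<in> Lp ?M p"
    and h_wg: "AE x in ?M. weak_gradient \<Omega> h x = G x"
    using test_function_W1p[OF \<Omega> p h] by (auto simp: G_def)
  have meas [measurable]: "us \<in> borel_measurable ?M" "g \<in> borel_measurable ?M"
    "h \<in> borel_measurable ?M" "G \<in> borel_measurable ?M"
    using us_Lp h_Lp by (auto intro: Lp_measurable)
  have H_meas [measurable]: "H \<in> borel_measurable ?M"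
    unfolding H_def[abs_def] by (intro borel_measurable_Pair meas)
  have W_meas [measurable]: "W \<in> borel_measurable ?M"
    unfolding W_def[abs_def] by (rule measurable_selection_components[OF sel])
  \<comment> \<open>These majorants dominate \<open>us + s h\<close> and its gradient for all
    \<open>s\<close> between 0 and 1, so a single \<beta> and a single \<sigma> serve the whole
    segment.\<close>
  define U where "U x = norm (us x) + norm (h x)" for x
  define \<Xi> where "\<Xi> x = norm (g x) + norm (G x)" for x
  have U: "U \<in> Lp ?M p" "\<And>x. 0 \<le> U x" and \<Xi>: "\<Xi> \<in> Lp ?M p" "\<And>x. 0 \<le> \<Xi> x"
    unfolding U_def[abs_def] \<Xi>_def[abs_def]
    by (auto intro!: Lp_add[OF p] Lp_norm_real us_Lp h_Lp)
  obtain \<beta> where \<beta>: "integrable ?M \<beta>"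
    "AE x in ?M. \<forall>u \<xi>. norm u \<le> U x \<and> norm \<xi> \<le> \<Xi> x \<longrightarrow> \<bar>f x u \<xi>\<bar> \<le> \<beta> x"
    using integrand_growth[OF cc p U \<Xi>] by blast
  obtain \<sigma> where \<sigma>: "\<sigma> \<in> Lp ?M (conj_exponent p)" "\<And>x. 0 \<le> \<sigma> x"
    "AE x in ?M. \<forall>u \<xi>. norm u \<le> U x \<and> norm \<xi> \<le> \<Xi> x \<longrightarrow> (\<forall>z\<in>ld x u \<xi> \<union> ud x u \<xi>. norm (snd z) \<le> \<sigma> x)"
    using codifferential_growth[OF cc p U \<Xi>] by blast
  have cod: "AE x in ?M. \<forall>u \<xi>. has_codifferential (F x) (ld x u \<xi>) (ud x u \<xi>) (u, \<xi>)"
    and car: "caratheodory_fun ?M F"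
    using cc by (auto simp: codifferentiability_conditions_def Let_def F_def[abs_def])
  have W_sel: "AE x in ?M. (0, W x) \<in> ud x (us x) (g x)"
    using sel by (simp add: measurable_selection_def W_def g_def)
  have \<sigma>H: "integrable ?M (\<lambda>x. \<sigma> x * norm (H x))"
    unfolding H_def G_def
    by (intro test_pair_integrable(2)[OF \<Omega>' h] Lp_subset_L1_loc[OF conj_exponent_ge_1[OF p] \<sigma>(1) \<Omega>'])
  have small: "norm (us x + t *\<^sub>R h x) \<le> U x" "norm (g x + t *\<^sub>R G x) \<le> \<Xi> x"
    if "0 \<le> t" "t \<le> 1" for x t
  proof -
    have "norm (t *\<^sub>R h x) \<le> norm (h x)" "norm (t *\<^sub>R G x) \<le> norm (G x)"
      using that by (auto simp: mult_left_le_one_le)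
    then show "norm (us x + t *\<^sub>R h x) \<le> U x" "norm (g x + t *\<^sub>R G x) \<le> \<Xi> x"
      unfolding U_def \<Xi>_def by (auto intro: norm_triangle_le)
  qed
  have D_le: "AE x in ?M. \<bar>D x\<bar> \<le> 2 * (\<sigma> x * norm (H x))"
  proof -
    have "norm (us x) \<le> U x" "norm (g x) \<le> \<Xi> x" for x
      using small[of 0 x] by auto
    from linearization_bound[OF cc \<sigma>(3) this W_sel] show ?thesis
    proof eventually_elim
      case (elim x)
      then have "\<bar>codiff_Phi (ld x (us x) (g x)) (H x) + W x \<bullet> H x\<bar> \<le> 2 * \<sigma> x * norm (H x)" by blast
      then show ?case by (simp add: D_def A_def mult.assoc)
    qed
  qed
  have D_meas [measurable]: "D \<in> borel_measurable ?M"
    unfolding D_def[abs_def] A_def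
    by (intro borel_measurable_add borel_measurable_inner hypodifferential_measurable[OF \<Omega>' cc]
        meas H_meas W_meas)
  have D_int: "integrable ?M D"
    using D_le by (intro Bochner_Integration.integrable_bound[OF integrable_mult_right[OF \<sigma>H, of 2] D_meas])
      (auto elim!: eventually_mono)
  define t where "t n = inverse (real (Suc n))" for n
  have t: "0 < t n" "t n \<le> 1" for n by (auto simp: t_def divide_simps)
  have F_int: "integrable ?M (\<lambda>x. F x (y x + s *\<^sub>R H x))" if s: "0 \<le> s" "s \<le> 1" for s
  proof (rule Bochner_Integration.integrable_bound[OF \<beta>(1)])
    show "(\<lambda>x. F x (y x + s *\<^sub>R H x)) \<in> borel_measurable ?M"
    proof (rule caratheodory_fun_compose[OF car])
      show "(\<lambda>x. y x + s *\<^sub>R H x) \<in> borel_measurable ?M"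
        unfolding y_def[abs_def]
        by (intro borel_measurable_add borel_measurable_scaleR borel_measurable_Pair meas H_meas borel_measurable_const)
    qed
    show "AE x in ?M. norm (F x (y x + s *\<^sub>R H x)) \<le> norm (\<beta> x)"
      using \<beta>(2)
    proof eventually_elim
      case (elim x)
      have "\<bar>f x (us x + s *\<^sub>R h x) (g x + s *\<^sub>R G x)\<bar> \<le> \<beta> x"
        using elim small[OF s, of x] by blast
      then show ?case
        by (simp add: F_def y_def H_def)
    qed
  qed
  define q where "q n x = (F x (y x + t n *\<^sub>R H x) - F x (y x)) / t n" for n x
  have q_int: "integrable ?M (q n)" for n
    unfolding q_def[abs_def] using F_int[of "t n"] F_int[of 0] t[of n] by simp
  have q_le: "AE x in ?M. \<forall>n. \<bar>q n x\<bar> \<le> 2 * (\<sigma> x * norm (H x))"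
    using cod \<sigma>(3)
  proof eventually_elim
    case (elim x)
    show ?case
    proof
      fix n
      have bnd: "\<bar>v \<bullet> H x\<bar> \<le> \<sigma> x * norm (H x)"
        if "0 \<le> s" "s \<le> t n" "(a, v) \<in> ld x (us x + s *\<^sub>R h x) (g x + s *\<^sub>R G x) \<union> ud x (us x + s *\<^sub>R h x) (g x + s *\<^sub>R G x)"
        for s a v
      proof (rule abs_inner_le)
        have "s \<le> 1" using that(2) t(2)[of n] by linarith
        then have "norm (snd (a, v)) \<le> \<sigma> x"
          using elim(2) small[OF that(1), of x] that(3) by blast
        then show "norm v \<le> \<sigma> x" by simp
      qed
      have "\<bar>F x (y x + t n *\<^sub>R H x) - F x (y x)\<bar> \<le> 2 * (\<sigma> x * norm (H x)) * t n"
      proof (rule mean_value_codifferential)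
        show "has_codifferential (F x) (ld x (us x + s *\<^sub>R h x) (g x + s *\<^sub>R G x))
            (ud x (us x + s *\<^sub>R h x) (g x + s *\<^sub>R G x)) (y x + s *\<^sub>R H x)" for s
          using elim(1) by (simp add: y_def H_def)
      qed (use t[of n] bnd in \<open>auto simp: less_imp_le\<close>)
      then show "\<bar>q n x\<bar> \<le> 2 * (\<sigma> x * norm (H x))"
        using t(1)[of n] by (simp add: q_def abs_divide divide_le_eq)
    qed
  qed
  \<comment> \<open>Only the positive part is claimed to vanish: the selected element bounds
    \<open>codiff_Psi\<close> from above and gives no lower estimate of \<open>q n\<close>.\<close>
  have lim: "AE x in ?M. (\<lambda>n. max (q n x - D x) 0) \<longlonglongrightarrow> 0"
    using cod W_sel
  proof eventually_elim
    case (elim x)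
    let ?B = "ud x (us x) (g x)"
    have hc: "has_codifferential (F x) (A x) ?B (y x)"
      using elim(1) by (simp add: A_def y_def)
    then have A: "compact (A x)" "A x \<noteq> {}" "codiff_Phi (A x) 0 = 0" and B: "compact ?B" "?B \<noteq> {}"
      by (auto simp: has_codifferential_def)
    let ?R = "\<lambda>\<alpha>. (1 / \<alpha>) * \<bar>F x (y x + \<alpha> *\<^sub>R H x) - F x (y x)
        - codiff_Phi (A x) (\<alpha> *\<^sub>R H x) - codiff_Psi ?B (\<alpha> *\<^sub>R H x)\<bar>"
    have "(?R \<longlongrightarrow> 0) (at_right 0)"
      using hc unfolding has_codifferential_def by blast
    moreover have "filterlim t (at_right 0) sequentially"
      using LIMSEQ_inverse_real_of_nat t(1) unfolding t_def
      by (intro tendsto_imp_filterlim_at_right) auto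
    ultimately have R: "(\<lambda>n. ?R (t n)) \<longlonglongrightarrow> 0"
      by (rule filterlim_compose)
    have le: "norm (max (q n x - D x) 0) \<le> ?R (t n)" for n
    proof -
      \<comment> \<open>\<open>codiff_Phi\<close> is not homogeneous, but convexity and its value 0
        at the origin give the needed half of homogeneity. For \<open>codiff_Psi\<close> the
        selection has first component 0, so its affine function is linear.\<close>
      have "codiff_Phi (A x) ((1 - t n) *\<^sub>R 0 + t n *\<^sub>R H x) \<le> (1 - t n) * codiff_Phi (A x) 0 + t n * codiff_Phi (A x) (H x)"
        using t[of n] by (intro convex_onD[OF convex_codiff_Phi[OF A(1,2)]]) auto
      then have 1: "codiff_Phi (A x) (t n *\<^sub>R H x) \<le> t n * codiff_Phi (A x) (H x)"
        using A(3) by simp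
      have 2: "codiff_Psi ?B (t n *\<^sub>R H x) \<le> t n * (W x \<bullet> H x)"
        using codiff_Psi_attained(2)[OF B elim(2), of "t n *\<^sub>R H x"] by simp
      have "F x (y x + t n *\<^sub>R H x) - F x (y x) \<le> t n * D x + \<bar>F x (y x + t n *\<^sub>R H x) - F x (y x)
        - codiff_Phi (A x) (t n *\<^sub>R H x) - codiff_Psi ?B (t n *\<^sub>R H x)\<bar>"
        using 1 2 by (simp add: D_def distrib_left)
      moreover have "(D x + ?R (t n)) * t n = t n * D x + \<bar>F x (y x + t n *\<^sub>R H x) - F x (y x)
        - codiff_Phi (A x) (t n *\<^sub>R H x) - codiff_Psi ?B (t n *\<^sub>R H x)\<bar>"
        using t(1)[of n] by (simp add: distrib_right)
      ultimately have "F x (y x + t n *\<^sub>R H x) - F x (y x) \<le> (D x + ?R (t n)) * t n"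
        by linarith
      then have "q n x \<le> D x + ?R (t n)"
        unfolding q_def pos_divide_le_eq[OF t(1)] .
      moreover have "0 \<le> ?R (t n)" using t(1)[of n] by simp
      ultimately show ?thesis by (simp add: max_def)
    qed
    show ?case
      by (rule Lim_null_comparison[OF always_eventually R]) (use le in blast)
  qed
  have "(\<lambda>n. LINT x|?M. max (q n x - D x) 0) \<longlonglongrightarrow> (LINT x|?M. 0)"
  proof (rule integral_dominated_convergence)
    \<comment> \<open>The constant 4 adds the bounds with factor 2 for \<open>q n\<close> and for
      \<open>D\<close>.\<close>
    show "integrable ?M (\<lambda>x. 4 * (\<sigma> x * norm (H x)))" using \<sigma>H by simp
    show "AE x in ?M. norm (max (q n x - D x) 0) \<le> 4 * (\<sigma> x * norm (H x))" for n
      using q_le D_le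
    proof eventually_elim
      case (elim x)
      from elim(1)[rule_format, of n] elim(2) show ?case by (auto simp: max_def)
    qed
    show "(\<lambda>x. max (q n x - D x) 0) \<in> borel_measurable ?M" for n
      using q_int[of n] by (intro borel_measurable_max borel_measurable_diff D_meas) auto
  qed (use lim in auto)
  then have lim_max: "(\<lambda>n. (LINT x|?M. D x) + (LINT x|?M. max (q n x - D x) 0)) \<longlonglongrightarrow> (LINT x|?M. D x) + 0"
    by (intro tendsto_intros) simp
  obtain \<delta> where \<delta>: "0 < \<delta>" "\<And>u. u \<in> admissible \<Omega> p u0 \<Longrightarrow> W1p_norm \<Omega> p (\<lambda>x. u x - us x) < \<delta> \<Longrightarrow>
        functional_I \<Omega> f us \<le> functional_I \<Omega> f u"
    and adm: "us \<in> admissible \<Omega> p u0"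
    using opt by (auto simp: locally_optimal_def)
  have "t \<longlonglongrightarrow> 0" unfolding t_def by (rule LIMSEQ_inverse_real_of_nat)
  then have "(\<lambda>n. t n * W1p_norm \<Omega> p h) \<longlonglongrightarrow> 0 * W1p_norm \<Omega> p h"
    by (intro tendsto_intros)
  then have "\<forall>\<^sub>F n in sequentially. t n * W1p_norm \<Omega> p h < \<delta>"
    using \<delta>(1) by (intro order_tendstoD(2)) auto
  \<comment> \<open>As soon as \<open>t n\<close> times the norm of \<open>h\<close> is below
    \<delta>, the perturbed function competes, and
    \<open>q n x \<le> D x + max (q n x - D x) 0\<close> is integrated.\<close>
  then have "\<forall>\<^sub>F n in sequentially. 0 \<le> (LINT x|?M. D x) + (LINT x|?M. max (q n x - D x) 0)"
  proof eventually_elim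
    case (elim n)
    let ?u = "\<lambda>x. us x + t n *\<^sub>R h x"
    have "W1p_norm \<Omega> p (\<lambda>x. ?u x - us x) < \<delta>"
      using W1p_norm_scaleR_le[OF \<Omega> p h_W, of "t n"] t(1)[of n] elim by simp
    then have "functional_I \<Omega> f us \<le> functional_I \<Omega> f ?u"
      by (intro \<delta>(2) admissible_perturbation[OF \<Omega> p adm h])
    also have "functional_I \<Omega> f ?u = (LINT x|?M. F x (y x + t n *\<^sub>R H x))"
      unfolding functional_I_def
    proof (rule integral_cong_AE)
      \<comment> \<open>The chosen weak gradient of the perturbed function is the expected sum only
        almost everywhere; measurability of the original integrand is then inherited from the other
        side.\<close>
      show eq: "AE x in ?M. f x (?u x) (weak_gradient \<Omega> ?u x) = F x (y x + t n *\<^sub>R H x)"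
        using W1p_add_scaled(2)[OF \<Omega> p us h_W, of "t n"] h_wg
        by eventually_elim (simp add: F_def y_def H_def g_def)
      show m: "(\<lambda>x. F x (y x + t n *\<^sub>R H x)) \<in> borel_measurable ?M"
        using F_int[of "t n"] t[of n] by auto
      show "(\<lambda>x. f x (?u x) (weak_gradient \<Omega> ?u x)) \<in> borel_measurable ?M"
        by (rule borel_measurable_AE_eq[OF m eq])
    qed
    finally have "(LINT x|?M. F x (y x)) \<le> (LINT x|?M. F x (y x + t n *\<^sub>R H x))"
      by (simp add: functional_I_def F_def y_def g_def)
    then have "0 \<le> (LINT x|?M. q n x)"
      unfolding q_def using F_int[of "t n"] F_int[of 0] t[of n] by simp
    also have "\<dots> \<le> (LINT x|?M. D x + max (q n x - D x) 0)"
      using q_int[of n] D_int by (intro integral_mono) auto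
    also have "\<dots> = (LINT x|?M. D x) + (LINT x|?M. max (q n x - D x) 0)"
      using q_int[of n] D_int by (intro Bochner_Integration.integral_add) auto
    finally show ?case .
  qed
  then have "0 \<le> (LINT x|?M. D x) + 0"
    using lim_max by (intro tendsto_lowerbound) auto
  then show ?thesis
    by (simp add: D_def A_def H_def W_def G_def g_def)
qed

lemma test_pair_subspace:
  fixes \<Omega> :: "(real^'d::finite) set"
  shows "subspace ((\<lambda>h x. (h x, test_gradient h x)) ` (test_functions \<Omega> :: (real^'d \<Rightarrow> real^'m::finite) set))"
  (is "subspace (?T ` _)")
  unfolding subspace_def
proof (intro conjI ballI allI)
  have "?T (\<lambda>x. 0) = (0 :: real^'d \<Rightarrow> (real^'m) \<times> (real^'d^'m))"
    by (rule ext) (simp add: test_gradient_def vec_eq_iff zero_prod_def)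
  then show "0 \<in> ?T ` test_functions \<Omega>"
    by (intro image_eqI[where x = "\<lambda>x. 0"] test_functions_zero) (rule sym)
next
  fix a b assume "a \<in> ?T ` test_functions \<Omega>" "b \<in> ?T ` test_functions \<Omega>"
  then obtain h k where hk: "h \<in> test_functions \<Omega>" "k \<in> test_functions \<Omega>" "a = ?T h" "b = ?T k" by blast
  then have "a + b = ?T (\<lambda>x. h x + k x)"
    by (intro ext) (simp add: test_gradient_add[OF test_functions_C_k[OF hk(1)] test_functions_C_k[OF hk(2)]])
  then show "a + b \<in> ?T ` test_functions \<Omega>"
    using test_functions_add[OF hk(1,2)] by (rule image_eqI)
next
  fix c a assume "a \<in> ?T ` test_functions \<Omega>"
  then obtain h where h: "h \<in> test_functions \<Omega>" "a = ?T h" by blast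
  then have "c *\<^sub>R a = ?T (\<lambda>x. c *\<^sub>R h x)"
    by (intro ext) (simp add: scaleR_fun_def test_gradient_scaleR[OF test_functions_C_k[OF h(1)]])
  then show "c *\<^sub>R a \<in> ?T ` test_functions \<Omega>"
    using test_functions_bounded_linear[OF h(1) bounded_linear_scaleR_right] by (rule image_eqI)
qed

theorem theorem3p1:
  fixes \<Omega> :: "(real^'d::finite) set"
    and p :: ennreal
    and f :: "real^'d \<Rightarrow> real^'m::finite \<Rightarrow> real^'d^'m \<Rightarrow> real"
    and ld ud :: "real^'d \<Rightarrow> real^'m \<Rightarrow> real^'d^'m \<Rightarrow> (real \<times> (real^'m) \<times> (real^'d^'m)) set"
    and u0 us w1 :: "real^'d \<Rightarrow> real^'m"
    and w2 :: "real^'d \<Rightarrow> real^'d^'m"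
  assumes "open \<Omega>"
    and "1 \<le> p"
    and "codifferentiability_conditions \<Omega> p f ld ud"
    and "1 < p \<or> (bounded \<Omega> \<and> segment_property \<Omega>)"
    and "u0 \<in> W1p \<Omega> p"
    and "locally_optimal \<Omega> p f u0 us"
    and "measurable_selection (lebesgue_on \<Omega>)
           (\<lambda>x. ud x (us x) (weak_gradient \<Omega> us x)) (\<lambda>x. (0, w1 x, w2 x))"
  shows "\<exists>\<zeta> \<in> Lp_div \<Omega> (conj_exponent p).
           AE x in lebesgue_on \<Omega>.
             (0, weak_div_rows \<Omega> \<zeta> x, \<zeta> x)
               \<in> (\<lambda>z. z + (0, w1 x, w2 x)) ` ld x (us x) (weak_gradient \<Omega> us x)"
proof -
  note \<Omega> = assms(1) and p = assms(2) and cc = assms(3) and sel = assms(7)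
  let ?M = "lebesgue_on \<Omega>"
  have \<Omega>': "\<Omega> \<in> sets lebesgue" using \<Omega> by simp
  have p': "1 \<le> conj_exponent p" by (rule conj_exponent_ge_1[OF p])
  have us: "us \<in> W1p \<Omega> p"
    using admissible_W1p[OF \<Omega> p assms(5)] assms(6) by (simp add: locally_optimal_def)
  define g where "g = weak_gradient \<Omega> us"
  define A where "A x = ld x (us x) (g x)" for x
  define W where "W x = (w1 x, w2 x)" for x
  define \<Phi> where "\<Phi> x \<xi> = codiff_Phi (A x) \<xi> + W x \<bullet> \<xi>" for x and \<xi> :: "(real^'m) \<times> (real^'d^'m)"
  define T where "T = (\<lambda>(h :: real^'d \<Rightarrow> real^'m) x. (h x, test_gradient h x))"
  have us_Lp: "us \<in> Lp ?M p" "g \<in> Lp ?M p"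
    using W1p_D[OF \<Omega> us] by (auto simp: g_def)
  have cod: "AE x in ?M. \<forall>u \<xi>. has_codifferential (\<lambda>(u, \<xi>). f x u \<xi>) (ld x u \<xi>) (ud x u \<xi>) (u, \<xi>)"
    using cc by (simp add: codifferentiability_conditions_def Let_def)
  \<comment> \<open>The convex problem lives at the solution itself, so the norms of
    \<open>us\<close> and \<open>g\<close> are the majorants here.\<close>
  obtain \<sigma> where \<sigma>: "\<sigma> \<in> Lp ?M (conj_exponent p)" "\<And>x. 0 \<le> \<sigma> x"
    and \<sigma>_le: "AE x in ?M. \<forall>u \<xi>. norm u \<le> norm (us x) \<and> norm \<xi> \<le> norm (g x) \<longrightarrow>
      (\<forall>z\<in>ld x u \<xi> \<union> ud x u \<xi>. norm (snd z) \<le> \<sigma> x)"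
    using codifferential_growth[OF cc p Lp_norm_real[OF us_Lp(1)] _ Lp_norm_real[OF us_Lp(2)]] by auto
  have A_ok: "AE x in ?M. compact (A x) \<and> A x \<noteq> {} \<and> codiff_Phi (A x) 0 = 0 \<and> convex (A x)"
    using cod by eventually_elim (auto simp: A_def has_codifferential_def)
  have "AE x in ?M. (0, W x) \<in> ud x (us x) (g x)"
    using sel by (simp add: measurable_selection_def W_def g_def)
  from linearization_bound[OF cc \<sigma>_le _ _ this]
  have bnd: "AE x in ?M. (\<forall>z\<in>A x. norm (snd z) \<le> \<sigma> x) \<and> norm (W x) \<le> \<sigma> x \<and>
      (\<forall>\<xi>. \<bar>\<Phi> x \<xi>\<bar> \<le> 2 * \<sigma> x * norm \<xi>)"
    by (simp add: A_def \<Phi>_def)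
  have W_meas: "W \<in> borel_measurable ?M"
    unfolding W_def[abs_def] by (rule measurable_selection_components[OF sel])
  have \<sigma>_loc: "\<sigma> \<in> L1_loc \<Omega>" by (rule Lp_subset_L1_loc[OF p' \<sigma>(1) \<Omega>'])
  have "\<exists>v\<in>borel_measurable ?M. (AE x in ?M. \<forall>\<xi>. v x \<bullet> \<xi> \<le> \<Phi> x \<xi>) \<and>
      (\<forall>H\<in>T ` test_functions \<Omega>. (LINT x|?M. v x \<bullet> H x) = 0)"
  proof (rule integral_convex_selection[where \<kappa> = "\<lambda>x. 2 * \<sigma> x + 1"])
    show "sigma_finite_measure ?M" by (rule sigma_finite_lebesgue_on[OF \<Omega>'])
    show "(\<lambda>x. \<Phi> x (H x)) \<in> borel_measurable ?M" if "H \<in> borel_measurable ?M"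
      for H :: "real^'d \<Rightarrow> (real^'m) \<times> (real^'d^'m)"
      unfolding \<Phi>_def A_def
      by (intro borel_measurable_add borel_measurable_inner hypodifferential_measurable[OF \<Omega>' cc]
          that W_meas Lp_measurable[OF us_Lp(1)] Lp_measurable[OF us_Lp(2)])
    show "AE x in ?M. convex_on UNIV (\<Phi> x)"
      using A_ok
    proof eventually_elim
      case (elim x)
      have "convex_on UNIV (\<lambda>\<xi>. W x \<bullet> \<xi>)"
        by (rule convex_onI) (auto simp: inner_add_right)
      then show ?case
        unfolding \<Phi>_def[abs_def] using elim by (intro convex_on_add convex_codiff_Phi) auto
    qed
    show "(\<lambda>x. 2 * \<sigma> x + 1) \<in> borel_measurable ?M"
      using Lp_measurable[OF \<sigma>(1)] by measurable
    show "0 < 2 * \<sigma> x + 1" for x using \<sigma>(2)[of x] by simp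
    show "AE x in ?M. \<forall>\<xi>. \<bar>\<Phi> x \<xi>\<bar> \<le> (2 * \<sigma> x + 1) * norm \<xi>"
      using bnd
    proof eventually_elim
      case (elim x)
      show ?case
      proof
        fix \<xi> :: "(real^'m) \<times> (real^'d^'m)"
        have "\<bar>\<Phi> x \<xi>\<bar> \<le> 2 * \<sigma> x * norm \<xi>" using elim by blast
        then show "\<bar>\<Phi> x \<xi>\<bar> \<le> (2 * \<sigma> x + 1) * norm \<xi>"
          using norm_ge_zero[of \<xi>] unfolding distrib_right mult_1 by linarith
      qed
    qed
    show "subspace (T ` test_functions \<Omega>)"
      unfolding T_def by (rule test_pair_subspace)
    fix H assume "H \<in> T ` test_functions \<Omega>"
    then obtain h where h: "h \<in> test_functions \<Omega>" "H = T h" by blast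
    have "(\<lambda>x. 2 * \<sigma> x + 1) \<in> L1_loc \<Omega>"
      by (intro L1_loc_add L1_loc_bounded_linear[OF bounded_linear_mult_right \<sigma>_loc] continuous_L1_loc continuous_on_const)
    then show "H \<in> borel_measurable ?M" "integrable ?M (\<lambda>x. (2 * \<sigma> x + 1) * norm (H x))"
      unfolding h(2) T_def by (rule test_pair_integrable[OF \<Omega>' h(1)])+
    show "0 \<le> (LINT x|?M. \<Phi> x (H x))"
      using optimality_test_functions[OF \<Omega> p cc us assms(6) sel h(1)]
      by (simp add: \<Phi>_def A_def W_def g_def h(2) T_def)
  qed
  then obtain v where v_meas [measurable]: "v \<in> borel_measurable ?M"
    and v_le: "AE x in ?M. \<forall>\<xi>. v x \<bullet> \<xi> \<le> \<Phi> x \<xi>"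
    and v_test: "\<And>h. h \<in> test_functions \<Omega> \<Longrightarrow> (LINT x|?M. v x \<bullet> (h x, test_gradient h x)) = 0"
    by (auto simp: T_def)
  \<comment> \<open>Subtracting \<open>W x\<close> leaves a linear functional below the support
    function of the hypodifferential, and separation turns this into membership with first component
    0.\<close>
  have v_mem: "AE x in ?M. (0, v x - W x) \<in> A x"
    using v_le A_ok
  proof eventually_elim
    case (elim x)
    have "(v x - W x) \<bullet> \<xi> \<le> codiff_Phi (A x) \<xi>" for \<xi>
      using elim(1)[THEN spec, of \<xi>] unfolding \<Phi>_def inner_diff_left by linarith
    with elim(2) show ?case
      by (intro codiff_Phi_memI) blast+
  qed
  \<comment> \<open>\<open>v\<close> is the sum of \<open>v - W\<close> and \<open>W\<close>. The
    first is bounded by \<sigma> as an element of the hypodifferential, the second as the selection;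
    this places \<open>v\<close> in the conjugate space.\<close>
  have v_norm: "AE x in ?M. norm (v x) \<le> norm (2 *\<^sub>R \<sigma> x)"
    using v_mem bnd
  proof eventually_elim
    case (elim x)
    then have "norm (v x - W x) \<le> \<sigma> x" by force
    then show ?case
      using elim(2) norm_triangle_ineq[of "v x - W x" "W x"] \<sigma>(2)[of x] by simp
  qed
  have v_Lp: "v \<in> Lp ?M (conj_exponent p)"
    by (rule Lp_bound[OF p' Lp_scaleR[OF p' \<sigma>(1)] v_meas v_norm])
  define v1 where "v1 x = fst (v x)" for x
  define \<zeta> where "\<zeta> x = snd (v x)" for x
  have v_pair: "v x = (v1 x, \<zeta> x)" for x by (simp add: v1_def \<zeta>_def)
  have v1_meas: "v1 \<in> borel_measurable ?M" and \<zeta>_meas: "\<zeta> \<in> borel_measurable ?M"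
    unfolding v1_def[abs_def] \<zeta>_def[abs_def]
    using borel_measurable_continuous_on[OF continuous_on_fst[OF continuous_on_id] v_meas]
      borel_measurable_continuous_on[OF continuous_on_snd[OF continuous_on_id] v_meas] by auto
  have v1_Lp: "v1 \<in> Lp ?M (conj_exponent p)"
    by (rule Lp_bound[OF p' v_Lp v1_meas]) (auto simp: v_pair norm_fst_le)
  have \<zeta>_Lp: "\<zeta> \<in> Lp ?M (conj_exponent p)"
    by (rule Lp_bound[OF p' v_Lp \<zeta>_meas]) (auto simp: v_pair norm_snd_le)
  have v1_loc: "(\<lambda>x. v1 x $ i) \<in> L1_loc \<Omega>" for i
    by (rule L1_loc_bounded_linear[OF bounded_linear_vec_nth Lp_subset_L1_loc[OF p' v1_Lp \<Omega>']])
  have \<zeta>_loc: "(\<lambda>x. \<zeta> x $ i) \<in> L1_loc \<Omega>" for i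
    by (rule L1_loc_bounded_linear[OF bounded_linear_vec_nth Lp_subset_L1_loc[OF p' \<zeta>_Lp \<Omega>']])
  have div: "has_weak_div \<Omega> (\<lambda>y. \<zeta> y $ i) (\<lambda>x. v1 x $ i)" for i
    unfolding has_weak_div_def
  proof (intro conjI ballI v1_loc \<zeta>_loc)
    fix \<phi> :: "real^'d \<Rightarrow> real" assume \<phi>: "\<phi> \<in> test_functions \<Omega>"
    \<comment> \<open>A test function in the single component \<open>i\<close> has a gradient with
      the single nonzero row \<open>i\<close>, so the vector identity reduces to the scalar one for
      row \<open>i\<close> of \<zeta>.\<close>
    let ?h = "\<lambda>x. \<phi> x *\<^sub>R axis i 1 :: real^'m"
    have "?h \<in> test_functions \<Omega>"
      by (rule test_functions_bounded_linear[OF \<phi> bounded_linear_scaleR_left])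
    then have "(LINT x|?M. v x \<bullet> (?h x, test_gradient ?h x)) = 0" by (rule v_test)
    also have "(\<lambda>x. v x \<bullet> (?h x, test_gradient ?h x)) = (\<lambda>x. v1 x $ i * \<phi> x + \<zeta> x $ i \<bullet> grad \<phi> x)"
      by (rule ext) (simp add: v_pair test_gradient_axis[OF test_functions_C_k[OF \<phi>]] inner_axis mult.commute)
    also have "(LINT x|?M. v1 x $ i * \<phi> x + \<zeta> x $ i \<bullet> grad \<phi> x)
        = (LINT x|?M. v1 x $ i * \<phi> x) + (LINT x|?M. \<zeta> x $ i \<bullet> grad \<phi> x)"
    proof (rule Bochner_Integration.integral_add)
      show "integrable ?M (\<lambda>x. v1 x $ i * \<phi> x)"
        by (rule L1_loc_integrable_test(1)[OF \<Omega> v1_loc \<phi>])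
      have "(\<lambda>x. \<zeta> x $ i $ j) \<in> L1_loc \<Omega>" for j
        by (rule L1_loc_bounded_linear[OF bounded_linear_vec_nth \<zeta>_loc])
      then have "integrable ?M (\<lambda>x. \<Sum>j\<in>UNIV. \<zeta> x $ i $ j * frechet_derivative \<phi> (at x) (axis j 1))"
        by (intro Bochner_Integration.integrable_sum L1_loc_integrable_test(2)[OF \<Omega> _ \<phi>])
      then show "integrable ?M (\<lambda>x. \<zeta> x $ i \<bullet> grad \<phi> x)"
        by (simp add: inner_vec_def grad_nth)
    qed
    finally show "(LINT x|?M. v1 x $ i * \<phi> x) = - (LINT x|?M. \<zeta> x $ i \<bullet> grad \<phi> x)"
      by simp
  qed
  \<comment> \<open>The inclusion is stated for the chosen divergence, which agrees with
    \<open>v1\<close> only almost everywhere.\<close>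
  have "AE x in ?M. \<forall>i. weak_div \<Omega> (\<lambda>y. \<zeta> y $ i) x = v1 x $ i"
    by (rule eventually_all_finite) (rule weak_div_AE(2)[OF \<Omega> div])
  then have div_eq: "AE x in ?M. weak_div_rows \<Omega> \<zeta> x = v1 x"
    by eventually_elim (simp add: weak_div_rows_def vec_eq_iff)
  have "weak_div_rows \<Omega> \<zeta> \<in> borel_measurable ?M"
    unfolding weak_div_rows_def[abs_def]
  proof (rule borel_measurable_vec_lambda)
    show "(\<lambda>x. weak_div \<Omega> (\<lambda>y. \<zeta> y $ i) x) \<in> borel_measurable ?M" for i
      using weak_div_AE(1)[OF \<Omega> div[of i]] by (simp add: has_weak_div_def L1_loc_def)
  qed
  then have "weak_div_rows \<Omega> \<zeta> \<in> Lp ?M (conj_exponent p)"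
    using div_eq by (intro Lp_bound[OF p' v1_Lp]) (auto elim: eventually_mono)
  then have "\<zeta> \<in> Lp_div \<Omega> (conj_exponent p)"
    using \<zeta>_Lp div by (auto simp: Lp_div_def)
  moreover have "AE x in ?M. (0, weak_div_rows \<Omega> \<zeta> x, \<zeta> x)
      \<in> (\<lambda>z. z + (0, w1 x, w2 x)) ` ld x (us x) (weak_gradient \<Omega> us x)"
    using v_mem div_eq
  proof eventually_elim
    case (elim x)
    have "(0 :: real, weak_div_rows \<Omega> \<zeta> x, \<zeta> x) = (0, v x - W x) + (0, w1 x, w2 x)"
      by (simp add: elim(2) v_pair W_def)
    with elim(1) show ?case
      unfolding A_def g_def by (rule image_eqI[rotated])
  qed
  ultimately show ?thesis by blast
qed

end
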